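(* Let $v>0$, $c>0$ be constants with $\frac vc>\sqrt2$ and let $s\in\mathbb{R}$. There exists a constant $C>0$ such that for every $\gamma\ge1$ and all $\mathcal F^+\in L^2(\mathbb{R}^+;H^s_\gamma(\mathbb{R}^2))$, $\mathcal F^-\in L^2(\mathbb{R}^-;H^s_\gamma(\mathbb{R}^2))$ there exists a unique solution $f\in H^{s+1}_\gamma(\mathbb{R}^2)$ of the equation $$\left(\tau^2+v^2\eta^2\left(\frac{8\tau^2}{c^2(\mu^++\mu^-)^2}-1\right)\right)\widehat f+\frac{\mu^+\mu^-}{\mu^++\mu^-}\,M=0,\qquad \tau=\gamma+i\delta,\ (\delta,\eta)\in\mathbb{R}^2,$$ where $$M=M(\tau,\eta):=\frac1{\mu^+}\int_0^{+\infty}e^{-\mu^+y}\,\widehat{\mathcal F}^+(\cdot,y)\,dy-\frac1{\mu^-}\int_0^{+\infty}e^{-\mu^-y}\,\widehat{\mathcal F}^-(\cdot,-y)\,dy ,$$ and this solution satisfies the estimate $$\gamma^3\|f\|^2_{H^{s+1}_\gamma(\mathbb{R}^2)}\le C\left(\|\mathcal F^+\|^2_{L^2(\mathbb{R}^+;H^s_\gamma(\mathbb{R}^2))}+\|\mathcal F^-\|^2_{L^2(\mathbb{R}^-;H^s_\gamma(\mathbb{R}^2))}\right).$$ In particular $C$ is independent of $\mathcal F^\pm$ and $\gamma$.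
   Context: For $\Re\tau>0$ and $\eta\in\mathbb{R}$, $\mu^\pm=\mu^\pm(\tau,\eta)$ denotes the square root of $\left(\frac{\tau\pm iv\eta}{c}\right)^2+\eta^2$ with $\Re\mu^\pm>0$. Weighted spaces: points of $\mathbb{R}^2$ are $(t,x_1)$, with Fourier dual variables $(\delta,\eta)$, and $\tau=\gamma+i\delta$. For $s\in\mathbb{R}$, $\gamma\ge1$, set $\|u\|_{s,\gamma}^2=\frac1{(2\pi)^2}\iint_{\mathbb{R}^2}(\gamma^2+\delta^2+\eta^2)^s|\widehat u(\delta,\eta)|^2\,d\delta\,d\eta$, where here $\widehat u$ is the Fourier transform of $u$; $H^s_\gamma(\mathbb{R}^2)=\{u\in\mathcal D'(\mathbb{R}^2): e^{-\gamma t}u\in H^s(\mathbb{R}^2)\}$ with norm $\|u\|_{H^s_\gamma(\mathbb{R}^2)}=\|e^{-\gamma t}u\|_{s,\gamma}$; $L^2(\mathbb{R}^\pm;H^s_\gamma(\mathbb{R}^2))$ is the space of $u(t,x_1,x_2)$, $x_2\gtrless0$, with $\|u\|^2_{L^2(\mathbb{R}^\pm;H^s_\gamma(\mathbb{R}^2))}=\int_0^{+\infty}\|u(\cdot,\pm x_2)\|^2_{H^s_\gamma(\mathbb{R}^2)}\,dx_2<\infty$. In the equation, $\widehat f$ and $\widehat{\mathcal F}^\pm$ denote the Fourier transforms in $(t,x_1)$ of $e^{-\gamma t}f$ and $e^{-\gamma t}\mathcal F^\pm$ (with $x_2$ kept as a parameter), and the dot stands for $(\delta,\eta)$; the equation is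 meant for almost every $(\delta,\eta)\in\mathbb{R}^2$. *)

theory Defs
  imports "HOL-Analysis.Analysis" "HOL-Library.FuncSet"
begin

text \<open>
  Points of the plane are pairs \<open>(t, x)\<close>, dual points are pairs \<open>(\<delta>, \<eta>)\<close>; the product norm and the
  product inner product on \<^typ>\<open>real \<times> real\<close> are the Euclidean ones.
  All functions and distributions are complex valued.
\<close>

section \<open>Test functions and distributions on the plane\<close>

type_synonym planefun = "real \<times> real \<Rightarrow> complex"

definition d_t :: "planefun \<Rightarrow> planefun" where
  "d_t \<phi> = (\<lambda>(t, x). vector_derivative (\<lambda>t'. \<phi> (t', x)) (at t))"

definition d_x :: "planefun \<Rightarrow> planefun" where
  "d_x \<phi> = (\<lambda>(t, x). vector_derivative (\<lambda>x'. \<phi> (t, x')) (at x))"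

primrec Ck :: "nat \<Rightarrow> planefun \<Rightarrow> bool" where
  "Ck 0 \<phi> \<longleftrightarrow> continuous_on UNIV \<phi>"
| "Ck (Suc k) \<phi> \<longleftrightarrow> continuous_on UNIV \<phi> \<and>
     (\<forall>t x. (\<lambda>t'. \<phi> (t', x)) differentiable (at t)) \<and>
     (\<forall>t x. (\<lambda>x'. \<phi> (t, x')) differentiable (at x)) \<and>
     Ck k (d_t \<phi>) \<and> Ck k (d_x \<phi>)"

definition smooth :: "planefun \<Rightarrow> bool" where
  "smooth \<phi> \<longleftrightarrow> (\<forall>k. Ck k \<phi>)"

definition partial :: "nat \<Rightarrow> nat \<Rightarrow> planefun \<Rightarrow> planefun" where
  "partial j k \<phi> = (d_t ^^ j) ((d_x ^^ k) \<phi>)"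

definition support :: "planefun \<Rightarrow> (real \<times> real) set" where
  "support \<phi> = closure {p. \<phi> p \<noteq> 0}"

definition test_functions :: "planefun set" where
  "test_functions = {\<phi>. smooth \<phi> \<and> compact (support \<phi>)}"

definition schwartz_functions :: "planefun set" where
  "schwartz_functions = {\<phi>. smooth \<phi> \<and>
     (\<forall>N j k. bounded (range (\<lambda>p. (1 + norm p) ^ N * norm (partial j k \<phi> p))))}"

definition schwartz_seminorm :: "nat \<Rightarrow> planefun \<Rightarrow> real" where
  "schwartz_seminorm N \<phi> =
     (\<Sum>j\<le>N. \<Sum>k\<le>N. SUP p. (1 + norm p) ^ N * norm (partial j k \<phi> p))"

definition test_seminorm :: "nat \<Rightarrow> planefun \<Rightarrow> real" where
  "test_seminorm N \<phi> = (\<Sum>j\<le>N. \<Sum>k\<le>N. SUP p. norm (partial j k \<phi> p))"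

definition linear_functional_on :: "planefun set \<Rightarrow> (planefun \<Rightarrow> complex) \<Rightarrow> bool" where
  "linear_functional_on V u \<longleftrightarrow>
     (\<forall>\<phi>\<in>V. \<forall>\<psi>\<in>V. \<forall>a b. u (\<lambda>p. a * \<phi> p + b * \<psi> p) = a * u \<phi> + b * u \<psi>)"

text \<open>
  Functionals are taken extensional (\<open>undefined\<close> off the space they live on), so that equality
  of distributions is HOL equality.
\<close>

definition distributions :: "(planefun \<Rightarrow> complex) set" where
  "distributions = {u \<in> extensional test_functions. linear_functional_on test_functions u \<and>
     (\<forall>K. compact K \<longrightarrow> (\<exists>N B. \<forall>\<phi>\<in>test_functions. support \<phi> \<subseteq> K \<longrightarrow>
        norm (u \<phi>) \<le> B * test_seminorm N \<phi>))}"

definition tempered_distributions :: "(planefun \<Rightarrow> complex) set" where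
  "tempered_distributions = {W \<in> extensional schwartz_functions.
     linear_functional_on schwartz_functions W \<and>
     (\<exists>N B. \<forall>\<phi>\<in>schwartz_functions. norm (W \<phi>) \<le> B * schwartz_seminorm N \<phi>)}"

definition dist_diff :: "(planefun \<Rightarrow> complex) \<Rightarrow> (planefun \<Rightarrow> complex) \<Rightarrow> planefun \<Rightarrow> complex" where
  "dist_diff u w = (\<lambda>\<phi>\<in>test_functions. u \<phi> - w \<phi>)"

definition exp_weight :: "real \<Rightarrow> (planefun \<Rightarrow> complex) \<Rightarrow> planefun \<Rightarrow> complex" \<comment> \<open>\<open>u \<mapsto> e\<^sup>-\<^sup>\<gamma>\<^sup>t u\<close>\<close> where
  "exp_weight \<gamma> u = (\<lambda>\<phi>\<in>test_functions. u (\<lambda>p. of_real (exp (- \<gamma> * fst p)) * \<phi> p))"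

section \<open>Fourier transform\<close>

definition fourier :: "planefun \<Rightarrow> planefun" where
  "fourier \<phi> \<xi> = (\<integral>p. cis (- (\<xi> \<bullet> p)) * \<phi> p \<partial>lborel)"

definition fourier_tempered :: "(planefun \<Rightarrow> complex) \<Rightarrow> planefun \<Rightarrow> complex" where
  "fourier_tempered W = (\<lambda>\<phi>\<in>schwartz_functions. W (fourier \<phi>))"

definition regular_tempered :: "planefun \<Rightarrow> planefun \<Rightarrow> complex" where
  "regular_tempered g = (\<lambda>\<phi>\<in>schwartz_functions. \<integral>\<xi>. g \<xi> * \<phi> \<xi> \<partial>lborel)"

text \<open>
  The distribution \<open>w\<close> is (the restriction to test functions of) a tempered distribution whose
  Fourier transform is the function \<open>g\<close>. By density of the test functions in the Schwartz space,
  such a \<open>g\<close> is unique up to null sets.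
\<close>

definition has_fourier_fun :: "(planefun \<Rightarrow> complex) \<Rightarrow> planefun \<Rightarrow> bool" where
  "has_fourier_fun w g \<longleftrightarrow> g \<in> borel_measurable borel \<and>
     (\<forall>\<phi>\<in>schwartz_functions. integrable lborel (\<lambda>\<xi>. g \<xi> * \<phi> \<xi>)) \<and>
     (\<exists>W\<in>tempered_distributions.
        w = restrict W test_functions \<and> fourier_tempered W = regular_tempered g)"

definition fourier_fun :: "(planefun \<Rightarrow> complex) \<Rightarrow> planefun" where
  "fourier_fun w = (SOME g. has_fourier_fun w g)"

section \<open>Weighted Sobolev spaces\<close>

definition sobolev :: "real \<Rightarrow> (planefun \<Rightarrow> complex) set" where
  "sobolev s = {w \<in> distributions. \<exists>g. has_fourier_fun w g \<and>
     integrable lborel (\<lambda>(\<delta>, \<eta>). (1 + \<delta>\<^sup>2 + \<eta>\<^sup>2) powr s * (norm (g (\<delta>, \<eta>)))\<^sup>2)}"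

definition sobolev_norm :: "real \<Rightarrow> real \<Rightarrow> (planefun \<Rightarrow> complex) \<Rightarrow> real" where
  "sobolev_norm s \<gamma> w = sqrt (1 / (2 * pi)\<^sup>2 *
     (\<integral>(\<delta>, \<eta>). (\<gamma>\<^sup>2 + \<delta>\<^sup>2 + \<eta>\<^sup>2) powr s * (norm (fourier_fun w (\<delta>, \<eta>)))\<^sup>2 \<partial>lborel))"

definition Hsg :: "real \<Rightarrow> real \<Rightarrow> (planefun \<Rightarrow> complex) set" where
  "Hsg s \<gamma> = {u \<in> distributions. exp_weight \<gamma> u \<in> sobolev s}"

definition Hsg_norm :: "real \<Rightarrow> real \<Rightarrow> (planefun \<Rightarrow> complex) \<Rightarrow> real" where
  "Hsg_norm s \<gamma> u = sobolev_norm s \<gamma> (exp_weight \<gamma> u)"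

text \<open>
  The spaces of square integrable functions on a half line with values in \<^const>\<open>Hsg\<close>. The sign
  \<open>\<sigma>\<close> is \<open>1\<close> or \<open>-1\<close>, and the half line consists of the points \<open>\<sigma> * y\<close> with \<open>y > 0\<close>. Measurability
  is Bochner measurability: almost everywhere limit, in the norm, of simple functions.
\<close>

definition bochner_measurable ::
  "real \<Rightarrow> real \<Rightarrow> real \<Rightarrow> (real \<Rightarrow> planefun \<Rightarrow> complex) \<Rightarrow> bool" where
  "bochner_measurable \<sigma> s \<gamma> F \<longleftrightarrow> (\<exists>S :: nat \<Rightarrow> real \<Rightarrow> planefun \<Rightarrow> complex.
     (\<forall>n. finite (range (S n)) \<and> range (S n) \<subseteq> Hsg s \<gamma> \<and> (\<forall>u. S n -` {u} \<in> sets lebesgue)) \<and>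
     (AE y in lebesgue. y > 0 \<longrightarrow>
        (\<lambda>n. Hsg_norm s \<gamma> (dist_diff (S n y) (F (\<sigma> * y)))) \<longlonglongrightarrow> 0))"

definition L2_Hsg :: "real \<Rightarrow> real \<Rightarrow> real \<Rightarrow> (real \<Rightarrow> planefun \<Rightarrow> complex) set" where
  "L2_Hsg \<sigma> s \<gamma> = {F.
     (AE y in lebesgue. y > 0 \<longrightarrow> F (\<sigma> * y) \<in> Hsg s \<gamma>) \<and>
     bochner_measurable \<sigma> s \<gamma> F \<and>
     set_integrable lebesgue {0<..} (\<lambda>y. (Hsg_norm s \<gamma> (F (\<sigma> * y)))\<^sup>2)}"

definition L2_Hsg_norm :: "real \<Rightarrow> real \<Rightarrow> real \<Rightarrow> (real \<Rightarrow> planefun \<Rightarrow> complex) \<Rightarrow> real" where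
  "L2_Hsg_norm \<sigma> s \<gamma> F = sqrt (LINT y:{0<..}|lebesgue. (Hsg_norm s \<gamma> (F (\<sigma> * y)))\<^sup>2)"

section \<open>The equation\<close>

text \<open>\<open>\<mu>\<^sup>\<plusminus>\<close> is \<open>mu (\<plusminus>1)\<close>.\<close>

definition mu_arg :: "real \<Rightarrow> real \<Rightarrow> real \<Rightarrow> complex \<Rightarrow> real \<Rightarrow> complex" where
  "mu_arg \<sigma> v c \<tau> \<eta> =
     ((\<tau> + of_real \<sigma> * \<i> * of_real v * of_real \<eta>) / of_real c)\<^sup>2 + (of_real \<eta>)\<^sup>2"

definition mu :: "real \<Rightarrow> real \<Rightarrow> real \<Rightarrow> complex \<Rightarrow> real \<Rightarrow> complex" where
  "mu \<sigma> v c \<tau> \<eta> = csqrt (mu_arg \<sigma> v c \<tau> \<eta>)"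

lemma mu_Re_pos:
  assumes "Re \<tau> > 0" "c > 0"
  shows "Re (mu \<sigma> v c \<tau> \<eta>) > 0"
proof (rule ccontr)
  let ?m = "mu \<sigma> v c \<tau> \<eta>"
  define a where "a = Re \<tau> / c"
  define b where "b = (Im \<tau> + \<sigma> * v * \<eta>) / c"
  assume "\<not> Re ?m > 0"
  moreover have "Re ?m \<ge> 0" unfolding mu_def by (rule Re_csqrt)
  ultimately have R: "Re ?m = 0" by simp
  have sq: "?m\<^sup>2 = (Complex a b)\<^sup>2 + (of_real \<eta>)\<^sup>2"
  proof -
    have "(\<tau> + of_real \<sigma> * \<i> * of_real v * of_real \<eta>) / of_real c = Complex a b"
      by (simp add: complex_eq_iff a_def b_def)
    then show ?thesis by (simp add: mu_def mu_arg_def)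
  qed
  have "Im (?m\<^sup>2) = 0" "Re (?m\<^sup>2) \<le> 0" using R by (simp_all add: power2_eq_square)
  then have "2 * a * b = 0" "a\<^sup>2 - b\<^sup>2 + \<eta>\<^sup>2 \<le> 0"
    unfolding sq by (simp_all add: power2_eq_square)
  moreover have "a > 0" using assms by (simp add: a_def)
  ultimately have "b = 0" "a\<^sup>2 + \<eta>\<^sup>2 \<le> 0" by auto
  moreover have "a\<^sup>2 > 0" using \<open>a > 0\<close> by simp
  moreover have "\<eta>\<^sup>2 \<ge> 0" by simp
  ultimately show False by linarith
qed

lemma mu_eq_iff:
  assumes "Re \<tau> > 0" "c > 0"
  shows "m = mu \<sigma> v c \<tau> \<eta> \<longleftrightarrow> m\<^sup>2 = mu_arg \<sigma> v c \<tau> \<eta> \<and> Re m > 0"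
proof
  assume "m = mu \<sigma> v c \<tau> \<eta>"
  then show "m\<^sup>2 = mu_arg \<sigma> v c \<tau> \<eta> \<and> Re m > 0"
    using mu_Re_pos[OF assms] by (simp add: mu_def)
next
  assume m: "m\<^sup>2 = mu_arg \<sigma> v c \<tau> \<eta> \<and> Re m > 0"
  then have "csqrt (m\<^sup>2) = m" by (intro csqrt_square) simp
  with m show "m = mu \<sigma> v c \<tau> \<eta>" by (simp add: mu_def)
qed

text \<open>
  \<open>G\<close> is the Fourier transform in the tangential variables of \<open>e\<^sup>-\<^sup>\<gamma>\<^sup>t F\<close>, with the normal variable
  \<open>y\<close> as a parameter. Each slice \<open>G (\<cdot>, y)\<close> is determined only up to null sets of frequencies, so the
  joint measurability of \<open>G\<close> is needed for integrals in \<open>y\<close> at fixed frequency to make sense;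
  by Fubini they are then determined for almost every frequency.
\<close>

definition has_tangential_fourier ::
  "real \<Rightarrow> real \<Rightarrow> (real \<Rightarrow> planefun \<Rightarrow> complex) \<Rightarrow> ((real \<times> real) \<times> real \<Rightarrow> complex) \<Rightarrow> bool" where
  "has_tangential_fourier \<sigma> \<gamma> F G \<longleftrightarrow> G \<in> borel_measurable borel \<and>
     (AE y in lebesgue. y > 0 \<longrightarrow>
        has_fourier_fun (exp_weight \<gamma> (F (\<sigma> * y))) (\<lambda>\<xi>. G (\<xi>, \<sigma> * y)))"

definition M_term :: "real \<Rightarrow> real \<Rightarrow> ((real \<times> real) \<times> real \<Rightarrow> complex) \<Rightarrow>
    ((real \<times> real) \<times> real \<Rightarrow> complex) \<Rightarrow> real \<Rightarrow> real \<Rightarrow> real \<Rightarrow> complex" where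
  "M_term v c Gp Gm \<gamma> \<delta> \<eta> =
     (let \<tau> = Complex \<gamma> \<delta>; \<mu>p = mu 1 v c \<tau> \<eta>; \<mu>m = mu (-1) v c \<tau> \<eta> in
        1 / \<mu>p * (LINT y:{0<..}|lborel. exp (- \<mu>p * of_real y) * Gp ((\<delta>, \<eta>), y))
      - 1 / \<mu>m * (LINT y:{0<..}|lborel. exp (- \<mu>m * of_real y) * Gm ((\<delta>, \<eta>), - y)))"

definition solves_equation :: "real \<Rightarrow> real \<Rightarrow> real \<Rightarrow> (real \<Rightarrow> planefun \<Rightarrow> complex) \<Rightarrow>
    (real \<Rightarrow> planefun \<Rightarrow> complex) \<Rightarrow> (planefun \<Rightarrow> complex) \<Rightarrow> bool" where
  "solves_equation v c \<gamma> Fp Fm f \<longleftrightarrow> (\<exists>fhat Gp Gm.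
     has_fourier_fun (exp_weight \<gamma> f) fhat \<and>
     has_tangential_fourier 1 \<gamma> Fp Gp \<and>
     has_tangential_fourier (-1) \<gamma> Fm Gm \<and>
     (AE (\<delta>, \<eta>) in lborel.
        let \<tau> = Complex \<gamma> \<delta>; \<mu>p = mu 1 v c \<tau> \<eta>; \<mu>m = mu (-1) v c \<tau> \<eta> in
          (\<tau>\<^sup>2 + (of_real v)\<^sup>2 * (of_real \<eta>)\<^sup>2 *
             (8 * \<tau>\<^sup>2 / ((of_real c)\<^sup>2 * (\<mu>p + \<mu>m)\<^sup>2) - 1)) * fhat (\<delta>, \<eta>)
          + \<mu>p * \<mu>m / (\<mu>p + \<mu>m) * M_term v c Gp Gm \<gamma> \<delta> \<eta> = 0))"

end

theory Submission
  imports Defs "HOL-Probability.Probability"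
begin

text \<open>
  Let \<open>w = v / c\<close>, \<open>T = (\<tau> / c)\<^sup>2\<close> and \<open>\<Lambda>\<^sup>2 = \<gamma>\<^sup>2 + \<delta>\<^sup>2 + \<eta>\<^sup>2\<close>. The difference of the squares of \<open>\<mu>\<^sup>+\<close> and
  \<open>\<mu>\<^sup>-\<close> is \<open>4 \<i> \<tau> v \<eta> / c\<^sup>2\<close>, so the coefficient of the transform of \<open>f\<close> equals \<open>c\<^sup>2 (\<mu>\<^sup>+ \<mu>\<^sup>- - \<eta>\<^sup>2)\<close>. Multiplied by
  \<open>\<mu>\<^sup>+ \<mu>\<^sup>- + \<eta>\<^sup>2\<close> it becomes \<open>c\<^sup>2 (T + a \<eta>\<^sup>2) (T + b \<eta>\<^sup>2)\<close> with \<open>a, b = 1 + w\<^sup>2 \<mp> sqrt (1 + 4 w\<^sup>2)\<close>, and both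
  \<open>a\<close> and \<open>b\<close> are positive exactly when \<open>w > sqrt 2\<close>. Its zeros are then purely imaginary and simple, which gives
  the lower bound \<open>\<bar>coefficient\<bar> \<bar>\<mu>\<^sup>+ + \<mu>\<^sup>-\<bar> \<ge> K \<gamma> \<Lambda> \<bar>\<mu>\<^sup>\<plusminus>\<bar>\<close>. The Cauchy-Schwarz inequality in \<open>y\<close> costs only
  \<open>1 / Re \<mu>\<^sup>\<plusminus>\<close>, which is at most a multiple of \<open>1 / \<gamma>\<close>, and the estimate follows pointwise in frequency.
  The equation determines the transform of \<open>f\<close>, so existence and uniqueness come from Fourier inversion.
  The transform of \<open>\<F>\<^sup>\<plusminus>\<close> is given for each \<open>y\<close> only up to a null set of frequencies; the integral over \<open>y\<close> requires a
  version of it that is jointly measurable.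
\<close>

section \<open>The symbol\<close>

text \<open>Write p, q for the two roots, with \<gamma> and \<delta> divided by c, and Y1, Y2 for
  the square roots of a, b. The product identity cannot be used everywhere: the boundary zeros
  \<delta> = \<plusminus> Y2 \<eta> of its second factor are zeros of pq + \<eta>^2, not of pq -
  \<eta>^2, and bounding pq + \<eta>^2 from above there would ruin the estimate. Hence the split at
  |\<delta>| = w |\<eta>|. Above it, Im p and Im q do not have opposite signs, and p + q and pq -
  \<eta>^2 are bounded below directly; below it, only the zeros \<plusminus> Y1 \<eta> matter. The
  sum p + q stays in the bound because it degenerates too, at \<tau> = 0; as Y1 > 0 this zero is
  separated from the other two, so the product loses a single factor \<gamma>. After solving, each
  Laplace integral carries p / ((p + q) S) or q / ((p + q) S), with S the coefficient; this is why a
  root stands on the small side of the lower bound. In the estimate, \<gamma>^3 is two powers from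
  squaring this factor and one from the Cauchy-Schwarz inequality, and 1 / \<Lambda>^2 is the
  passage from s to s + 1.\<close>

lemma sqrt_parts:
  fixes p :: complex
  assumes "p\<^sup>2 = (Complex a b)\<^sup>2 + (of_real \<eta>)\<^sup>2"
  shows "Re p * Im p = a * b" "(Re p)\<^sup>2 - (Im p)\<^sup>2 = a\<^sup>2 - b\<^sup>2 + \<eta>\<^sup>2"
    "(norm p)\<^sup>2 \<le> a\<^sup>2 + b\<^sup>2 + \<eta>\<^sup>2"
proof -
  have "Im (p\<^sup>2) = Im ((Complex a b)\<^sup>2 + (of_real \<eta>)\<^sup>2)" "Re (p\<^sup>2) = Re ((Complex a b)\<^sup>2 + (of_real \<eta>)\<^sup>2)"
    using assms by simp_all
  then show "Re p * Im p = a * b" "(Re p)\<^sup>2 - (Im p)\<^sup>2 = a\<^sup>2 - b\<^sup>2 + \<eta>\<^sup>2"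
    by (simp_all add: power2_eq_square mult.commute)
  have "(norm p)\<^sup>2 = norm ((Complex a b)\<^sup>2 + (of_real \<eta>)\<^sup>2)"
    by (metis assms norm_power)
  also have "\<dots> \<le> norm ((Complex a b)\<^sup>2) + norm ((complex_of_real \<eta>)\<^sup>2)" by (rule norm_triangle_ineq)
  also have "\<dots> = a\<^sup>2 + b\<^sup>2 + \<eta>\<^sup>2" by (simp add: norm_power cmod_power2)
  finally show "(norm p)\<^sup>2 \<le> a\<^sup>2 + b\<^sup>2 + \<eta>\<^sup>2" .
qed

text \<open>Eliminating \<open>Im p\<close> from the two real equations gives (x^2 - a^2)(x^2 + b^2)
  = x^2 \<eta>^2 with x = \<open>Re p\<close>. The right-hand side is nonnegative, so x^2 cannot
  fall below a^2; inserting this in the equation for the real part of p^2 gives the bound on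
  \<open>Im p\<close>.\<close>

lemma sqrt_Re_ge:
  fixes p :: complex
  assumes "p\<^sup>2 = (Complex a b)\<^sup>2 + (of_real \<eta>)\<^sup>2" "Re p > 0" "a > 0"
  shows "Re p \<ge> a" "(Im p)\<^sup>2 \<ge> b\<^sup>2 - \<eta>\<^sup>2"
proof -
  define x y where "x = Re p" and "y = Im p"
  note s = sqrt_parts(1,2)[OF assms(1), folded x_def y_def]
  have "x\<^sup>2 * (x\<^sup>2 - y\<^sup>2) = x^4 - (x*y)\<^sup>2" by (simp add: power2_eq_square power4_eq_xxxx algebra_simps)
  then have "x\<^sup>2 * (a\<^sup>2 - b\<^sup>2 + \<eta>\<^sup>2) = x^4 - (a*b)\<^sup>2" using s by simp
  then have e: "(x\<^sup>2 - a\<^sup>2) * (x\<^sup>2 + b\<^sup>2) = x\<^sup>2 * \<eta>\<^sup>2"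
    by (simp add: power2_eq_square power4_eq_xxxx algebra_simps)
  have "x\<^sup>2 \<ge> a\<^sup>2"
  proof (rule ccontr)
    assume "\<not> x\<^sup>2 \<ge> a\<^sup>2"
    moreover have "x\<^sup>2 + b\<^sup>2 > 0" using assms by (simp add: x_def add_pos_nonneg)
    ultimately have "(x\<^sup>2 - a\<^sup>2) * (x\<^sup>2 + b\<^sup>2) < 0" by (simp add: mult_neg_pos)
    moreover have "x\<^sup>2 * \<eta>\<^sup>2 \<ge> 0" by simp
    ultimately show False using e by linarith
  qed
  then show "Re p \<ge> a" using assms by (metis less_imp_le power2_le_imp_le x_def)
  show "(Im p)\<^sup>2 \<ge> b\<^sup>2 - \<eta>\<^sup>2" using s(2) \<open>x\<^sup>2 \<ge> a\<^sup>2\<close> by (simp add: y_def[symmetric])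
qed

text \<open>Since |\<delta>| dominates w |\<eta>|, the shifted frequencies
  \<open>\<delta> + w * \<eta>\<close> and \<open>\<delta> - w * \<eta>\<close> do not have opposite
  signs, and hence neither do \<open>Im p\<close> and \<open>Im q\<close>. Nothing cancels in p + q,
  which is at least the square root of \<open>L\<close>, nor in the imaginary part of pq.\<close>

lemma symbol_case_hyperbolic:
  fixes p q :: complex
  assumes w: "w\<^sup>2 > 2" "w > 0" and a: "a > 0" and pq: "Re p > 0" "Re q > 0"
    and p: "p\<^sup>2 = (Complex a (\<delta> + w * \<eta>))\<^sup>2 + (of_real \<eta>)\<^sup>2"
    and q: "q\<^sup>2 = (Complex a (\<delta> - w * \<eta>))\<^sup>2 + (of_real \<eta>)\<^sup>2"
    and \<delta>: "\<bar>\<delta>\<bar> \<ge> w * \<bar>\<eta>\<bar>"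
  shows "norm (p * q - (of_real \<eta>)\<^sup>2) * norm (p + q) \<ge> 1/3 * a * (a\<^sup>2 + \<delta>\<^sup>2 + \<eta>\<^sup>2)"
proof -
  define x y x' y' where "x = Re p" and "y = Im p" and "x' = Re q" and "y' = Im q"
  define L where "L = a\<^sup>2 + \<delta>\<^sup>2 + \<eta>\<^sup>2"
  note s = sqrt_parts(1,2)[OF p, folded x_def y_def] sqrt_parts(1,2)[OF q, folded x'_def y'_def]
  note r = sqrt_Re_ge[OF p pq(1) a, folded x_def y_def] sqrt_Re_ge[OF q pq(2) a, folded x'_def y'_def]
  have \<delta>2: "\<delta>\<^sup>2 \<ge> w\<^sup>2 * \<eta>\<^sup>2"
  proof -
    have "(w * \<bar>\<eta>\<bar>)\<^sup>2 \<le> \<bar>\<delta>\<bar>\<^sup>2" using \<delta> w by (intro power_mono) auto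
    then show ?thesis by (simp add: power_mult_distrib)
  qed
  have we: "w\<^sup>2 * \<eta>\<^sup>2 \<ge> 2 * \<eta>\<^sup>2" using w by (intro mult_right_mono) auto
  have bd: "(\<delta> + w * \<eta>) * (\<delta> - w * \<eta>) = \<delta>\<^sup>2 - w\<^sup>2 * \<eta>\<^sup>2"
    by (simp add: power2_eq_square algebra_simps)
  have xx: "x * x' \<ge> a\<^sup>2" using r a by (simp add: power2_eq_square mult_mono)
  have xx0: "x * x' > 0" using pq by (simp add: x_def x'_def)
  have yy: "(x * x') * (y * y') = a\<^sup>2 * (\<delta>\<^sup>2 - w\<^sup>2 * \<eta>\<^sup>2)"
    using s(1,3) bd by (simp add: power2_eq_square) (metis (no_types, opaque_lifting) mult.assoc mult.left_commute)
  have yy0: "y * y' \<ge> 0"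
  proof -
    have "(x * x') * (y * y') \<ge> 0" unfolding yy using \<delta>2 by simp
    then show ?thesis using xx0 zero_le_mult_iff[of "x*x'" "y*y'"] by linarith
  qed
  have yy1: "y * y' \<le> \<delta>\<^sup>2 - w\<^sup>2 * \<eta>\<^sup>2"
  proof -
    have "a\<^sup>2 * (y * y') \<le> (x * x') * (y * y')" using xx yy0 by (intro mult_right_mono)
    then show ?thesis unfolding yy using a by simp
  qed
  \<comment> \<open>One of the two shifted frequencies has modulus |\<delta>| + w |\<eta>|, so a
    single imaginary part already gives \<delta>^2 + (w^2 - 1) \<eta>^2; here w^2 > 2
    enters.\<close>
  have y2: "y\<^sup>2 + y'\<^sup>2 \<ge> \<delta>\<^sup>2 + \<eta>\<^sup>2"
  proof -
    have *: "(\<bar>\<delta>\<bar> + w * \<bar>\<eta>\<bar>)\<^sup>2 \<ge> \<delta>\<^sup>2 + w\<^sup>2 * \<eta>\<^sup>2"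
      using w by (simp add: power2_sum power_mult_distrib)
    have "\<bar>\<delta>\<bar> + w * \<bar>\<eta>\<bar> = \<bar>\<delta> + w * \<eta>\<bar> \<or> \<bar>\<delta>\<bar> + w * \<bar>\<eta>\<bar> = \<bar>\<delta> - w * \<eta>\<bar>"
    proof -
      have "w * \<bar>\<eta>\<bar> = \<bar>w * \<eta>\<bar>" using w by (simp add: abs_mult)
      then show ?thesis by linarith
    qed
    then have "(\<bar>\<delta>\<bar> + w * \<bar>\<eta>\<bar>)\<^sup>2 = (\<delta> + w * \<eta>)\<^sup>2 \<or> (\<bar>\<delta>\<bar> + w * \<bar>\<eta>\<bar>)\<^sup>2 = (\<delta> - w * \<eta>)\<^sup>2"
      by (metis power2_abs)
    then have "y\<^sup>2 \<ge> \<delta>\<^sup>2 + w\<^sup>2 * \<eta>\<^sup>2 - \<eta>\<^sup>2 \<or> y'\<^sup>2 \<ge> \<delta>\<^sup>2 + w\<^sup>2 * \<eta>\<^sup>2 - \<eta>\<^sup>2"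
      using r * by linarith
    then show ?thesis using we zero_le_power2[of y] zero_le_power2[of y'] zero_le_power2[of \<eta>] by linarith
  qed
  have sum: "norm (p + q) \<ge> sqrt L"
  proof (rule power2_le_imp_le)
    have "(norm (p + q))\<^sup>2 = (x + x')\<^sup>2 + (y + y')\<^sup>2" by (simp add: cmod_power2 x_def x'_def y_def y'_def)
    moreover have "(x + x')\<^sup>2 \<ge> a\<^sup>2" using r a by (intro power_mono) auto
    moreover have "(y + y')\<^sup>2 \<ge> y\<^sup>2 + y'\<^sup>2" using yy0 by (simp add: power2_sum mult.commute)
    moreover have "(sqrt L)\<^sup>2 = L" by (simp add: L_def)
    ultimately show "(sqrt L)\<^sup>2 \<le> (norm (p + q))\<^sup>2" using y2 by (simp add: L_def)
  qed simp
  have prd: "norm (p * q - (of_real \<eta>)\<^sup>2) \<ge> 1/3 * a * sqrt L"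
  proof (rule power2_le_imp_le)
    define R where "R = x * x' - y * y' - \<eta>\<^sup>2"
    define I where "I = x * y' + y * x'"
    have n: "(norm (p * q - (of_real \<eta>)\<^sup>2))\<^sup>2 = R\<^sup>2 + I\<^sup>2"
      by (simp add: cmod_power2 R_def I_def x_def x'_def y_def y'_def flip: of_real_power)
    have R: "R \<ge> a\<^sup>2 - \<delta>\<^sup>2" using xx yy1 we zero_le_power2[of \<eta>] unfolding R_def by linarith
    have I: "I\<^sup>2 \<ge> a\<^sup>2 * \<delta>\<^sup>2"
    proof -
      have "I\<^sup>2 = x\<^sup>2 * y'\<^sup>2 + x'\<^sup>2 * y\<^sup>2 + 2 * ((x * x') * (y * y'))"
        by (simp add: I_def power2_eq_square algebra_simps)
      moreover have "x\<^sup>2 * y'\<^sup>2 \<ge> a\<^sup>2 * y'\<^sup>2" "x'\<^sup>2 * y\<^sup>2 \<ge> a\<^sup>2 * y\<^sup>2"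
        using r a by (auto intro!: mult_right_mono power_mono)
      moreover have "(x * x') * (y * y') \<ge> 0" using xx0 yy0 by simp
      moreover have "a\<^sup>2 * \<delta>\<^sup>2 \<le> a\<^sup>2 * (y\<^sup>2 + y'\<^sup>2)" using y2 zero_le_power2[of \<eta>]
        by (intro mult_left_mono) (linarith, simp)
      ultimately show ?thesis by (simp add: algebra_simps)
    qed
    have Lb: "L \<le> a\<^sup>2 + 3/2 * \<delta>\<^sup>2" using \<delta>2 we by (simp add: L_def)
    \<comment> \<open>For \<delta>^2 at least a^2 / 4 the imaginary part alone suffices, as
      \<open>L\<close> is then at most 9 \<delta>^2; below this threshold \<open>R\<close> is at
      least 3 a^2 / 4. The 9 is the square of the 3 in the constant.\<close>
    have goal: "9 * (R\<^sup>2 + I\<^sup>2) \<ge> a\<^sup>2 * L"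
    proof (cases "\<delta>\<^sup>2 \<ge> a\<^sup>2 / 4")
      case True
      then have "L \<le> 9 * \<delta>\<^sup>2" using Lb zero_le_power2[of a] by linarith
      then have "a\<^sup>2 * L \<le> a\<^sup>2 * (9 * \<delta>\<^sup>2)" by (intro mult_left_mono) auto
      then have "a\<^sup>2 * L \<le> 9 * (a\<^sup>2 * \<delta>\<^sup>2)" by (simp add: algebra_simps)
      also have "a\<^sup>2 * \<delta>\<^sup>2 \<le> R\<^sup>2 + I\<^sup>2" using I by (simp add: add_increasing)
      finally show ?thesis by simp
    next
      case False
      then have "R \<ge> 3/4 * a\<^sup>2" using R by linarith
      then have "R\<^sup>2 \<ge> (3/4 * a\<^sup>2)\<^sup>2" by (intro power_mono) auto
      then have "R\<^sup>2 \<ge> 9/16 * (a\<^sup>2 * a\<^sup>2)" by (simp add: power2_eq_square)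
      moreover have "a\<^sup>2 * L \<le> a\<^sup>2 * (2 * a\<^sup>2)" using Lb False zero_le_power2[of a]
        by (intro mult_left_mono) linarith+
      moreover have "0 \<le> a\<^sup>2 * a\<^sup>2" by simp
      ultimately have "a\<^sup>2 * L \<le> 9 * R\<^sup>2" by linarith
      also have "\<dots> \<le> 9 * (R\<^sup>2 + I\<^sup>2)" by simp
      finally show ?thesis .
    qed
    have "(1/3 * a * sqrt L)\<^sup>2 = 1/9 * (a\<^sup>2 * L)"
      by (simp add: power_mult_distrib L_def power2_eq_square field_simps)
    then show "(1/3 * a * sqrt L)\<^sup>2 \<le> (norm (p * q - (of_real \<eta>)\<^sup>2))\<^sup>2" unfolding n using goal by simp
  qed simp
  have "(1/3 * a * sqrt L) * sqrt L \<le> norm (p * q - (of_real \<eta>)\<^sup>2) * norm (p + q)"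
    using prd sum a by (intro mult_mono) (auto simp: L_def)
  moreover have "(1/3 * a * sqrt L) * sqrt L = 1/3 * a * L" by (simp add: L_def)
  ultimately have "1/3 * a * L \<le> norm (p * q - (of_real \<eta>)\<^sup>2) * norm (p + q)" by (simp only:)
  then show ?thesis by (simp only: L_def)
qed

text \<open>The form splits as (\<tau> + i Y \<eta>)(\<tau> - i Y \<eta>) with \<tau> =
  \<open>Complex a \<delta>\<close>, so its modulus is the product of the distances from \<tau> to
  the two imaginary zeros.\<close>

lemma norm_quadratic_factor:
  "(norm ((Complex a \<delta>)\<^sup>2 + of_real (Y\<^sup>2 * \<eta>\<^sup>2)))\<^sup>2 = (a\<^sup>2 + (\<delta> + Y * \<eta>)\<^sup>2) * (a\<^sup>2 + (\<delta> - Y * \<eta>)\<^sup>2)"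
proof -
  have "(Complex a \<delta>)\<^sup>2 + of_real (Y\<^sup>2 * \<eta>\<^sup>2) = Complex a (\<delta> + Y * \<eta>) * Complex a (\<delta> - Y * \<eta>)"
    by (simp add: complex_eq_iff power2_eq_square algebra_simps)
  then show ?thesis by (simp add: norm_mult power_mult_distrib cmod_power2)
qed

text \<open>Expanding p^2 q^2 - \<eta>^4 gives a quadratic polynomial in \<tau>^2; the hypotheses on
  \<open>Y1\<close> and \<open>Y2\<close> are Vieta's relations for its roots
  \<open>- Y1\<^sup>2 * \<eta>\<^sup>2\<close> and
  \<open>- Y2\<^sup>2 * \<eta>\<^sup>2\<close>.\<close>

lemma product_of_roots:
  fixes p q :: complex and a \<delta> \<eta> w :: real
  defines "\<tau> \<equiv> Complex a \<delta>"
  assumes p: "p\<^sup>2 = (Complex a (\<delta> + w * \<eta>))\<^sup>2 + (of_real \<eta>)\<^sup>2"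
    and q: "q\<^sup>2 = (Complex a (\<delta> - w * \<eta>))\<^sup>2 + (of_real \<eta>)\<^sup>2"
    and Y: "Y1\<^sup>2 + Y2\<^sup>2 = 2 * (1 + w\<^sup>2)" "Y1\<^sup>2 * Y2\<^sup>2 = w^4 - 2 * w\<^sup>2"
  shows "(p * q - (of_real \<eta>)\<^sup>2) * (p * q + (of_real \<eta>)\<^sup>2)
     = (\<tau>\<^sup>2 + of_real (Y1\<^sup>2 * \<eta>\<^sup>2)) * (\<tau>\<^sup>2 + of_real (Y2\<^sup>2 * \<eta>\<^sup>2))"
proof -
  let ?e = "complex_of_real \<eta>" and ?w = "complex_of_real w"
  have c: "Complex a (\<delta> + w * \<eta>) = \<tau> + \<i> * ?w * ?e" "Complex a (\<delta> - w * \<eta>) = \<tau> - \<i> * ?w * ?e"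
    by (simp_all add: complex_eq_iff \<tau>_def)
  have "(p * q - ?e\<^sup>2) * (p * q + ?e\<^sup>2) = p\<^sup>2 * q\<^sup>2 - ?e^4" by algebra
  also have "\<dots> = ((\<tau> + \<i> * ?w * ?e)\<^sup>2 + ?e\<^sup>2) * ((\<tau> - \<i> * ?w * ?e)\<^sup>2 + ?e\<^sup>2) - ?e^4"
    using p q c by simp
  also have "\<dots> = (\<tau>\<^sup>2)\<^sup>2 + \<tau>\<^sup>2 * (2 * (1 + ?w\<^sup>2)) * ?e\<^sup>2 + (?w^4 - 2 * ?w\<^sup>2) * ?e^4"
    using i_squared by algebra
  also have "2 * (1 + ?w\<^sup>2) = of_real Y1 ^ 2 + of_real Y2 ^ 2"
    using arg_cong[OF Y(1), of complex_of_real] by simp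
  also have "?w^4 - 2 * ?w\<^sup>2 = of_real Y1 ^ 2 * of_real Y2 ^ 2"
    using arg_cong[OF Y(2), of complex_of_real] by simp
  finally show ?thesis by (simp add: algebra_simps power2_eq_square power4_eq_xxxx)
qed

text \<open>Because \<open>1 + w \<le> Y2\<close>, \<delta> keeps distance at least |\<eta>| from
  \<plusminus> Y2 \<eta>, so the second factor in \<open>product_of_roots\<close> is at least a
  multiple of L. Dividing by pq + \<eta>^2, which is at most a multiple of L, then costs only a
  constant. What remains is \<open>Q1 * norm (p + q)\<close>, where \<open>Q1\<close> degenerates
  only near \<delta> = \<plusminus> Y1 \<eta> and p + q only near \<tau> = 0.\<close>

lemma symbol_case_elliptic:
  fixes p q :: complex
  assumes w: "w\<^sup>2 > 2" "w > 0" and a: "a > 0" and pq: "Re p > 0" "Re q > 0"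
    and p: "p\<^sup>2 = (Complex a (\<delta> + w * \<eta>))\<^sup>2 + (of_real \<eta>)\<^sup>2"
    and q: "q\<^sup>2 = (Complex a (\<delta> - w * \<eta>))\<^sup>2 + (of_real \<eta>)\<^sup>2"
    and \<delta>: "\<bar>\<delta>\<bar> < w * \<bar>\<eta>\<bar>"
    and Y: "Y1\<^sup>2 + Y2\<^sup>2 = 2 * (1 + w\<^sup>2)" "Y1\<^sup>2 * Y2\<^sup>2 = w^4 - 2 * w\<^sup>2" "0 < Y1" "Y1 \<le> w" "1 + w \<le> Y2"
  defines "D \<equiv> 4 * w\<^sup>2 + 2"
  shows "norm (p * q - (of_real \<eta>)\<^sup>2) * norm (p + q) \<ge> Y1\<^sup>2 / D ^ 4 * a * (a\<^sup>2 + \<delta>\<^sup>2 + \<eta>\<^sup>2)"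
proof -
  define L where "L = a\<^sup>2 + \<delta>\<^sup>2 + \<eta>\<^sup>2"
  define \<tau> where "\<tau> = Complex a \<delta>"
  define A where "A = norm (p * q - (of_real \<eta>)\<^sup>2)"
  define Q1 where "Q1 = norm (\<tau>\<^sup>2 + of_real (Y1\<^sup>2 * \<eta>\<^sup>2))"
  define Q2 where "Q2 = norm (\<tau>\<^sup>2 + of_real (Y2\<^sup>2 * \<eta>\<^sup>2))"
  \<comment> \<open>\<open>D\<close> is chosen so that
    \<open>(norm p)\<^sup>2 \<le> a\<^sup>2 + (D - 1) * \<eta>\<^sup>2\<close> in this range; the
    spared 1 absorbs the \<eta>^2 in pq + \<eta>^2. Of the four powers of \<open>D\<close> in the
    constant, two come from passing from \<open>Q1\<close> to \<open>A\<close> and two from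
    \<open>main\<close>.\<close>
  have D: "D \<ge> 10" "D > 0" using w by (simp_all add: D_def)
  have L0: "L > 0" using a by (simp add: L_def add_pos_nonneg)
  have \<eta>0: "\<eta> \<noteq> 0" using \<delta> by auto
  have \<delta>2: "\<delta>\<^sup>2 \<le> w\<^sup>2 * \<eta>\<^sup>2"
  proof -
    have "\<bar>\<delta>\<bar>\<^sup>2 \<le> (w * \<bar>\<eta>\<bar>)\<^sup>2" using \<delta> w by (intro power_mono) auto
    then show ?thesis by (simp add: power_mult_distrib)
  qed
  have LD: "L \<le> a\<^sup>2 + (w\<^sup>2 + 1) * \<eta>\<^sup>2" using \<delta>2 by (simp add: L_def algebra_simps)
  have LD': "L \<le> D * (a\<^sup>2 + \<eta>\<^sup>2)"
  proof -
    have "a\<^sup>2 + (w\<^sup>2 + 1) * \<eta>\<^sup>2 \<le> D * a\<^sup>2 + D * \<eta>\<^sup>2" using D w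
        mult_right_mono[of 1 D "a\<^sup>2"] by (intro add_mono mult_right_mono) (simp_all add: D_def)
    then show ?thesis using LD by (simp add: algebra_simps)
  qed
  have wh: "(w * \<bar>\<eta>\<bar>) = \<bar>w * \<eta>\<bar>" using w by (simp add: abs_mult)
  have b2: "(\<delta> + w * \<eta>)\<^sup>2 \<le> 4 * w\<^sup>2 * \<eta>\<^sup>2" "(\<delta> - w * \<eta>)\<^sup>2 \<le> 4 * w\<^sup>2 * \<eta>\<^sup>2"
  proof -
    have "\<bar>\<delta> + w * \<eta>\<bar> \<le> \<bar>2 * (w * \<eta>)\<bar>" "\<bar>\<delta> - w * \<eta>\<bar> \<le> \<bar>2 * (w * \<eta>)\<bar>" using \<delta> wh by linarith+
    then have "(\<delta> + w * \<eta>)\<^sup>2 \<le> (2 * (w * \<eta>))\<^sup>2" "(\<delta> - w * \<eta>)\<^sup>2 \<le> (2 * (w * \<eta>))\<^sup>2"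
      by (simp_all only: abs_le_square_iff)
    then show "(\<delta> + w * \<eta>)\<^sup>2 \<le> 4 * w\<^sup>2 * \<eta>\<^sup>2" "(\<delta> - w * \<eta>)\<^sup>2 \<le> 4 * w\<^sup>2 * \<eta>\<^sup>2"
      by (simp_all add: power_mult_distrib)
  qed
  have np: "(norm p)\<^sup>2 \<le> a\<^sup>2 + (D - 1) * \<eta>\<^sup>2" "(norm q)\<^sup>2 \<le> a\<^sup>2 + (D - 1) * \<eta>\<^sup>2"
    using sqrt_parts(3)[OF p] sqrt_parts(3)[OF q] b2 by (simp_all add: D_def algebra_simps)
  have pqD: "norm (p * q + (of_real \<eta>)\<^sup>2) \<le> D * L"
  proof -
    have "norm (p * q + (of_real \<eta>)\<^sup>2) \<le> norm p * norm q + \<eta>\<^sup>2"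
      by (metis norm_triangle_ineq norm_mult norm_of_real norm_power power2_abs)
    also have "norm p * norm q \<le> ((norm p)\<^sup>2 + (norm q)\<^sup>2) / 2"
      using sum_squares_bound[of "norm p" "norm q"] by simp
    also have "\<dots> + \<eta>\<^sup>2 \<le> a\<^sup>2 + D * \<eta>\<^sup>2"
    proof -
      have "(D - 1) * \<eta>\<^sup>2 + \<eta>\<^sup>2 = D * \<eta>\<^sup>2" by (simp add: algebra_simps)
      moreover have "((norm p)\<^sup>2 + (norm q)\<^sup>2) / 2 \<le> a\<^sup>2 + (D - 1) * \<eta>\<^sup>2" using np by (simp add: field_simps)
      ultimately show ?thesis by linarith
    qed
    also have "\<dots> \<le> D * a\<^sup>2 + D * \<eta>\<^sup>2 + D * \<delta>\<^sup>2" using D mult_right_mono[of 1 D "a\<^sup>2"] by (simp add: add_increasing2)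
    finally show ?thesis by (simp add: L_def algebra_simps)
  qed
  have Q2: "Q2 \<ge> a\<^sup>2 + \<eta>\<^sup>2"
  proof (rule power2_le_imp_le)
    have y: "\<bar>Y2 * \<eta>\<bar> \<ge> \<bar>\<eta>\<bar> + w * \<bar>\<eta>\<bar>"
      using Y mult_right_mono[of "1+w" Y2 "\<bar>\<eta>\<bar>"] w by (simp add: abs_mult algebra_simps)
    then have "\<bar>\<delta> + Y2 * \<eta>\<bar> \<ge> \<bar>\<eta>\<bar>" "\<bar>\<delta> - Y2 * \<eta>\<bar> \<ge> \<bar>\<eta>\<bar>" using \<delta> by linarith+
    then have "(\<delta> + Y2 * \<eta>)\<^sup>2 \<ge> \<eta>\<^sup>2" "(\<delta> - Y2 * \<eta>)\<^sup>2 \<ge> \<eta>\<^sup>2" by (simp_all only: abs_le_square_iff)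
    then have "(a\<^sup>2 + \<eta>\<^sup>2) * (a\<^sup>2 + \<eta>\<^sup>2) \<le> (a\<^sup>2 + (\<delta> + Y2 * \<eta>)\<^sup>2) * (a\<^sup>2 + (\<delta> - Y2 * \<eta>)\<^sup>2)"
      by (intro mult_mono) auto
    then show "(a\<^sup>2 + \<eta>\<^sup>2)\<^sup>2 \<le> Q2\<^sup>2"
      unfolding Q2_def \<tau>_def norm_quadratic_factor by (simp add: power2_eq_square)
  qed (simp add: Q2_def)
  have "A * norm (p * q + (of_real \<eta>)\<^sup>2) = Q1 * Q2"
    unfolding A_def Q1_def Q2_def \<tau>_def norm_mult[symmetric] product_of_roots[OF p q Y(1,2)] ..
  moreover have "A * norm (p * q + (of_real \<eta>)\<^sup>2) \<le> A * (D * L)" using pqD by (intro mult_left_mono) (auto simp: A_def)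
  moreover have "Q1 * (L / D) \<le> Q1 * Q2"
  proof (intro mult_left_mono)
    have "L \<le> D * Q2" using LD' mult_left_mono[OF Q2, of D] D by linarith
    then show "L / D \<le> Q2" using D by (simp add: pos_divide_le_eq mult.commute)
  qed (simp add: Q1_def)
  ultimately have "Q1 * (L / D) \<le> A * (D * L)" by linarith
  then have A: "Q1 \<le> D\<^sup>2 * A" using L0 D by (simp add: field_simps power2_eq_square)
  have pq2a: "norm (p + q) \<ge> 2 * a"
    using sqrt_Re_ge(1)[OF p pq(1) a] sqrt_Re_ge(1)[OF q pq(2) a] complex_Re_le_cmod[of "p + q"] by simp
  have Y1w: "Y1\<^sup>2 \<le> w\<^sup>2" using Y by (intro power_mono) auto
  have Y1D: "Y1\<^sup>2 \<le> D / 4" using Y1w by (simp add: D_def)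
  \<comment> \<open>Well inside \<plusminus> Y1 \<eta> the factor \<open>Q1\<close> is of size L,
    and \<open>norm (p + q) \<ge> 2 * a\<close> supplies a. Otherwise \<open>Q1\<close> supplies a
    sqrt L and p + q must supply sqrt L; the threshold at half of Y1 |\<eta>| keeps \<tau> away from
    0 in this second case.\<close>
  have main: "D\<^sup>2 * (Q1 * norm (p + q)) \<ge> Y1\<^sup>2 * (a * L)"
  proof (cases "\<bar>\<delta>\<bar> \<le> Y1 * \<bar>\<eta>\<bar> / 2")
    case True
    have "Q1 \<ge> a\<^sup>2 + Y1\<^sup>2 * \<eta>\<^sup>2 / 4"
    proof (rule power2_le_imp_le)
      have "\<bar>Y1 * \<eta>\<bar> = Y1 * \<bar>\<eta>\<bar>" using Y by (simp add: abs_mult)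
      then have "\<bar>\<delta> + Y1 * \<eta>\<bar> \<ge> \<bar>Y1 * \<eta> / 2\<bar>" "\<bar>\<delta> - Y1 * \<eta>\<bar> \<ge> \<bar>Y1 * \<eta> / 2\<bar>" using True by linarith+
      then have "(\<delta> + Y1 * \<eta>)\<^sup>2 \<ge> (Y1 * \<eta> / 2)\<^sup>2" "(\<delta> - Y1 * \<eta>)\<^sup>2 \<ge> (Y1 * \<eta> / 2)\<^sup>2"
        by (simp_all only: abs_le_square_iff)
      then have "(a\<^sup>2 + Y1\<^sup>2 * \<eta>\<^sup>2 / 4) * (a\<^sup>2 + Y1\<^sup>2 * \<eta>\<^sup>2 / 4) \<le> (a\<^sup>2 + (\<delta> + Y1 * \<eta>)\<^sup>2) * (a\<^sup>2 + (\<delta> - Y1 * \<eta>)\<^sup>2)"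
        by (intro mult_mono) (auto simp: power_mult_distrib power_divide)
      then show "(a\<^sup>2 + Y1\<^sup>2 * \<eta>\<^sup>2 / 4)\<^sup>2 \<le> Q1\<^sup>2"
        unfolding Q1_def \<tau>_def norm_quadratic_factor by (simp add: power2_eq_square)
    qed (simp add: Q1_def)
    moreover have "a\<^sup>2 + Y1\<^sup>2 * \<eta>\<^sup>2 / 4 \<ge> Y1\<^sup>2 / D * (a\<^sup>2 + \<eta>\<^sup>2)"
    proof -
      have "Y1\<^sup>2 / D * a\<^sup>2 \<le> 1 * a\<^sup>2" using Y1D D by (intro mult_right_mono) auto
      moreover have "Y1\<^sup>2 / D * \<eta>\<^sup>2 \<le> Y1\<^sup>2 / 4 * \<eta>\<^sup>2" using D by (intro mult_right_mono divide_left_mono) auto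
      ultimately show ?thesis by (simp add: algebra_simps)
    qed
    moreover have "Y1\<^sup>2 / D * (a\<^sup>2 + \<eta>\<^sup>2) \<ge> Y1\<^sup>2 / D * (L / D)" using LD' D
      by (intro mult_left_mono) (auto simp: field_simps)
    ultimately have "Q1 \<ge> Y1\<^sup>2 / D * (L / D)" by linarith
    then have "D\<^sup>2 * Q1 \<ge> Y1\<^sup>2 * L" using D by (simp add: field_simps power2_eq_square)
    then have "(D\<^sup>2 * Q1) * norm (p + q) \<ge> (Y1\<^sup>2 * L) * (2 * a)"
      by (rule mult_mono[OF _ pq2a]) (use a L0 D in \<open>auto simp: Q1_def\<close>)
    moreover have "Y1\<^sup>2 * L * a \<ge> 0" using L0 a by simp
    ultimately show ?thesis by (simp add: algebra_simps)
  next
    case False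
    have Q1: "Q1\<^sup>2 \<ge> a\<^sup>2 * (L * (Y1\<^sup>2 / D))"
    proof -
      have Y\<eta>: "\<bar>Y1 * \<eta>\<bar> = Y1 * \<bar>\<eta>\<bar>" using Y by (simp add: abs_mult)
      have s: "(\<delta> + Y1 * \<eta>)\<^sup>2 + (\<delta> - Y1 * \<eta>)\<^sup>2 = 2 * (\<delta>\<^sup>2 + Y1\<^sup>2 * \<eta>\<^sup>2)"
        by (simp add: power2_eq_square algebra_simps)
      have "Q1\<^sup>2 = a\<^sup>2 * (a\<^sup>2 + ((\<delta> + Y1 * \<eta>)\<^sup>2 + (\<delta> - Y1 * \<eta>)\<^sup>2)) + (\<delta> + Y1 * \<eta>)\<^sup>2 * (\<delta> - Y1 * \<eta>)\<^sup>2"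
        unfolding Q1_def \<tau>_def norm_quadratic_factor by algebra
      also have "\<dots> \<ge> a\<^sup>2 * (a\<^sup>2 + ((\<delta> + Y1 * \<eta>)\<^sup>2 + (\<delta> - Y1 * \<eta>)\<^sup>2))" by simp
      finally have "Q1\<^sup>2 \<ge> a\<^sup>2 * (a\<^sup>2 + 2 * (\<delta>\<^sup>2 + Y1\<^sup>2 * \<eta>\<^sup>2))" unfolding s .
      moreover have "a\<^sup>2 + 2 * (\<delta>\<^sup>2 + Y1\<^sup>2 * \<eta>\<^sup>2) \<ge> L * (Y1\<^sup>2 / D)"
      proof -
        have "Y1\<^sup>2 / D \<le> 1" using Y1D D by simp
        then have "Y1\<^sup>2 / D * (a\<^sup>2 + \<delta>\<^sup>2) \<le> 1 * (a\<^sup>2 + \<delta>\<^sup>2)" by (intro mult_right_mono) auto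
        moreover have "Y1\<^sup>2 / D * \<eta>\<^sup>2 \<le> Y1\<^sup>2 / 1 * \<eta>\<^sup>2" using D by (intro mult_right_mono divide_left_mono) auto
        moreover have "Y1\<^sup>2 * \<eta>\<^sup>2 \<ge> 0" "\<delta>\<^sup>2 \<ge> 0" by simp_all
        moreover have "L * (Y1\<^sup>2 / D) = Y1\<^sup>2 / D * (a\<^sup>2 + \<delta>\<^sup>2) + Y1\<^sup>2 / D * \<eta>\<^sup>2"
          unfolding L_def by (simp only: distrib_left mult.commute)
        ultimately show ?thesis by (simp only: div_by_1 mult_1 distrib_left)
      qed
      ultimately show ?thesis by (meson mult_left_mono order_trans zero_le_power2)
    qed
    \<comment> \<open>When \<eta> dominates a, the bound comes from (p + q)(p - q) = p^2 - q^2 = 4 i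
      w \<eta> \<tau>: the difference p - q is at most of order |\<eta>|, while the modulus of
      \<tau> is at least Y1 |\<eta>| / 2.\<close>
    have S: "(norm (p + q))\<^sup>2 * D^3 \<ge> Y1\<^sup>2 * L"
    proof (cases "a\<^sup>2 \<ge> \<eta>\<^sup>2")
      case True
      have "D * (a\<^sup>2 + \<eta>\<^sup>2) \<le> D * (2 * a)\<^sup>2"
      proof (rule mult_left_mono)
        have "(2 * a)\<^sup>2 = 4 * a\<^sup>2" by (simp add: power_mult_distrib)
        then show "a\<^sup>2 + \<eta>\<^sup>2 \<le> (2 * a)\<^sup>2" using True zero_le_power2[of a] by linarith
      qed (use D in simp)
      also have "\<dots> \<le> D * (norm (p + q))\<^sup>2" using pq2a a D by (intro mult_left_mono power_mono) auto
      finally have 1: "L \<le> D * (norm (p + q))\<^sup>2" using LD' by linarith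
      have "D \<le> D\<^sup>2" using D mult_right_mono[of 1 D D] by (simp add: power2_eq_square)
      then have "Y1\<^sup>2 \<le> D\<^sup>2" using Y1D D by linarith
      then have "Y1\<^sup>2 * L \<le> D\<^sup>2 * (D * (norm (p + q))\<^sup>2)"
        using 1 by (rule mult_mono) (use L0 in auto)
      then show ?thesis by (simp add: algebra_simps power2_eq_square power3_eq_cube)
    next
      case False
      have LE: "L \<le> D * (2 * \<eta>\<^sup>2)"
      proof -
        have "D * (a\<^sup>2 + \<eta>\<^sup>2) \<le> D * (2 * \<eta>\<^sup>2)" using False D by (intro mult_left_mono) auto
        then show ?thesis using LD' by linarith
      qed
      have diff: "norm (p + q) * norm (p - q) = 4 * w * \<bar>\<eta>\<bar> * norm \<tau>"
      proof -
        have "(p + q) * (p - q) = p\<^sup>2 - q\<^sup>2" by algebra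
        also have "\<dots> = 4 * \<i> * of_real w * of_real \<eta> * \<tau>"
          unfolding p q by (simp add: \<tau>_def complex_eq_iff power2_eq_square algebra_simps)
        finally have "norm ((p + q) * (p - q)) = norm (4 * \<i> * of_real w * of_real \<eta> * \<tau>)" by simp
        then show ?thesis using w by (simp add: norm_mult)
      qed
      have m: "(norm (p - q))\<^sup>2 \<le> 4 * D * \<eta>\<^sup>2"
      proof -
        have "(norm (p - q))\<^sup>2 \<le> (norm p + norm q)\<^sup>2" by (intro power_mono norm_triangle_ineq4) auto
        also have "\<dots> \<le> 2 * ((norm p)\<^sup>2 + (norm q)\<^sup>2)" using sum_squares_bound[of "norm p" "norm q"]
          by (simp add: power2_sum)
        also have "\<dots> \<le> 4 * (a\<^sup>2 + (D - 1) * \<eta>\<^sup>2)" using add_mono[OF np] by simp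
        also have "\<dots> \<le> 4 * D * \<eta>\<^sup>2" using False by (simp add: algebra_simps)
        finally show ?thesis .
      qed
      have t: "(norm \<tau>)\<^sup>2 \<ge> Y1\<^sup>2 * \<eta>\<^sup>2 / 4"
      proof -
        have "\<bar>\<delta>\<bar>\<^sup>2 \<ge> (Y1 * \<bar>\<eta>\<bar> / 2)\<^sup>2" using \<open>\<not> \<bar>\<delta>\<bar> \<le> Y1 * \<bar>\<eta>\<bar> / 2\<close> Y by (intro power_mono) auto
        then have "\<delta>\<^sup>2 \<ge> Y1\<^sup>2 * \<eta>\<^sup>2 / 4" by (simp add: power_mult_distrib power_divide)
        then show ?thesis by (simp add: \<tau>_def cmod_power2 add_increasing)
      qed
      have "(norm (p + q))\<^sup>2 * (4 * D * \<eta>\<^sup>2) \<ge> (norm (p + q) * norm (p - q))\<^sup>2"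
        using m by (simp add: power_mult_distrib mult_left_mono)
      also have "(norm (p + q) * norm (p - q))\<^sup>2 = 16 * w\<^sup>2 * \<eta>\<^sup>2 * (norm \<tau>)\<^sup>2"
        unfolding diff by (simp add: power_mult_distrib)
      also have "\<dots> \<ge> 16 * w\<^sup>2 * \<eta>\<^sup>2 * (Y1\<^sup>2 * \<eta>\<^sup>2 / 4)" using t by (intro mult_left_mono) auto
      finally have "(norm (p + q))\<^sup>2 * (4 * D * \<eta>\<^sup>2) \<ge> 16 * w\<^sup>2 * \<eta>\<^sup>2 * (Y1\<^sup>2 * \<eta>\<^sup>2 / 4)" .
      then have "\<eta>\<^sup>2 * ((norm (p + q))\<^sup>2 * D) \<ge> \<eta>\<^sup>2 * (w\<^sup>2 * (Y1\<^sup>2 * \<eta>\<^sup>2))"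
        by (simp add: algebra_simps)
      then have "(norm (p + q))\<^sup>2 * D \<ge> w\<^sup>2 * (Y1\<^sup>2 * \<eta>\<^sup>2)" using \<eta>0 by (simp add: mult_le_cancel_left)
      moreover have "w\<^sup>2 * (Y1\<^sup>2 * \<eta>\<^sup>2) \<ge> 2 * (Y1\<^sup>2 * \<eta>\<^sup>2)" using w by (intro mult_right_mono) auto
      ultimately have 3: "(norm (p + q))\<^sup>2 * D \<ge> 2 * (Y1\<^sup>2 * \<eta>\<^sup>2)" by linarith
      have "Y1\<^sup>2 * L \<le> Y1\<^sup>2 * (D * (2 * \<eta>\<^sup>2))" using LE by (intro mult_left_mono) auto
      also have "\<dots> = D * (2 * (Y1\<^sup>2 * \<eta>\<^sup>2))" by simp
      also have "\<dots> \<le> D * ((norm (p + q))\<^sup>2 * D)" using 3 D by (intro mult_left_mono) auto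
      also have "\<dots> \<le> D * (D * ((norm (p + q))\<^sup>2 * D))"
        using D mult_right_mono[of 1 D "D * ((norm (p + q))\<^sup>2 * D)"] by simp
      finally show ?thesis by (simp add: algebra_simps power3_eq_cube)
    qed
    show ?thesis
    proof (rule power2_le_imp_le)
      have "(Y1\<^sup>2 * (a * L))\<^sup>2 = (a\<^sup>2 * (L * Y1\<^sup>2)) * (Y1\<^sup>2 * L)" by (simp add: power2_eq_square algebra_simps)
      also have "\<dots> \<le> (Q1\<^sup>2 * D) * ((norm (p + q))\<^sup>2 * D^3)"
        by (rule mult_mono) (use S Q1 D L0 in \<open>simp_all add: pos_divide_le_eq times_divide_eq_right\<close>)
      also have "\<dots> = (D\<^sup>2 * (Q1 * norm (p + q)))\<^sup>2" by (simp add: power2_eq_square power3_eq_cube algebra_simps)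
      finally show "(Y1\<^sup>2 * (a * L))\<^sup>2 \<le> (D\<^sup>2 * (Q1 * norm (p + q)))\<^sup>2" .
    qed (simp add: Q1_def)
  qed
  have "D\<^sup>2 * (Q1 * norm (p + q)) \<le> D\<^sup>2 * ((D\<^sup>2 * A) * norm (p + q))"
    using A by (intro mult_left_mono mult_right_mono) auto
  then have "Y1\<^sup>2 * (a * L) \<le> D\<^sup>2 * (D\<^sup>2 * A * norm (p + q))" using main by (rule order_trans[rotated])
  also have "\<dots> = D^4 * (A * norm (p + q))" by (simp add: power2_eq_square power4_eq_xxxx algebra_simps)
  finally have "Y1\<^sup>2 * (a * L) \<le> D^4 * (A * norm (p + q))" .
  then have "Y1\<^sup>2 * (a * L) / D^4 \<le> A * norm (p + q)" using D by (simp add: field_simps)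
  then have "Y1\<^sup>2 / D^4 * a * L \<le> A * norm (p + q)" by (simp only: times_divide_eq_left mult.assoc)
  then show ?thesis by (simp only: A_def L_def)
qed


text \<open>The polynomial T^2 + 2 (1 + w^2) T + w^4 - 2 w^2 has the roots -(1 + w^2) \<plusminus> r
  with r^2 = 1 + 4 w^2, which gives \<open>Y1\<close> and \<open>Y2\<close>. The hypothesis w^2 > 2
  is equivalent to r < 1 + w^2, that is, to \<open>Y1\<close> being a positive real; r \<ge> 1 gives
  \<open>Y1 \<le> w\<close>, and r \<ge> 2 w gives \<open>1 + w \<le> Y2\<close>.\<close>

lemma root_product_lower_bound:
  assumes w: "w\<^sup>2 > 2" "w > 0"
  shows "\<exists>K>0. \<forall>a \<delta> \<eta> p q. a > 0 \<longrightarrow> Re p > 0 \<longrightarrow> Re q > 0 \<longrightarrow>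
    p\<^sup>2 = (Complex a (\<delta> + w * \<eta>))\<^sup>2 + (of_real \<eta>)\<^sup>2 \<longrightarrow>
    q\<^sup>2 = (Complex a (\<delta> - w * \<eta>))\<^sup>2 + (of_real \<eta>)\<^sup>2 \<longrightarrow>
    K * a * (a\<^sup>2 + \<delta>\<^sup>2 + \<eta>\<^sup>2) \<le> norm (p * q - (of_real \<eta>)\<^sup>2) * norm (p + q)"
proof -
  define r where "r = sqrt (1 + 4 * w\<^sup>2)"
  define Y1 Y2 where "Y1 = sqrt (1 + w\<^sup>2 - r)" and "Y2 = sqrt (1 + w\<^sup>2 + r)"
  define D where "D = 4 * w\<^sup>2 + 2"
  have r2: "r\<^sup>2 = 1 + 4 * w\<^sup>2" by (simp add: r_def)
  have r1: "r \<ge> 1" by (simp add: r_def)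
  have rw: "r \<ge> 2 * w" unfolding r_def by (rule real_le_rsqrt) (simp add: power_mult_distrib)
  have w4: "w\<^sup>2 * w\<^sup>2 > 2 * w\<^sup>2" using w by (intro mult_strict_right_mono) auto
  have rl: "r < 1 + w\<^sup>2"
  proof (rule power2_less_imp_less)
    show "r\<^sup>2 < (1 + w\<^sup>2)\<^sup>2" using w4 unfolding r2 by (simp add: power2_eq_square algebra_simps)
  qed simp
  have y: "Y1\<^sup>2 = 1 + w\<^sup>2 - r" "Y2\<^sup>2 = 1 + w\<^sup>2 + r" using rl r1 by (simp_all add: Y1_def Y2_def add_nonneg_nonneg)
  have Y: "Y1\<^sup>2 + Y2\<^sup>2 = 2 * (1 + w\<^sup>2)" by (simp add: y)
  have "Y1\<^sup>2 * Y2\<^sup>2 = (1 + w\<^sup>2)\<^sup>2 - r\<^sup>2" unfolding y by (simp add: power2_eq_square algebra_simps)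
  then have Y': "Y1\<^sup>2 * Y2\<^sup>2 = w^4 - 2 * w\<^sup>2" unfolding r2
    by (simp add: power2_eq_square power4_eq_xxxx algebra_simps)
  have Y1: "0 < Y1" "Y1 \<le> w"
    using rl r1 w by (simp_all add: Y1_def real_le_lsqrt)
  have Y2: "1 + w \<le> Y2" unfolding Y2_def by (rule real_le_rsqrt) (use rw in \<open>simp add: power2_sum\<close>)
  define K where "K = min (1/3) (Y1\<^sup>2 / D ^ 4)"
  have K: "K > 0" using Y1 w by (simp add: K_def D_def add_pos_pos)
  show ?thesis
  proof (intro exI[of _ K] conjI K allI impI)
    fix a \<delta> \<eta> p q
    assume a: "a > 0" and pq: "Re p > 0" "Re q > 0"
      and p: "p\<^sup>2 = (Complex a (\<delta> + w * \<eta>))\<^sup>2 + (of_real \<eta>)\<^sup>2"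
      and q: "q\<^sup>2 = (Complex a (\<delta> - w * \<eta>))\<^sup>2 + (of_real \<eta>)\<^sup>2"
    have L: "a * (a\<^sup>2 + \<delta>\<^sup>2 + \<eta>\<^sup>2) \<ge> 0" using a by simp
    have "K * (a * (a\<^sup>2 + \<delta>\<^sup>2 + \<eta>\<^sup>2)) \<le> norm (p * q - (of_real \<eta>)\<^sup>2) * norm (p + q)"
    proof (cases "\<bar>\<delta>\<bar> \<ge> w * \<bar>\<eta>\<bar>")
      case True
      have "K * (a * (a\<^sup>2 + \<delta>\<^sup>2 + \<eta>\<^sup>2)) \<le> 1/3 * (a * (a\<^sup>2 + \<delta>\<^sup>2 + \<eta>\<^sup>2))"
        using L unfolding K_def by (intro mult_right_mono min.cobounded1) auto
      with symbol_case_hyperbolic[OF w a pq p q True] show ?thesis by simp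
    next
      case False
      have "K * (a * (a\<^sup>2 + \<delta>\<^sup>2 + \<eta>\<^sup>2)) \<le> Y1\<^sup>2 / D ^ 4 * (a * (a\<^sup>2 + \<delta>\<^sup>2 + \<eta>\<^sup>2))"
        using L unfolding K_def by (intro mult_right_mono min.cobounded2) auto
      also have "\<dots> \<le> norm (p * q - (of_real \<eta>)\<^sup>2) * norm (p + q)"
        using symbol_case_elliptic[OF w a pq p q _ Y Y' Y1 Y2] False by (simp add: D_def mult.assoc)
      finally show ?thesis .
    qed
    then show "K * a * (a\<^sup>2 + \<delta>\<^sup>2 + \<eta>\<^sup>2) \<le> norm (p * q - (of_real \<eta>)\<^sup>2) * norm (p + q)" by (simp add: mult.assoc)
  qed
qed

section \<open>The coefficient of the equation\<close>

definition lop_symbol :: "real \<Rightarrow> real \<Rightarrow> complex \<Rightarrow> real \<Rightarrow> complex" where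
  "lop_symbol v c \<tau> \<eta> = \<tau>\<^sup>2 + (of_real v)\<^sup>2 * (of_real \<eta>)\<^sup>2 *
     (8 * \<tau>\<^sup>2 / ((of_real c)\<^sup>2 * (mu 1 v c \<tau> \<eta> + mu (-1) v c \<tau> \<eta>)\<^sup>2) - 1)"

lemma mu_sum_nonzero:
  assumes "Re \<tau> > 0" "c > 0"
  shows "mu 1 v c \<tau> \<eta> + mu (-1) v c \<tau> \<eta> \<noteq> 0"
  using mu_Re_pos[OF assms, of 1 v \<eta>] mu_Re_pos[OF assms, of "-1" v \<eta>]
  by (auto simp: complex_eq_iff simp del: of_real_1)

lemma mu_squared: "(mu \<sigma> v c \<tau> \<eta>)\<^sup>2 = mu_arg \<sigma> v c \<tau> \<eta>"
  by (simp add: mu_def)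

lemma lop_symbol_eq:
  assumes "Re \<tau> > 0" "c > 0"
  shows "lop_symbol v c \<tau> \<eta> = (of_real c)\<^sup>2 * (mu 1 v c \<tau> \<eta> * mu (-1) v c \<tau> \<eta> - (of_real \<eta>)\<^sup>2)"
proof -
  define p q where "p = mu 1 v c \<tau> \<eta>" and "q = mu (-1) v c \<tau> \<eta>"
  let ?c = "complex_of_real c" and ?v = "complex_of_real v" and ?e = "complex_of_real \<eta>"
  have S: "p + q \<noteq> 0" using mu_sum_nonzero[OF assms] by (simp add: p_def q_def)
  have c: "?c \<noteq> 0" using assms by simp
  have p2: "?c\<^sup>2 * p\<^sup>2 = (\<tau> + \<i> * ?v * ?e)\<^sup>2 + ?c\<^sup>2 * ?e\<^sup>2"
    and q2: "?c\<^sup>2 * q\<^sup>2 = (\<tau> - \<i> * ?v * ?e)\<^sup>2 + ?c\<^sup>2 * ?e\<^sup>2"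
    using c by (simp_all add: p_def q_def mu_squared mu_arg_def power_divide distrib_left)
  have d: "?c\<^sup>2 * ((p - q) * (p + q)) = 4 * \<i> * ?v * ?e * \<tau>" using p2 q2 by algebra
  have "?c\<^sup>2 * ?c\<^sup>2 * ((p - q)\<^sup>2 * (p + q)\<^sup>2) = (?c\<^sup>2 * ((p - q) * (p + q)))\<^sup>2" by algebra
  also have "\<dots> = - 16 * ?v\<^sup>2 * ?e\<^sup>2 * \<tau>\<^sup>2" unfolding d by (simp add: power_mult_distrib)
  finally have d2: "?c\<^sup>2 * ?c\<^sup>2 * ((p - q)\<^sup>2 * (p + q)\<^sup>2) = - 16 * ?v\<^sup>2 * ?e\<^sup>2 * \<tau>\<^sup>2" .
  \<comment> \<open>The square of c^2 (p - q)(p + q) = 4 i \<tau> v \<eta> trades 1 / (p + q)^2 for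
    (p - q)^2, so the coefficient becomes polynomial in the roots.\<close>
  have "?v\<^sup>2 * ?e\<^sup>2 * (8 * \<tau>\<^sup>2 / (?c\<^sup>2 * (p + q)\<^sup>2)) = - (?c\<^sup>2 * (p - q)\<^sup>2) / 2"
    using S c d2 by (simp add: field_simps)
  then have "lop_symbol v c \<tau> \<eta> = \<tau>\<^sup>2 - ?v\<^sup>2 * ?e\<^sup>2 - (?c\<^sup>2 * (p - q)\<^sup>2) / 2"
    unfolding lop_symbol_def p_def[symmetric] q_def[symmetric] by (simp add: algebra_simps)
  also have "?c\<^sup>2 * (p - q)\<^sup>2 = ?c\<^sup>2 * p\<^sup>2 + ?c\<^sup>2 * q\<^sup>2 - 2 * (?c\<^sup>2 * (p * q))" by algebra
  also have "\<dots> = 2 * (\<tau>\<^sup>2 - ?v\<^sup>2 * ?e\<^sup>2 + ?c\<^sup>2 * ?e\<^sup>2 - ?c\<^sup>2 * (p * q))"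
    unfolding p2 q2 using i_squared by algebra
  finally have "lop_symbol v c \<tau> \<eta> = \<tau>\<^sup>2 - ?v\<^sup>2 * ?e\<^sup>2 - (\<tau>\<^sup>2 - ?v\<^sup>2 * ?e\<^sup>2 + ?c\<^sup>2 * ?e\<^sup>2 - ?c\<^sup>2 * (p * q))"
    by (simp only: nonzero_mult_div_cancel_left[OF zero_neq_numeral[symmetric]])
  then show ?thesis by (simp add: p_def q_def algebra_simps)
qed

text \<open>Scaling by \<open>c\<close> brings both roots into the form of
  \<open>sqrt_parts\<close>, with \<gamma> / c for a, \<delta> / c for \<delta> and w = v /
  c.\<close>

lemma mu_normalised:
  assumes "c > 0"
  shows "(mu 1 v c (Complex \<gamma> \<delta>) \<eta>)\<^sup>2 = (Complex (\<gamma> / c) (\<delta> / c + v / c * \<eta>))\<^sup>2 + (of_real \<eta>)\<^sup>2"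
    "(mu (-1) v c (Complex \<gamma> \<delta>) \<eta>)\<^sup>2 = (Complex (\<gamma> / c) (\<delta> / c - v / c * \<eta>))\<^sup>2 + (of_real \<eta>)\<^sup>2"
proof -
  have "(Complex \<gamma> \<delta> + of_real 1 * \<i> * of_real v * of_real \<eta>) / of_real c = Complex (\<gamma> / c) (\<delta> / c + v / c * \<eta>)"
    "(Complex \<gamma> \<delta> + of_real (-1) * \<i> * of_real v * of_real \<eta>) / of_real c = Complex (\<gamma> / c) (\<delta> / c - v / c * \<eta>)"
    using assms by (simp_all add: complex_eq_iff field_simps)
  then show "(mu 1 v c (Complex \<gamma> \<delta>) \<eta>)\<^sup>2 = (Complex (\<gamma> / c) (\<delta> / c + v / c * \<eta>))\<^sup>2 + (of_real \<eta>)\<^sup>2"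
    "(mu (-1) v c (Complex \<gamma> \<delta>) \<eta>)\<^sup>2 = (Complex (\<gamma> / c) (\<delta> / c - v / c * \<eta>))\<^sup>2 + (of_real \<eta>)\<^sup>2"
    unfolding mu_squared mu_arg_def by simp_all
qed

lemma mu_Re_ge:
  assumes "c > 0" "\<gamma> > 0" "\<sigma> = 1 \<or> \<sigma> = -1"
  shows "Re (mu \<sigma> v c (Complex \<gamma> \<delta>) \<eta>) \<ge> \<gamma> / c"
proof -
  have "Re (Complex \<gamma> \<delta>) > 0" using assms by simp
  from mu_Re_pos[OF this assms(1)] show ?thesis
    using assms(3) sqrt_Re_ge(1)[OF mu_normalised(1)] sqrt_Re_ge(1)[OF mu_normalised(2)] assms(1,2) by auto
qed

text \<open>\<open>root_product_lower_bound\<close> offers a multiple of \<gamma> \<Lambda>^2. One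
  of the two factors \<Lambda> is given up for the modulus of either root, which is at most a
  multiple of \<Lambda>. In this form the bound absorbs the root that multiplies each Laplace
  integral.\<close>

lemma lop_symbol_lower_bound:
  assumes v: "v > 0" and c: "c > 0" and vc: "v / c > sqrt 2"
  shows "\<exists>K>0. \<forall>\<gamma> \<delta> \<eta>. \<gamma> > 0 \<longrightarrow> (\<forall>\<sigma>\<in>{1,-1}.
    K * \<gamma> * sqrt (\<gamma>\<^sup>2 + \<delta>\<^sup>2 + \<eta>\<^sup>2) * norm (mu \<sigma> v c (Complex \<gamma> \<delta>) \<eta>)
      \<le> norm (lop_symbol v c (Complex \<gamma> \<delta>) \<eta>) *
          norm (mu 1 v c (Complex \<gamma> \<delta>) \<eta> + mu (-1) v c (Complex \<gamma> \<delta>) \<eta>))"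
proof -
  define w where "w = v / c"
  have w: "w\<^sup>2 > 2" "w > 0"
  proof -
    have "(sqrt 2)\<^sup>2 < w\<^sup>2" using vc unfolding w_def by (intro power_strict_mono) auto
    then show "w\<^sup>2 > 2" by simp
    show "w > 0" using v c by (simp add: w_def)
  qed
  obtain K0 where K0: "K0 > 0" and low: "\<And>a \<delta> \<eta> p q. a > 0 \<Longrightarrow> Re p > 0 \<Longrightarrow> Re q > 0 \<Longrightarrow>
    p\<^sup>2 = (Complex a (\<delta> + w * \<eta>))\<^sup>2 + (of_real \<eta>)\<^sup>2 \<Longrightarrow>
    q\<^sup>2 = (Complex a (\<delta> - w * \<eta>))\<^sup>2 + (of_real \<eta>)\<^sup>2 \<Longrightarrow>
    K0 * a * (a\<^sup>2 + \<delta>\<^sup>2 + \<eta>\<^sup>2) \<le> norm (p * q - (of_real \<eta>)\<^sup>2) * norm (p + q)"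
    using root_product_lower_bound[OF w] by metis
  \<comment> \<open>\<open>E\<close> serves to bound the squared modulus of either root by
    \<open>E * L\<close>, and \<open>m\<close> to bound the scaled quadratic form below by
    \<open>m * L\<close>; both depend only on \<open>v\<close> and \<open>c\<close>.\<close>
  define E where "E = 2 / c\<^sup>2 + 2 * w\<^sup>2 + 1"
  define m where "m = min 1 (1 / c\<^sup>2)"
  have E: "E > 0" using c by (simp add: E_def add_pos_pos add_nonneg_pos)
  have m: "m > 0" using c by (simp add: m_def)
  define K where "K = c * K0 * m / sqrt E"
  have K: "K > 0" using K0 c m E by (simp add: K_def)
  show ?thesis
  proof (intro exI[of _ K] conjI K allI impI ballI)
    fix \<gamma> \<delta> \<eta> \<sigma> :: real
    assume g: "\<gamma> > 0" and \<sigma>: "\<sigma> \<in> {1,-1}"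
    define \<tau> where "\<tau> = Complex \<gamma> \<delta>"
    have R: "Re \<tau> > 0" using g by (simp add: \<tau>_def)
    define p q where "p = mu 1 v c \<tau> \<eta>" and "q = mu (-1) v c \<tau> \<eta>"
    define L where "L = \<gamma>\<^sup>2 + \<delta>\<^sup>2 + \<eta>\<^sup>2"
    have L: "L > 0" using g by (simp add: L_def add_pos_nonneg)
    note eqs = mu_normalised[OF c, of v \<gamma> \<delta> \<eta>, folded \<tau>_def w_def, folded p_def q_def]
    have pos: "Re p > 0" "Re q > 0" using mu_Re_pos[OF R c] by (auto simp: p_def q_def)
    have "m * L \<le> (\<gamma> / c)\<^sup>2 + (\<delta> / c)\<^sup>2 + \<eta>\<^sup>2"
    proof -
      have "m * \<gamma>\<^sup>2 \<le> 1 / c\<^sup>2 * \<gamma>\<^sup>2" "m * \<delta>\<^sup>2 \<le> 1 / c\<^sup>2 * \<delta>\<^sup>2" "m * \<eta>\<^sup>2 \<le> 1 * \<eta>\<^sup>2"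
        by (intro mult_right_mono; simp add: m_def)+
      then show ?thesis by (simp add: L_def power_divide algebra_simps)
    qed
    then have "K0 * (\<gamma> / c) * (m * L) \<le> K0 * (\<gamma> / c) * ((\<gamma> / c)\<^sup>2 + (\<delta> / c)\<^sup>2 + \<eta>\<^sup>2)"
      using K0 g c by (intro mult_left_mono) auto
    also have "\<dots> \<le> norm (p * q - (of_real \<eta>)\<^sup>2) * norm (p + q)"
      using g c pos eqs by (intro low) auto
    finally have "c\<^sup>2 * (K0 * (\<gamma> / c) * (m * L)) \<le> c\<^sup>2 * (norm (p * q - (of_real \<eta>)\<^sup>2) * norm (p + q))"
      by (intro mult_left_mono) auto
    also have "\<dots> = norm (lop_symbol v c \<tau> \<eta>) * norm (p + q)"
      unfolding lop_symbol_eq[OF R c] by (simp add: norm_mult norm_power p_def q_def)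
    also have "c\<^sup>2 * (K0 * (\<gamma> / c) * (m * L)) = (K * \<gamma> * sqrt L) * (sqrt E * sqrt L)"
      using c E L by (simp add: K_def power2_eq_square)
    finally have main: "(K * \<gamma> * sqrt L) * (sqrt E * sqrt L) \<le> norm (lop_symbol v c \<tau> \<eta>) * norm (p + q)" .
    have up: "norm r \<le> sqrt E * sqrt L" if r: "(norm r)\<^sup>2 \<le> (\<gamma> / c)\<^sup>2 + (\<delta> / c + s * (w * \<eta>))\<^sup>2 + \<eta>\<^sup>2" "s\<^sup>2 = 1"
      for r :: complex and s
    proof -
      have "0 \<le> (\<delta> / c - s * (w * \<eta>))\<^sup>2" by simp
      then have "(\<delta> / c + s * (w * \<eta>))\<^sup>2 \<le> 2 * (\<delta> / c)\<^sup>2 + 2 * (s\<^sup>2 * (w\<^sup>2 * \<eta>\<^sup>2))"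
        by (simp add: power2_sum power2_diff power_mult_distrib mult_ac)
      then have "(norm r)\<^sup>2 \<le> (\<gamma> / c)\<^sup>2 + 2 * (\<delta> / c)\<^sup>2 + 2 * (w\<^sup>2 * \<eta>\<^sup>2) + \<eta>\<^sup>2" using r by simp
      also have "\<dots> = (1 / c\<^sup>2) * \<gamma>\<^sup>2 + (2 / c\<^sup>2) * \<delta>\<^sup>2 + (2 * w\<^sup>2 + 1) * \<eta>\<^sup>2"
        by (simp add: power_divide algebra_simps)
      also have "\<dots> \<le> E * \<gamma>\<^sup>2 + E * \<delta>\<^sup>2 + E * \<eta>\<^sup>2"
        unfolding E_def by (intro add_mono mult_right_mono) (auto simp: divide_right_mono add_nonneg_nonneg add_increasing2)
      finally have "(norm r)\<^sup>2 \<le> E * L" by (simp add: L_def algebra_simps)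
      then have "norm r \<le> sqrt (E * L)" by (rule real_le_rsqrt)
      then show ?thesis by (simp add: real_sqrt_mult)
    qed
    have "norm (mu \<sigma> v c \<tau> \<eta>) \<le> sqrt E * sqrt L"
      using \<sigma> up[of p 1] up[of q "-1"] sqrt_parts(3)[OF eqs(1)] sqrt_parts(3)[OF eqs(2)]
      by (auto simp: p_def q_def)
    then have "(K * \<gamma> * sqrt L) * norm (mu \<sigma> v c \<tau> \<eta>) \<le> (K * \<gamma> * sqrt L) * (sqrt E * sqrt L)"
      using K g L by (intro mult_left_mono) auto
    with main show "K * \<gamma> * sqrt (\<gamma>\<^sup>2 + \<delta>\<^sup>2 + \<eta>\<^sup>2) * norm (mu \<sigma> v c (Complex \<gamma> \<delta>) \<eta>)
      \<le> norm (lop_symbol v c (Complex \<gamma> \<delta>) \<eta>) *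
          norm (mu 1 v c (Complex \<gamma> \<delta>) \<eta> + mu (-1) v c (Complex \<gamma> \<delta>) \<eta>)"
      by (simp add: \<tau>_def L_def p_def q_def)
  qed
qed

section \<open>Schwartz functions\<close>

declare split_paired_All [simp del] split_paired_Ex [simp del]

section \<open>Calculus of partial derivatives\<close>

definition has_dt :: "planefun \<Rightarrow> planefun \<Rightarrow> bool" where
  "has_dt \<phi> \<psi> \<longleftrightarrow> (\<forall>t x. ((\<lambda>t'. \<phi> (t', x)) has_vector_derivative \<psi> (t, x)) (at t))"

definition has_dx :: "planefun \<Rightarrow> planefun \<Rightarrow> bool" where
  "has_dx \<phi> \<psi> \<longleftrightarrow> (\<forall>t x. ((\<lambda>x'. \<phi> (t, x')) has_vector_derivative \<psi> (t, x)) (at x))"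

lemma has_dt_imp_d_t: "has_dt \<phi> \<psi> \<Longrightarrow> d_t \<phi> = \<psi>"
  by (auto simp: has_dt_def d_t_def fun_eq_iff intro!: vector_derivative_at)

lemma has_dx_imp_d_x: "has_dx \<phi> \<psi> \<Longrightarrow> d_x \<phi> = \<psi>"
  by (auto simp: has_dx_def d_x_def fun_eq_iff intro!: vector_derivative_at)

text \<open>Derivatives given by witness functions: the sum and product rules then yield
  \<open>Ck\<close> directly, without evaluating \<open>vector_derivative\<close>, which is
  meaningful only where a derivative exists.\<close>

lemma Ck_Suc_iff:
  "Ck (Suc k) \<phi> \<longleftrightarrow> continuous_on UNIV \<phi> \<and> (\<exists>\<psi>. has_dt \<phi> \<psi> \<and> Ck k \<psi>) \<and> (\<exists>\<psi>. has_dx \<phi> \<psi> \<and> Ck k \<psi>)"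
proof -
  have 1: "(\<forall>t x. (\<lambda>t'. \<phi> (t', x)) differentiable (at t)) \<and> Ck k (d_t \<phi>) \<longleftrightarrow> (\<exists>\<psi>. has_dt \<phi> \<psi> \<and> Ck k \<psi>)"
  proof
    assume *: "(\<forall>t x. (\<lambda>t'. \<phi> (t', x)) differentiable (at t)) \<and> Ck k (d_t \<phi>)"
    then have "has_dt \<phi> (d_t \<phi>)" by (auto simp: has_dt_def d_t_def vector_derivative_works)
    with * show "\<exists>\<psi>. has_dt \<phi> \<psi> \<and> Ck k \<psi>" by blast
  next
    assume "\<exists>\<psi>. has_dt \<phi> \<psi> \<and> Ck k \<psi>"
    then obtain \<psi> where *: "has_dt \<phi> \<psi>" "Ck k \<psi>" by blast
    then show "(\<forall>t x. (\<lambda>t'. \<phi> (t', x)) differentiable (at t)) \<and> Ck k (d_t \<phi>)"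
      using has_dt_imp_d_t[OF *(1)] by (auto simp: has_dt_def intro: differentiableI_vector)
  qed
  have 2: "(\<forall>t x. (\<lambda>x'. \<phi> (t, x')) differentiable (at x)) \<and> Ck k (d_x \<phi>) \<longleftrightarrow> (\<exists>\<psi>. has_dx \<phi> \<psi> \<and> Ck k \<psi>)"
  proof
    assume *: "(\<forall>t x. (\<lambda>x'. \<phi> (t, x')) differentiable (at x)) \<and> Ck k (d_x \<phi>)"
    then have "has_dx \<phi> (d_x \<phi>)" by (auto simp: has_dx_def d_x_def vector_derivative_works)
    with * show "\<exists>\<psi>. has_dx \<phi> \<psi> \<and> Ck k \<psi>" by blast
  next
    assume "\<exists>\<psi>. has_dx \<phi> \<psi> \<and> Ck k \<psi>"
    then obtain \<psi> where *: "has_dx \<phi> \<psi>" "Ck k \<psi>" by blast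
    then show "(\<forall>t x. (\<lambda>x'. \<phi> (t, x')) differentiable (at x)) \<and> Ck k (d_x \<phi>)"
      using has_dx_imp_d_x[OF *(1)] by (auto simp: has_dx_def intro: differentiableI_vector)
  qed
  show ?thesis using 1 2 by auto
qed

lemma Ck_SucI:
  "continuous_on UNIV \<phi> \<Longrightarrow> has_dt \<phi> \<psi> \<Longrightarrow> Ck k \<psi> \<Longrightarrow> has_dx \<phi> \<omega> \<Longrightarrow> Ck k \<omega> \<Longrightarrow> Ck (Suc k) \<phi>"
  unfolding Ck_Suc_iff by blast

lemma Ck_imp_continuous: "Ck k \<phi> \<Longrightarrow> continuous_on UNIV \<phi>"
  by (cases k) auto

lemma Ck_SucD: "Ck (Suc k) \<phi> \<Longrightarrow> Ck k \<phi>"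
proof (induction k arbitrary: \<phi>)
  case (Suc k)
  then show ?case using Suc.IH[of "d_t \<phi>"] Suc.IH[of "d_x \<phi>"] by (metis Ck.simps(2))
qed auto

lemma Ck_has_dt: "Ck (Suc k) \<phi> \<Longrightarrow> has_dt \<phi> (d_t \<phi>)"
  unfolding Ck_Suc_iff using has_dt_imp_d_t by blast

lemma Ck_has_dx: "Ck (Suc k) \<phi> \<Longrightarrow> has_dx \<phi> (d_x \<phi>)"
  unfolding Ck_Suc_iff using has_dx_imp_d_x by blast

lemma has_dt_add: "has_dt \<phi> \<phi>' \<Longrightarrow> has_dt \<psi> \<psi>' \<Longrightarrow> has_dt (\<lambda>p. \<phi> p + \<psi> p) (\<lambda>p. \<phi>' p + \<psi>' p)"
  by (auto simp: has_dt_def intro!: has_vector_derivative_add)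

lemma has_dx_add: "has_dx \<phi> \<phi>' \<Longrightarrow> has_dx \<psi> \<psi>' \<Longrightarrow> has_dx (\<lambda>p. \<phi> p + \<psi> p) (\<lambda>p. \<phi>' p + \<psi>' p)"
  by (auto simp: has_dx_def intro!: has_vector_derivative_add)

lemma has_dt_mult:
  "has_dt \<phi> \<phi>' \<Longrightarrow> has_dt \<psi> \<psi>' \<Longrightarrow> has_dt (\<lambda>p. \<phi> p * \<psi> p) (\<lambda>p. \<phi> p * \<psi>' p + \<phi>' p * \<psi> p)"
  by (auto simp: has_dt_def intro!: has_vector_derivative_mult)

lemma has_dx_mult:
  "has_dx \<phi> \<phi>' \<Longrightarrow> has_dx \<psi> \<psi>' \<Longrightarrow> has_dx (\<lambda>p. \<phi> p * \<psi> p) (\<lambda>p. \<phi> p * \<psi>' p + \<phi>' p * \<psi> p)"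
  by (auto simp: has_dx_def intro!: has_vector_derivative_mult)

lemma has_dt_const: "has_dt (\<lambda>p. a) (\<lambda>p. 0)" and has_dx_const: "has_dx (\<lambda>p. a) (\<lambda>p. 0)"
  by (auto simp: has_dt_def has_dx_def)

lemma Ck_const: "Ck k (\<lambda>p. a)"
proof (induction k arbitrary: a)
  case (Suc k)
  show ?case by (rule Ck_SucI[OF _ has_dt_const Suc.IH has_dx_const Suc.IH]) simp
qed simp

lemma Ck_add: "Ck k \<phi> \<Longrightarrow> Ck k \<psi> \<Longrightarrow> Ck k (\<lambda>p. \<phi> p + \<psi> p)"
proof (induction k arbitrary: \<phi> \<psi>)
  case (Suc k)
  note d = Ck_has_dt[OF Suc.prems(1)] Ck_has_dt[OF Suc.prems(2)] Ck_has_dx[OF Suc.prems(1)] Ck_has_dx[OF Suc.prems(2)]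
  have c': "Ck k (d_t \<phi>)" "Ck k (d_t \<psi>)" "Ck k (d_x \<phi>)" "Ck k (d_x \<psi>)" using Suc.prems by simp_all
  show ?case
    by (rule Ck_SucI[OF _ has_dt_add[OF d(1,2)] Suc.IH[OF c'(1,2)] has_dx_add[OF d(3,4)] Suc.IH[OF c'(3,4)]])
       (intro continuous_on_add Suc.prems[THEN Ck_imp_continuous])
qed (auto intro: continuous_intros)

lemma Ck_mult: "Ck k \<phi> \<Longrightarrow> Ck k \<psi> \<Longrightarrow> Ck k (\<lambda>p. \<phi> p * \<psi> p)"
proof (induction k arbitrary: \<phi> \<psi>)
  case (Suc k)
  note d = Ck_has_dt[OF Suc.prems(1)] Ck_has_dt[OF Suc.prems(2)] Ck_has_dx[OF Suc.prems(1)] Ck_has_dx[OF Suc.prems(2)]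
  note c = Suc.prems[THEN Ck_SucD]
  have c': "Ck k (d_t \<phi>)" "Ck k (d_t \<psi>)" "Ck k (d_x \<phi>)" "Ck k (d_x \<psi>)" using Suc.prems by simp_all
  show ?case
    by (rule Ck_SucI[OF _ has_dt_mult[OF d(1,2)] _ has_dx_mult[OF d(3,4)]])
       (intro Ck_add Suc.IH continuous_on_mult c c' Suc.prems[THEN Ck_imp_continuous])+
qed (auto intro: continuous_intros)

lemma smooth_const: "smooth (\<lambda>p. a)"
  by (simp add: smooth_def Ck_const)

lemma smooth_add: "smooth \<phi> \<Longrightarrow> smooth \<psi> \<Longrightarrow> smooth (\<lambda>p. \<phi> p + \<psi> p)"
  by (simp add: smooth_def Ck_add)

lemma smooth_mult: "smooth \<phi> \<Longrightarrow> smooth \<psi> \<Longrightarrow> smooth (\<lambda>p. \<phi> p * \<psi> p)"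
  by (simp add: smooth_def Ck_mult)

lemma smooth_imp_continuous: "smooth \<phi> \<Longrightarrow> continuous_on UNIV \<phi>"
  using Ck_imp_continuous smooth_def by blast

lemma smooth_has_dt: "smooth \<phi> \<Longrightarrow> has_dt \<phi> (d_t \<phi>)"
  using Ck_has_dt smooth_def by blast

lemma smooth_has_dx: "smooth \<phi> \<Longrightarrow> has_dx \<phi> (d_x \<phi>)"
  using Ck_has_dx smooth_def by blast

lemma smooth_d_t: "smooth \<phi> \<Longrightarrow> smooth (d_t \<phi>)"
  by (metis Ck.simps(2) smooth_def)

lemma smooth_d_x: "smooth \<phi> \<Longrightarrow> smooth (d_x \<phi>)"
  by (metis Ck.simps(2) smooth_def)

lemma smooth_measurable: "smooth \<phi> \<Longrightarrow> \<phi> \<in> borel_measurable borel"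
  by (intro borel_measurable_continuous_onI smooth_imp_continuous)

text \<open>A class of continuous functions that is closed under both partial derivatives lies in
  every \<open>Ck k\<close>, by induction on k inside the class. This serves families whose
  derivatives are again members with other parameters, such as dilates or Fourier
  transforms.\<close>

lemma smooth_coinduct:
  assumes "P \<phi>"
    and "\<And>\<phi>. P \<phi> \<Longrightarrow> continuous_on UNIV \<phi>"
    and "\<And>\<phi>. P \<phi> \<Longrightarrow> \<exists>\<psi>. has_dt \<phi> \<psi> \<and> P \<psi>"
    and "\<And>\<phi>. P \<phi> \<Longrightarrow> \<exists>\<psi>. has_dx \<phi> \<psi> \<and> P \<psi>"
  shows "smooth \<phi>"
proof -
  have "Ck k \<phi>" if "P \<phi>" for k \<phi> using that
  proof (induction k arbitrary: \<phi>)
    case 0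
    then show ?case using assms(2) by simp
  next
    case (Suc k)
    obtain \<psi>1 \<psi>2 where "has_dt \<phi> \<psi>1" "P \<psi>1" "has_dx \<phi> \<psi>2" "P \<psi>2" using assms(3,4) Suc.prems by meson
    then show ?case using assms(2)[OF Suc.prems] Suc.IH by (intro Ck_SucI) auto
  qed
  then show ?thesis using assms(1) by (simp add: smooth_def)
qed

lemma d_t_add: "smooth \<phi> \<Longrightarrow> smooth \<psi> \<Longrightarrow> d_t (\<lambda>p. \<phi> p + \<psi> p) = (\<lambda>p. d_t \<phi> p + d_t \<psi> p)"
  by (intro has_dt_imp_d_t has_dt_add smooth_has_dt)

lemma d_x_add: "smooth \<phi> \<Longrightarrow> smooth \<psi> \<Longrightarrow> d_x (\<lambda>p. \<phi> p + \<psi> p) = (\<lambda>p. d_x \<phi> p + d_x \<psi> p)"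
  by (intro has_dx_imp_d_x has_dx_add smooth_has_dx)

lemma d_t_mult: "smooth \<phi> \<Longrightarrow> smooth \<psi> \<Longrightarrow> d_t (\<lambda>p. \<phi> p * \<psi> p) = (\<lambda>p. \<phi> p * d_t \<psi> p + d_t \<phi> p * \<psi> p)"
  by (intro has_dt_imp_d_t has_dt_mult smooth_has_dt)

lemma d_x_mult: "smooth \<phi> \<Longrightarrow> smooth \<psi> \<Longrightarrow> d_x (\<lambda>p. \<phi> p * \<psi> p) = (\<lambda>p. \<phi> p * d_x \<psi> p + d_x \<phi> p * \<psi> p)"
  by (intro has_dx_imp_d_x has_dx_mult smooth_has_dx)

lemma d_t_const: "d_t (\<lambda>p. a) = (\<lambda>p. 0)" and d_x_const: "d_x (\<lambda>p. a) = (\<lambda>p. 0)"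
  by (intro has_dt_imp_d_t has_dt_const has_dx_imp_d_x has_dx_const)+

text \<open>Schwarz's theorem: \<phi> is the integral of its x-derivative, differentiation in t
  passes under the integral sign, and the fundamental theorem of calculus in x gives the derivative
  of the result. It reduces arbitrary words of derivatives to the normal form
  \<open>partial j k\<close>.\<close>

lemma d_x_d_t_commute:
  assumes "smooth \<phi>"
  shows "d_x (d_t \<phi>) = d_t (d_x \<phi>)"
proof (rule has_dx_imp_d_x, unfold has_dx_def, intro allI)
  fix t x :: real
  let ?A = "d_t (d_x \<phi>)"
  \<comment> \<open>The base point lies strictly to the left of x, so that the integral formula is
    valid on the open set \<open>{x0<..}\<close> around x and may be differentiated there.\<close>
  define x0 x1 where "x0 = x - 1" and "x1 = x + 1"
  have cont[continuous_intros]: "continuous_on S (\<lambda>y. \<psi> (f y, g y))" if "smooth \<psi>" "continuous_on S f" "continuous_on S g"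
    for \<psi> and f g :: "real \<Rightarrow> real" and S
    by (rule continuous_on_compose2[OF smooth_imp_continuous[OF that(1)]]) (auto intro!: continuous_intros that)
  have eq: "\<phi> (s, y) = \<phi> (s, x0) + integral (cbox x0 y) (\<lambda>z. d_x \<phi> (s, z))" if "y \<ge> x0" for s y
  proof -
    have "((\<lambda>z. d_x \<phi> (s, z)) has_integral (\<phi> (s, y) - \<phi> (s, x0))) {x0..y}"
      using smooth_has_dx[OF assms] that
      by (intro fundamental_theorem_of_calculus) (auto simp: has_dx_def intro: has_vector_derivative_at_within)
    then show ?thesis by (simp add: integral_unique)
  qed
  have eq2: "d_t \<phi> (t, y) = d_t \<phi> (t, x0) + integral (cbox x0 y) (\<lambda>z. ?A (t, z))" if "y \<ge> x0" for y
  proof -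
    have "((\<lambda>s. integral (cbox x0 y) (\<lambda>z. d_x \<phi> (s, z))) has_vector_derivative integral (cbox x0 y) (\<lambda>z. ?A (t, z))) (at t within UNIV)"
    proof (rule leibniz_rule_vector_derivative)
      show "((\<lambda>s. d_x \<phi> (s, z)) has_vector_derivative ?A (s, z)) (at s within UNIV)" for s z
        using smooth_has_dt[OF smooth_d_x[OF assms]] by (simp add: has_dt_def)
      show "(\<lambda>z. d_x \<phi> (s, z)) integrable_on cbox x0 y" for s
        using smooth_d_x[OF assms] by (intro integrable_continuous continuous_intros)
      have "continuous_on UNIV ?A" by (intro smooth_imp_continuous smooth_d_t smooth_d_x assms)
      then show "continuous_on (UNIV \<times> cbox x0 y) (\<lambda>(s, z). ?A (s, z))"
        by (auto intro: continuous_on_subset)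
    qed auto
    moreover have "((\<lambda>s. \<phi> (s, x0)) has_vector_derivative d_t \<phi> (t, x0)) (at t)"
      using smooth_has_dt[OF assms] by (simp add: has_dt_def)
    ultimately have "((\<lambda>s. \<phi> (s, x0) + integral (cbox x0 y) (\<lambda>z. d_x \<phi> (s, z))) has_vector_derivative
       (d_t \<phi> (t, x0) + integral (cbox x0 y) (\<lambda>z. ?A (t, z)))) (at t)"
      by (intro has_vector_derivative_add) simp_all
    then have "((\<lambda>s. \<phi> (s, y)) has_vector_derivative
       (d_t \<phi> (t, x0) + integral (cbox x0 y) (\<lambda>z. ?A (t, z)))) (at t)"
      using eq[OF that] by simp
    moreover have "((\<lambda>s. \<phi> (s, y)) has_vector_derivative d_t \<phi> (t, y)) (at t)"
      using smooth_has_dt[OF assms] by (simp add: has_dt_def)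
    ultimately show ?thesis by (metis vector_derivative_at)
  qed
  have "((\<lambda>y. integral {x0..y} (\<lambda>z. ?A (t, z))) has_vector_derivative ?A (t, x)) (at x within {x0..x1})"
    using assms by (intro integral_has_vector_derivative continuous_intros smooth_d_t smooth_d_x) (auto simp: x0_def x1_def)
  then have "((\<lambda>y. integral {x0..y} (\<lambda>z. ?A (t, z))) has_vector_derivative ?A (t, x)) (at x within {x0<..<x1})"
    by (rule has_vector_derivative_within_subset) auto
  then have "((\<lambda>y. integral {x0..y} (\<lambda>z. ?A (t, z))) has_vector_derivative ?A (t, x)) (at x)"
    using at_within_open[of x "{x0<..<x1}"] by (simp add: x0_def x1_def)
  then have "((\<lambda>y. d_t \<phi> (t, x0) + integral {x0..y} (\<lambda>z. ?A (t, z))) has_vector_derivative 0 + ?A (t, x)) (at x)"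
    by (intro has_vector_derivative_add has_vector_derivative_const)
  then have H: "((\<lambda>y. d_t \<phi> (t, x0) + integral {x0..y} (\<lambda>z. ?A (t, z))) has_vector_derivative ?A (t, x)) (at x)"
    by simp
  show "((\<lambda>x'. d_t \<phi> (t, x')) has_vector_derivative ?A (t, x)) (at x)"
    by (rule has_vector_derivative_transform_within_open[OF H, of "{x0<..}"]) (use eq2[symmetric] in \<open>auto simp: x0_def\<close>)
qed

text \<open>The bound runs over all words of derivatives of length at most m, not only over
  \<open>partial j k\<close>, so that the product rule passes through an induction; one majorant
  \<open>h\<close> serves all orders.\<close>

primrec derivs_le :: "nat \<Rightarrow> planefun \<Rightarrow> (real \<times> real \<Rightarrow> real) \<Rightarrow> bool" where
  "derivs_le 0 \<phi> h \<longleftrightarrow> (\<forall>p. norm (\<phi> p) \<le> h p)"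
| "derivs_le (Suc m) \<phi> h \<longleftrightarrow> (\<forall>p. norm (\<phi> p) \<le> h p) \<and> derivs_le m (d_t \<phi>) h \<and> derivs_le m (d_x \<phi>) h"

lemma derivs_le_0: "derivs_le m \<phi> h \<Longrightarrow> norm (\<phi> p) \<le> h p"
  by (cases m) auto

lemma derivs_le_weaken: "derivs_le m \<phi> h \<Longrightarrow> (\<And>p. h p \<le> k p) \<Longrightarrow> derivs_le m \<phi> k"
proof (induction m arbitrary: \<phi>)
  case 0
  then show ?case using order_trans by (metis derivs_le.simps(1))
next
  case (Suc m)
  have "norm (\<phi> p) \<le> k p" for p using derivs_le_0[OF Suc.prems(1)] Suc.prems(2) order_trans by blast
  then show ?case using Suc by simp
qed

lemma derivs_le_SucD: "derivs_le (Suc m) \<phi> h \<Longrightarrow> derivs_le m \<phi> h"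
proof (induction m arbitrary: \<phi>)
  case (Suc m)
  then show ?case using Suc.IH[of "d_t \<phi>"] Suc.IH[of "d_x \<phi>"] by (metis derivs_le.simps(2))
qed auto

lemma derivs_le_mono: "derivs_le m \<phi> h \<Longrightarrow> n \<le> m \<Longrightarrow> derivs_le n \<phi> h"
proof (induction m)
  case (Suc m)
  then show ?case using derivs_le_SucD le_Suc_eq by metis
qed simp

lemma derivs_le_add:
  "smooth \<phi> \<Longrightarrow> smooth \<psi> \<Longrightarrow> derivs_le m \<phi> h \<Longrightarrow> derivs_le m \<psi> k \<Longrightarrow> derivs_le m (\<lambda>p. \<phi> p + \<psi> p) (\<lambda>p. h p + k p)"
proof (induction m arbitrary: \<phi> \<psi>)
  case (Suc m)
  have "derivs_le m (\<lambda>p. d_t \<phi> p + d_t \<psi> p) (\<lambda>p. h p + k p)" "derivs_le m (\<lambda>p. d_x \<phi> p + d_x \<psi> p) (\<lambda>p. h p + k p)"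
    using Suc.prems by (auto intro!: Suc.IH smooth_d_t smooth_d_x)
  moreover have "norm (\<phi> p + \<psi> p) \<le> h p + k p" for p
    using Suc.prems by (intro norm_triangle_mono) auto
  ultimately show ?case by (simp only: derivs_le.simps d_t_add[OF Suc.prems(1,2)] d_x_add[OF Suc.prems(1,2)]) simp
qed (auto intro: norm_triangle_mono)

text \<open>Each application of the product rule doubles the number of terms, hence the factor
  \<open>2 ^ m\<close>.\<close>

lemma derivs_le_mult:
  "smooth \<phi> \<Longrightarrow> smooth \<psi> \<Longrightarrow> derivs_le m \<phi> h \<Longrightarrow> derivs_le m \<psi> k \<Longrightarrow>
    derivs_le m (\<lambda>p. \<phi> p * \<psi> p) (\<lambda>p. 2 ^ m * (h p * k p))"
proof (induction m arbitrary: \<phi> \<psi>)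
  case 0
  have "norm (\<phi> p * \<psi> p) \<le> h p * k p" for p
  proof -
    have n: "norm (\<phi> p) \<le> h p" "norm (\<psi> p) \<le> k p" using 0 by auto
    then have "0 \<le> h p" using norm_ge_zero order_trans by blast
    with n show ?thesis by (auto simp: norm_mult intro: mult_mono)
  qed
  then show ?case by simp
next
  case (Suc m)
  have le: "norm (\<phi> p * \<psi> p) \<le> h p * k p" "0 \<le> h p * k p" for p
  proof -
    have n: "norm (\<phi> p) \<le> h p" "norm (\<psi> p) \<le> k p" using Suc.prems by auto
    then have "0 \<le> h p" "0 \<le> k p" using norm_ge_zero order_trans by blast+
    with n show "norm (\<phi> p * \<psi> p) \<le> h p * k p" "0 \<le> h p * k p"
      by (auto simp: norm_mult intro: mult_mono)
  qed
  have sum: "derivs_le m (\<lambda>p. \<alpha> p * \<beta> p + \<alpha>' p * \<beta>' p) (\<lambda>p. 2 ^ Suc m * (h p * k p))"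
    if "smooth \<alpha>" "smooth \<beta>" "smooth \<alpha>'" "smooth \<beta>'" "derivs_le m \<alpha> h" "derivs_le m \<beta> k" "derivs_le m \<alpha>' h" "derivs_le m \<beta>' k"
    for \<alpha> \<beta> \<alpha>' \<beta>'
  proof -
    have "derivs_le m (\<lambda>p. \<alpha> p * \<beta> p + \<alpha>' p * \<beta>' p) (\<lambda>p. 2 ^ m * (h p * k p) + 2 ^ m * (h p * k p))"
      using that by (intro derivs_le_add smooth_mult Suc.IH)
    then show ?thesis by (simp add: algebra_simps)
  qed
  have "norm (\<phi> p * \<psi> p) \<le> 2 ^ Suc m * (h p * k p)" for p
  proof -
    have "1 * (h p * k p) \<le> 2 ^ Suc m * (h p * k p)" by (intro mult_right_mono le one_le_power) simp
    with le(1)[of p] show ?thesis by simp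
  qed
  moreover have "derivs_le m (d_t (\<lambda>p. \<phi> p * \<psi> p)) (\<lambda>p. 2 ^ Suc m * (h p * k p))"
    using Suc.prems derivs_le_SucD[OF Suc.prems(3)] derivs_le_SucD[OF Suc.prems(4)]
    unfolding d_t_mult[OF Suc.prems(1,2)] by (intro sum smooth_d_t) simp_all
  moreover have "derivs_le m (d_x (\<lambda>p. \<phi> p * \<psi> p)) (\<lambda>p. 2 ^ Suc m * (h p * k p))"
    using Suc.prems derivs_le_SucD[OF Suc.prems(3)] derivs_le_SucD[OF Suc.prems(4)]
    unfolding d_x_mult[OF Suc.prems(1,2)] by (intro sum smooth_d_x) simp_all
  ultimately show ?case by simp
qed

lemma derivs_le_const: "norm a \<le> B \<Longrightarrow> derivs_le m (\<lambda>p. a) (\<lambda>p. B)"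
proof (induction m arbitrary: a)
  case (Suc m)
  have "0 \<le> B" using Suc.prems norm_ge_zero order_trans by blast
  then show ?case using Suc.prems Suc.IH[of 0] by (simp add: d_t_const d_x_const)
qed auto

lemma smooth_partial: "smooth \<phi> \<Longrightarrow> smooth (partial j k \<phi>)"
proof -
  assume s: "smooth \<phi>"
  have "smooth ((d_x ^^ k) \<phi>)" by (induction k) (auto simp: s smooth_d_x)
  then show ?thesis unfolding partial_def by (induction j) (auto simp: smooth_d_t)
qed

lemma smooth_d_x_pow: "smooth \<phi> \<Longrightarrow> smooth ((d_x ^^ k) \<phi>)"
  by (induction k) (auto simp: smooth_d_x)

lemma partial_d_x: "partial j k (d_x \<phi>) = partial j (Suc k) \<phi>"
  by (simp only: partial_def funpow_Suc_right o_apply)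

lemma partial_d_t:
  assumes "smooth \<phi>"
  shows "partial j k (d_t \<phi>) = partial (Suc j) k \<phi>"
proof -
  have "(d_x ^^ k) (d_t \<phi>) = d_t ((d_x ^^ k) \<phi>)"
    by (induction k) (auto simp: d_x_d_t_commute smooth_d_x_pow assms)
  then show ?thesis by (simp only: partial_def funpow_Suc_right o_apply)
qed

text \<open>Since mixed derivatives commute, every word of derivatives equals some
  \<open>partial j k\<close>. This links \<open>derivs_le\<close> to the seminorms.\<close>

lemma derivs_le_iff_partial:
  assumes "smooth \<phi>"
  shows "derivs_le m \<phi> h \<longleftrightarrow> (\<forall>j k p. j + k \<le> m \<longrightarrow> norm (partial j k \<phi> p) \<le> h p)"
  using assms
proof (induction m arbitrary: \<phi>)
  case 0
  have "partial 0 0 \<phi> = \<phi>" by (simp add: partial_def)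
  then show ?case by simp
next
  case (Suc m)
  have p0: "partial 0 0 \<phi> = \<phi>" by (simp add: partial_def)
  have dt: "derivs_le m (d_t \<phi>) h \<longleftrightarrow> (\<forall>j k p. j + k \<le> m \<longrightarrow> norm (partial (Suc j) k \<phi> p) \<le> h p)"
    using Suc.IH[OF smooth_d_t[OF Suc.prems]] unfolding partial_d_t[OF Suc.prems] .
  have dx: "derivs_le m (d_x \<phi>) h \<longleftrightarrow> (\<forall>j k p. j + k \<le> m \<longrightarrow> norm (partial j (Suc k) \<phi> p) \<le> h p)"
    using Suc.IH[OF smooth_d_x[OF Suc.prems]] unfolding partial_d_x .
  show ?case
  proof
    assume "derivs_le (Suc m) \<phi> h"
    then have *: "\<forall>p. norm (partial 0 0 \<phi> p) \<le> h p"
     "\<forall>j k p. j + k \<le> m \<longrightarrow> norm (partial (Suc j) k \<phi> p) \<le> h p"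
     "\<forall>j k p. j + k \<le> m \<longrightarrow> norm (partial j (Suc k) \<phi> p) \<le> h p" unfolding p0 dt[symmetric] dx[symmetric] by simp_all
    show "\<forall>j k p. j + k \<le> Suc m \<longrightarrow> norm (partial j k \<phi> p) \<le> h p"
    proof (intro allI impI)
      fix j k p assume jk: "j + k \<le> Suc m"
      show "norm (partial j k \<phi> p) \<le> h p"
      proof (cases j)
        case 0
        show ?thesis
        proof (cases k)
          case (Suc k')
          then show ?thesis using *(3) jk 0 by simp
        qed (use * 0 in simp)
      next
        case (Suc j')
        then show ?thesis using *(2) jk by simp
      qed
    qed
  next
    assume *: "\<forall>j k p. j + k \<le> Suc m \<longrightarrow> norm (partial j k \<phi> p) \<le> h p"
    have "norm (\<phi> p) \<le> h p" for p using *[rule_format, of 0 0 p] p0 by simp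
    moreover have "derivs_le m (d_t \<phi>) h" unfolding dt using * by simp
    moreover have "derivs_le m (d_x \<phi>) h" unfolding dx using * by simp
    ultimately show "derivs_le (Suc m) \<phi> h" by simp
  qed
qed

section \<open>Schwartz functions and their seminorms\<close>

lemma schwartz_smooth: "\<phi> \<in> schwartz_functions \<Longrightarrow> smooth \<phi>"
  by (simp add: schwartz_functions_def)

lemma schwartz_seminorm_upper:
  assumes \<phi>: "\<phi> \<in> schwartz_functions" and jk: "j \<le> N" "k \<le> N"
  shows "(1 + norm p) ^ N * norm (partial j k \<phi> p) \<le> schwartz_seminorm N \<phi>"
proof -
  let ?f = "\<lambda>j k p. (1 + norm p) ^ N * norm (partial j k \<phi> p)"
  have bd: "bdd_above (range (?f j k))" for j k
    using \<phi> by (intro bounded_imp_bdd_above) (auto simp: schwartz_functions_def)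
  have nn: "0 \<le> (SUP p. ?f j k p)" for j k
    by (rule cSUP_upper2[OF bd, of 0]) auto
  have "?f j k p \<le> (SUP p. ?f j k p)" by (intro cSUP_upper bd) auto
  also have "\<dots> \<le> (\<Sum>k\<le>N. SUP p. ?f j k p)" using jk nn by (intro member_le_sum) auto
  also have "\<dots> \<le> (\<Sum>j\<le>N. \<Sum>k\<le>N. SUP p. ?f j k p)"
    using jk nn by (intro member_le_sum[of j]) (auto intro: sum_nonneg)
  finally show ?thesis by (simp add: schwartz_seminorm_def)
qed

lemma schwartz_seminorm_nonneg: "\<phi> \<in> schwartz_functions \<Longrightarrow> 0 \<le> schwartz_seminorm N \<phi>"
  by (rule order_trans[OF _ schwartz_seminorm_upper[of \<phi> 0 N 0 0]]) auto

lemma schwartz_derivs_le: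
  assumes \<phi>: "\<phi> \<in> schwartz_functions" and m: "m \<le> N"
  shows "derivs_le m \<phi> (\<lambda>p. schwartz_seminorm N \<phi> / (1 + norm p) ^ N)"
  unfolding derivs_le_iff_partial[OF schwartz_smooth[OF \<phi>]]
proof (intro allI impI)
  fix j k and p :: "real \<times> real"
  assume "j + k \<le> m"
  then have "(1 + norm p) ^ N * norm (partial j k \<phi> p) \<le> schwartz_seminorm N \<phi>"
    using m by (intro schwartz_seminorm_upper[OF \<phi>]) auto
  moreover have "(1 + norm p) ^ N > 0" by (simp add: add_pos_nonneg)
  ultimately show "norm (partial j k \<phi> p) \<le> schwartz_seminorm N \<phi> / (1 + norm p) ^ N"
    by (simp add: field_simps)
qed

lemma schwartz_derivs_le_ex:
  assumes \<phi>: "\<phi> \<in> schwartz_functions"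
  shows "\<exists>B\<ge>0. derivs_le m \<phi> (\<lambda>p. B / (1 + norm p) ^ N)"
proof (intro exI conjI)
  let ?B = "schwartz_seminorm (max m N) \<phi>"
  show "0 \<le> ?B" by (rule schwartz_seminorm_nonneg[OF \<phi>])
  show "derivs_le m \<phi> (\<lambda>p. ?B / (1 + norm p) ^ N)"
    by (rule derivs_le_weaken[OF schwartz_derivs_le[OF \<phi>, of m "max m N"]])
       (auto intro!: divide_left_mono power_increasing mult_pos_pos zero_less_power add_pos_nonneg \<open>0 \<le> ?B\<close>)
qed

lemma schwartz_functionsI:
  assumes "smooth \<phi>" "\<And>N m. \<exists>B. derivs_le m \<phi> (\<lambda>p. B / (1 + norm p) ^ N)"
  shows "\<phi> \<in> schwartz_functions"
  unfolding schwartz_functions_def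
proof (intro CollectI conjI assms(1) allI)
  fix N j k
  obtain B where B: "derivs_le (j + k) \<phi> (\<lambda>p. B / (1 + norm p) ^ N)" using assms(2) by blast
  have "(1 + norm p) ^ N * norm (partial j k \<phi> p) \<le> B" for p
  proof -
    have "norm (partial j k \<phi> p) \<le> B / (1 + norm p) ^ N"
      using B unfolding derivs_le_iff_partial[OF assms(1)] by blast
    moreover have "(1 + norm p) ^ N > 0" by (simp add: add_pos_nonneg)
    ultimately show ?thesis by (simp add: field_simps)
  qed
  then show "bounded (range (\<lambda>p. (1 + norm p) ^ N * norm (partial j k \<phi> p)))"
    by (intro boundedI[of _ B]) (auto simp: abs_mult)
qed

text \<open>The seminorm lets j and k range up to N independently, so derivatives of total order
  \<open>2 * N\<close> occur, in \<open>(N + 1)\<^sup>2\<close> terms.\<close>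

lemma schwartz_seminorm_le:
  assumes "smooth \<phi>" "derivs_le (2 * N) \<phi> (\<lambda>p. B / (1 + norm p) ^ N)"
  shows "schwartz_seminorm N \<phi> \<le> (real N + 1)\<^sup>2 * B"
proof -
  have "(SUP p. (1 + norm p) ^ N * norm (partial j k \<phi> p)) \<le> B" if "j \<le> N" "k \<le> N" for j k
  proof (rule cSUP_least)
    fix p :: "real \<times> real"
    have "norm (partial j k \<phi> p) \<le> B / (1 + norm p) ^ N"
      using assms(2) that unfolding derivs_le_iff_partial[OF assms(1)] by auto
    moreover have "(1 + norm p) ^ N > 0" by (simp add: add_pos_nonneg)
    ultimately show "(1 + norm p) ^ N * norm (partial j k \<phi> p) \<le> B" by (simp add: field_simps)
  qed auto
  then have "schwartz_seminorm N \<phi> \<le> (\<Sum>j\<le>N. \<Sum>k\<le>N. B)"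
    unfolding schwartz_seminorm_def by (intro sum_mono) auto
  then show ?thesis by (simp add: power2_eq_square algebra_simps)
qed

text \<open>A factor of polynomial growth of degree n is paid for with n extra powers of decay of
  \<phi>.\<close>

lemma schwartz_mult:
  assumes \<phi>: "\<phi> \<in> schwartz_functions" and \<psi>: "smooth \<psi>"
    and growth: "\<And>m. \<exists>A n. derivs_le m \<psi> (\<lambda>p. A * (1 + norm p) ^ n)"
  shows "(\<lambda>p. \<psi> p * \<phi> p) \<in> schwartz_functions"
proof (rule schwartz_functionsI)
  show "smooth (\<lambda>p. \<psi> p * \<phi> p)" by (intro smooth_mult \<psi> schwartz_smooth \<phi>)
  fix N m
  obtain A n where A: "derivs_le m \<psi> (\<lambda>p. A * (1 + norm p) ^ n)" using growth by blast
  obtain B where B: "derivs_le m \<phi> (\<lambda>p. B / (1 + norm p) ^ (n + N))" using schwartz_derivs_le_ex[OF \<phi>] by blast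
  have "derivs_le m (\<lambda>p. \<psi> p * \<phi> p) (\<lambda>p. 2 ^ m * (A * (1 + norm p) ^ n * (B / (1 + norm p) ^ (n + N))))"
    by (intro derivs_le_mult \<psi> schwartz_smooth \<phi> A B)
  also have "(\<lambda>p::real\<times>real. 2 ^ m * (A * (1 + norm p) ^ n * (B / (1 + norm p) ^ (n + N)))) = (\<lambda>p. (2 ^ m * A * B) / (1 + norm p) ^ N)"
  proof
    fix p :: "real \<times> real"
    have "1 + norm p \<noteq> 0" using norm_ge_zero[of p] by linarith
    then show "2 ^ m * (A * (1 + norm p) ^ n * (B / (1 + norm p) ^ (n + N))) = (2 ^ m * A * B) / (1 + norm p) ^ N"
      by (simp add: power_add)
  qed
  finally show "\<exists>B. derivs_le m (\<lambda>p. \<psi> p * \<phi> p) (\<lambda>p. B / (1 + norm p) ^ N)" by blast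
qed

lemma schwartz_cmult: "\<phi> \<in> schwartz_functions \<Longrightarrow> (\<lambda>p. a * \<phi> p) \<in> schwartz_functions"
proof (rule schwartz_mult[where \<psi> = "\<lambda>p. a"])
  show "\<exists>A n. derivs_le m (\<lambda>p. a) (\<lambda>p. A * (1 + norm p) ^ n)" for m
    using derivs_le_const[of a "norm a" m] by (intro exI[of _ "norm a"] exI[of _ 0]) simp
qed (auto simp: smooth_const)

lemma schwartz_add:
  assumes "\<phi> \<in> schwartz_functions" "\<psi> \<in> schwartz_functions"
  shows "(\<lambda>p. \<phi> p + \<psi> p) \<in> schwartz_functions"
proof (rule schwartz_functionsI)
  show "smooth (\<lambda>p. \<phi> p + \<psi> p)" using assms by (intro smooth_add schwartz_smooth)
  fix N m
  obtain A B where "derivs_le m \<phi> (\<lambda>p. A / (1 + norm p) ^ N)" "derivs_le m \<psi> (\<lambda>p. B / (1 + norm p) ^ N)"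
    using assms[THEN schwartz_derivs_le_ex] by metis
  then have "derivs_le m (\<lambda>p. \<phi> p + \<psi> p) (\<lambda>p. A / (1 + norm p) ^ N + B / (1 + norm p) ^ N)"
    using assms by (intro derivs_le_add schwartz_smooth)
  then show "\<exists>B. derivs_le m (\<lambda>p. \<phi> p + \<psi> p) (\<lambda>p. B / (1 + norm p) ^ N)"
    unfolding add_divide_distrib[symmetric] by blast
qed

lemma schwartz_d_t: "\<phi> \<in> schwartz_functions \<Longrightarrow> d_t \<phi> \<in> schwartz_functions"
proof (rule schwartz_functionsI)
  assume \<phi>: "\<phi> \<in> schwartz_functions"
  show "smooth (d_t \<phi>)" by (intro smooth_d_t schwartz_smooth \<phi>)
  show "\<exists>B. derivs_le m (d_t \<phi>) (\<lambda>p. B / (1 + norm p) ^ N)" for N m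
    using schwartz_derivs_le_ex[OF \<phi>, of "Suc m" N] by auto
qed

lemma schwartz_d_x: "\<phi> \<in> schwartz_functions \<Longrightarrow> d_x \<phi> \<in> schwartz_functions"
proof (rule schwartz_functionsI)
  assume \<phi>: "\<phi> \<in> schwartz_functions"
  show "smooth (d_x \<phi>)" by (intro smooth_d_x schwartz_smooth \<phi>)
  show "\<exists>B. derivs_le m (d_x \<phi>) (\<lambda>p. B / (1 + norm p) ^ N)" for N m
    using schwartz_derivs_le_ex[OF \<phi>, of "Suc m" N] by auto
qed

lemma abs_fst_le: "\<bar>fst p\<bar> \<le> norm p" and abs_snd_le: "\<bar>snd p\<bar> \<le> norm p" for p :: "real \<times> real"
  using norm_fst_le[of "fst p" "snd p"] norm_snd_le[of "snd p" "fst p"] by simp_all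

lemma smooth_fst: "smooth (\<lambda>p. of_real (fst p))" and smooth_snd: "smooth (\<lambda>p. of_real (snd p))"
  and has_dt_fst: "has_dt (\<lambda>p. of_real (fst p)) (\<lambda>p. 1)" and has_dx_fst: "has_dx (\<lambda>p. of_real (fst p)) (\<lambda>p. 0)"
  and has_dt_snd: "has_dt (\<lambda>p. of_real (snd p)) (\<lambda>p. 0)" and has_dx_snd: "has_dx (\<lambda>p. of_real (snd p)) (\<lambda>p. 1)"
proof -
  have 1: "((\<lambda>t. complex_of_real t) has_vector_derivative 1) (at s)" for s
    using has_vector_derivative_of_real[OF DERIV_ident] by simp
  show d: "has_dt (\<lambda>p. of_real (fst p)) (\<lambda>p. 1)" "has_dx (\<lambda>p. of_real (fst p)) (\<lambda>p. 0)"
    "has_dt (\<lambda>p. of_real (snd p)) (\<lambda>p. 0)" "has_dx (\<lambda>p. of_real (snd p)) (\<lambda>p. 1)"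
    unfolding has_dt_def has_dx_def using 1 by simp_all
  have "Ck k (\<lambda>p. of_real (fst p))" for k
    by (cases k) (auto simp del: Ck.simps(2) intro!: continuous_intros Ck_SucI[OF _ d(1) Ck_const d(2) Ck_const])
  then show "smooth (\<lambda>p. of_real (fst p))" by (simp add: smooth_def)
  have "Ck k (\<lambda>p. of_real (snd p))" for k
    by (cases k) (auto simp del: Ck.simps(2) intro!: continuous_intros Ck_SucI[OF _ d(3) Ck_const d(4) Ck_const])
  then show "smooth (\<lambda>p. of_real (snd p))" by (simp add: smooth_def)
qed

lemma derivs_le_fst: "derivs_le m (\<lambda>p. of_real (fst p)) (\<lambda>p. 1 * (1 + norm p) ^ 1)"
proof -
  have n: "norm (complex_of_real (fst p)) \<le> 1 + norm p" for p :: "real \<times> real"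
    using abs_fst_le[of p] by simp
  have c: "derivs_le k (\<lambda>p. a) (\<lambda>p. 1 + norm p)" if "norm a \<le> 1" for k a
    by (rule derivs_le_weaken[OF derivs_le_const[OF that]]) simp
  show ?thesis using n c[of 1] c[of 0]
    by (cases m) (simp_all add: has_dt_imp_d_t[OF has_dt_fst] has_dx_imp_d_x[OF has_dx_fst])
qed

lemma derivs_le_snd: "derivs_le m (\<lambda>p. of_real (snd p)) (\<lambda>p. 1 * (1 + norm p) ^ 1)"
proof -
  have n: "norm (complex_of_real (snd p)) \<le> 1 + norm p" for p :: "real \<times> real"
    using abs_snd_le[of p] by simp
  have c: "derivs_le k (\<lambda>p. a) (\<lambda>p. 1 + norm p)" if "norm a \<le> 1" for k a
    by (rule derivs_le_weaken[OF derivs_le_const[OF that]]) simp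
  show ?thesis using n c[of 1] c[of 0]
    by (cases m) (simp_all add: has_dt_imp_d_t[OF has_dt_snd] has_dx_imp_d_x[OF has_dx_snd])
qed

lemma schwartz_mult_fst: "\<phi> \<in> schwartz_functions \<Longrightarrow> (\<lambda>p. of_real (fst p) * \<phi> p) \<in> schwartz_functions"
proof (rule schwartz_mult[OF _ smooth_fst])
  show "\<exists>A n. derivs_le m (\<lambda>p. of_real (fst p)) (\<lambda>p. A * (1 + norm p) ^ n)" for m
    by (rule exI)+ (rule derivs_le_fst)
qed

lemma schwartz_mult_snd: "\<phi> \<in> schwartz_functions \<Longrightarrow> (\<lambda>p. of_real (snd p) * \<phi> p) \<in> schwartz_functions"
proof (rule schwartz_mult[OF _ smooth_snd])
  show "\<exists>A n. derivs_le m (\<lambda>p. of_real (snd p)) (\<lambda>p. A * (1 + norm p) ^ n)" for m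
    by (rule exI)+ (rule derivs_le_snd)
qed

section \<open>Flat functions and bumps on rectangles\<close>

lemma has_dt_compose_affine:
  assumes "\<And>s. (F has_real_derivative F' s) (at s)"
  shows "has_dt (\<lambda>p. of_real (F (\<alpha> * fst p + \<beta> * snd p + r))) (\<lambda>p. of_real \<alpha> * of_real (F' (\<alpha> * fst p + \<beta> * snd p + r)))"
    "has_dx (\<lambda>p. of_real (F (\<alpha> * fst p + \<beta> * snd p + r))) (\<lambda>p. of_real \<beta> * of_real (F' (\<alpha> * fst p + \<beta> * snd p + r)))"
proof -
  have 1: "((\<lambda>t. F (\<alpha> * t + \<beta> * x + r)) has_real_derivative F' (\<alpha> * t + \<beta> * x + r) * \<alpha>) (at t)" for t x
    by (rule DERIV_chain2[OF assms]) (auto intro!: derivative_eq_intros)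
  show "has_dt (\<lambda>p. of_real (F (\<alpha> * fst p + \<beta> * snd p + r))) (\<lambda>p. of_real \<alpha> * of_real (F' (\<alpha> * fst p + \<beta> * snd p + r)))"
    unfolding has_dt_def using has_vector_derivative_of_real[where 'a = complex, OF 1] by (simp add: mult.commute)
  have 2: "((\<lambda>x. F (\<alpha> * t + \<beta> * x + r)) has_real_derivative F' (\<alpha> * t + \<beta> * x + r) * \<beta>) (at x)" for t x
    by (rule DERIV_chain2[OF assms]) (auto intro!: derivative_eq_intros)
  show "has_dx (\<lambda>p. of_real (F (\<alpha> * fst p + \<beta> * snd p + r))) (\<lambda>p. of_real \<beta> * of_real (F' (\<alpha> * fst p + \<beta> * snd p + r)))"
    unfolding has_dx_def using has_vector_derivative_of_real[where 'a = complex, OF 2] by (simp add: mult.commute)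
qed

lemma has_dt_cmult: "has_dt \<phi> \<phi>' \<Longrightarrow> has_dt (\<lambda>p. a * \<phi> p) (\<lambda>p. a * \<phi>' p)"
  and has_dx_cmult: "has_dx \<phi> \<phi>' \<Longrightarrow> has_dx (\<lambda>p. a * \<phi> p) (\<lambda>p. a * \<phi>' p)"
  using has_dt_mult[OF has_dt_const, of \<phi> \<phi>' a] has_dx_mult[OF has_dx_const, of \<phi> \<phi>' a] by simp_all

text \<open>The sequence \<open>D\<close> lists all derivatives of \<open>D 0\<close>. Constant
  multiples of the \<open>D n\<close>, composed with a fixed affine form, are then closed under both
  partial derivatives, as \<open>smooth_coinduct\<close> requires.\<close>

lemma smooth_compose_affine:
  assumes D: "\<And>n s. (D n has_real_derivative D (Suc n) s) (at s)"
  shows "smooth (\<lambda>p. of_real (D 0 (\<alpha> * fst p + \<beta> * snd p + r)))"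
proof -
  define P where "P \<phi> \<longleftrightarrow> (\<exists>a n. \<phi> = (\<lambda>p. a * complex_of_real (D n (\<alpha> * fst p + \<beta> * snd p + r))))" for \<phi> :: planefun
  have cont: "continuous_on UNIV (D n)" for n
    using D by (intro continuous_at_imp_continuous_on) (auto intro: DERIV_isCont)
  show ?thesis
  proof (rule smooth_coinduct[where P = P])
    show "P (\<lambda>p. of_real (D 0 (\<alpha> * fst p + \<beta> * snd p + r)))"
      unfolding P_def by (intro exI[of _ 1] exI[of _ 0]) simp
    fix \<phi> assume "P \<phi>"
    then obtain a n where \<phi>: "\<phi> = (\<lambda>p. a * complex_of_real (D n (\<alpha> * fst p + \<beta> * snd p + r)))" by (auto simp: P_def)
    show "continuous_on UNIV \<phi>"
      unfolding \<phi> by (intro continuous_intros continuous_on_compose2[OF cont[of n]]) auto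
    show "\<exists>\<psi>. has_dt \<phi> \<psi> \<and> P \<psi>"
      by (rule exI, rule conjI, unfold \<phi>, rule has_dt_cmult[OF has_dt_compose_affine(1)[OF D]])
         (auto simp: P_def mult.assoc[symmetric])
    show "\<exists>\<psi>. has_dx \<phi> \<psi> \<and> P \<psi>"
      by (rule exI, rule conjI, unfold \<phi>, rule has_dx_cmult[OF has_dt_compose_affine(2)[OF D]])
         (auto simp: P_def mult.assoc[symmetric])
  qed
qed

text \<open>The additional power \<open>s ^ k\<close> lets the induction over the coefficients of
  the polynomial shift one degree at a time; the difference quotient in
  \<open>flat_has_derivative\<close> uses k = 1.\<close>

lemma poly_mult_exp_tendsto_0:
  fixes P :: "real poly" and \<epsilon> :: real
  assumes "\<epsilon> > 0"
  shows "((\<lambda>s. s ^ k * poly P s * exp (- \<epsilon> * s)) \<longlongrightarrow> 0) at_top"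
proof (induction P arbitrary: k)
  case 0
  then show ?case by simp
next
  case (pCons a P)
  have "((\<lambda>s. s ^ k * exp (- \<epsilon> * s)) \<longlongrightarrow> 0) at_top"
  proof -
    have "((\<lambda>s. (\<epsilon> * s) ^ k / exp (\<epsilon> * s)) \<longlongrightarrow> 0) at_top"
      by (rule filterlim_compose[OF tendsto_power_div_exp_0])
         (use assms in \<open>auto intro!: filterlim_tendsto_pos_mult_at_top tendsto_const filterlim_ident\<close>)
    from tendsto_mult_left[OF this, of "1 / \<epsilon> ^ k"] show ?thesis
      using assms by (simp add: power_mult_distrib exp_minus field_simps)
  qed
  from tendsto_add[OF tendsto_mult_left[OF this, of a] pCons.IH[of "Suc k"]] show ?case
    by (simp add: algebra_simps)
qed

text \<open>The classical exp (-\<epsilon> / t) extended by zero, times a polynomial in 1 / t. The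
  polynomial factor makes the family closed under differentiation.\<close>

definition flat :: "real \<Rightarrow> real poly \<Rightarrow> real \<Rightarrow> real" where
  "flat \<epsilon> P t = (if t > 0 then poly P (1 / t) * exp (- \<epsilon> / t) else 0)"

text \<open>Read off from (P(1/t) exp (-\<epsilon>/t))' = t^-2 (\<epsilon> P - P')(1/t) exp
  (-\<epsilon>/t); \<open>monom 1 2\<close> is the factor t^-2.\<close>

definition flat_deriv :: "real \<Rightarrow> real poly \<Rightarrow> real poly" where
  "flat_deriv \<epsilon> P = monom 1 2 * (smult \<epsilon> P - pderiv P)"

lemma flat_has_derivative:
  assumes "\<epsilon> > 0"
  shows "(flat \<epsilon> P has_real_derivative flat \<epsilon> (flat_deriv \<epsilon> P) t) (at t)"
proof -
  consider "t > 0" | "t < 0" | "t = 0" by linarith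
  then show ?thesis
  proof cases
    case 1
    have "((\<lambda>t. poly P (1 / t) * exp (- \<epsilon> / t)) has_real_derivative flat \<epsilon> (flat_deriv \<epsilon> P) t) (at t)"
      using 1 by (auto intro!: derivative_eq_intros DERIV_chain2[OF poly_DERIV]
        simp: flat_def flat_deriv_def poly_monom power2_eq_square field_simps)
    then show ?thesis
      by (rule has_field_derivative_transform_within_open[of _ _ _ "{0<..}"]) (use 1 in \<open>auto simp: flat_def\<close>)
  next
    case 2
    have "((\<lambda>t. 0) has_real_derivative flat \<epsilon> (flat_deriv \<epsilon> P) t) (at t)"
      using 2 by (simp add: flat_def)
    then show ?thesis
      by (rule has_field_derivative_transform_within_open[of _ _ _ "{..<0}"]) (use 2 in \<open>auto simp: flat_def\<close>)
  next
    case 3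
    \<comment> \<open>At 0 the exponential beats every power of 1 / h, including the one added by
      the difference quotient, so both one-sided derivatives vanish.\<close>
    have "((\<lambda>h. flat \<epsilon> P h / h) \<longlongrightarrow> 0) (at 0)"
    proof (rule filterlim_split_at)
      have "((\<lambda>h. flat \<epsilon> P h / h) \<longlongrightarrow> 0) (at_left 0) \<longleftrightarrow> ((\<lambda>h::real. 0) \<longlongrightarrow> (0::real)) (at_left 0)"
        by (intro filterlim_cong) (auto simp: eventually_at_filter flat_def)
      then show "((\<lambda>h. flat \<epsilon> P h / h) \<longlongrightarrow> 0) (at_left 0)" by simp
      have "((\<lambda>h. inverse h ^ 1 * poly P (inverse h) * exp (- \<epsilon> * inverse h)) \<longlongrightarrow> 0) (at_right 0)"
        by (rule filterlim_compose[OF poly_mult_exp_tendsto_0[OF assms] filterlim_inverse_at_top_right])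
      moreover have "((\<lambda>h. flat \<epsilon> P h / h) \<longlongrightarrow> 0) (at_right 0) \<longleftrightarrow>
         ((\<lambda>h. inverse h ^ 1 * poly P (inverse h) * exp (- \<epsilon> * inverse h)) \<longlongrightarrow> 0) (at_right 0)"
        by (intro filterlim_cong) (auto simp: eventually_at_filter flat_def field_simps)
      ultimately show "((\<lambda>h. flat \<epsilon> P h / h) \<longlongrightarrow> 0) (at_right 0)" by simp
    qed
    then show ?thesis using 3 by (simp add: DERIV_def flat_def)
  qed
qed

lemma smooth_flat:
  assumes "\<epsilon> > 0"
  shows "smooth (\<lambda>p. of_real (flat \<epsilon> 1 (\<alpha> * fst p + \<beta> * snd p + r)))"
  using smooth_compose_affine[where D = "\<lambda>n. flat \<epsilon> ((flat_deriv \<epsilon> ^^ n) 1)", of \<alpha> \<beta> r] flat_has_derivative[OF assms]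
  by simp

text \<open>As \<open>\<epsilon>\<close> decreases to \<open>0\<close> these functions increase to the indicator function of an open rectangle.\<close>
definition box_bump :: "real \<Rightarrow> real \<times> real \<Rightarrow> real \<times> real \<Rightarrow> real \<times> real \<Rightarrow> real" where
  "box_bump \<epsilon> a b p = flat \<epsilon> 1 (fst p - fst a) * flat \<epsilon> 1 (fst b - fst p) *
     (flat \<epsilon> 1 (snd p - snd a) * flat \<epsilon> 1 (snd b - snd p))"

lemma smooth_box_bump:
  assumes "\<epsilon> > 0"
  shows "smooth (\<lambda>p. of_real (box_bump \<epsilon> a b p))"
proof -
  have "smooth (\<lambda>p. of_real (flat \<epsilon> 1 (fst p - fst a)) * of_real (flat \<epsilon> 1 (fst b - fst p)) *
     (of_real (flat \<epsilon> 1 (snd p - snd a)) * of_real (flat \<epsilon> 1 (snd b - snd p))))"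
    using smooth_flat[OF assms, of 1 0 "- fst a"] smooth_flat[OF assms, of "-1" 0 "fst b"]
     smooth_flat[OF assms, of 0 1 "- snd a"] smooth_flat[OF assms, of 0 "-1" "snd b"]
    by (intro smooth_mult) simp_all
  then show ?thesis by (simp add: box_bump_def)
qed

lemma flat_bounds: "\<epsilon> > 0 \<Longrightarrow> 0 \<le> flat \<epsilon> 1 t" "\<epsilon> > 0 \<Longrightarrow> flat \<epsilon> 1 t \<le> 1"
  by (auto simp: flat_def)

lemma mem_box_plane: "p \<in> box a b \<longleftrightarrow> fst a < fst p \<and> fst p < fst b \<and> snd a < snd p \<and> snd p < snd b"
  for p a b :: "real \<times> real"
  by (cases p; cases a; cases b) (auto simp: box_def Basis_prod_def)

lemma box_bump_zero: "p \<notin> box a b \<Longrightarrow> box_bump \<epsilon> a b p = 0"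
  by (auto simp: mem_box_plane box_bump_def flat_def)

lemma box_bump_bounds: "\<epsilon> > 0 \<Longrightarrow> 0 \<le> box_bump \<epsilon> a b p" "\<epsilon> > 0 \<Longrightarrow> box_bump \<epsilon> a b p \<le> 1"
  by (auto simp: box_bump_def flat_bounds intro!: mult_le_one mult_nonneg_nonneg)

lemma flat_tendsto: "(\<lambda>n. flat (1 / real (Suc n)) 1 t) \<longlonglongrightarrow> indicator {0<..} t"
proof (cases "t > 0")
  case True
  have "(\<lambda>n. exp (- (1 / real (Suc n)) / t)) \<longlonglongrightarrow> exp (- 0 / t)"
    using True by (intro tendsto_intros LIMSEQ_Suc[OF lim_1_over_n]) auto
  then show ?thesis using True by (simp add: flat_def)
qed (simp add: flat_def)

lemma box_bump_tendsto: "(\<lambda>n. box_bump (1 / real (Suc n)) a b p) \<longlonglongrightarrow> indicator (box a b) p"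
proof -
  have "(\<lambda>n. box_bump (1 / real (Suc n)) a b p) \<longlonglongrightarrow>
    indicator {0<..} (fst p - fst a) * indicator {0<..} (fst b - fst p) *
     (indicator {0<..} (snd p - snd a) * indicator {0<..} (snd b - snd p))"
    unfolding box_bump_def by (intro tendsto_mult flat_tendsto)
  also have "indicator {0<..} (fst p - fst a) * indicator {0<..} (fst b - fst p) *
     (indicator {0<..} (snd p - snd a) * indicator {0<..} (snd b - snd p)) = (indicator (box a b) p :: real)"
    by (auto simp: indicator_def mem_box_plane)
  finally show ?thesis .
qed

section \<open>Test functions and exponential weights\<close>

lemma support_subset: "(\<And>p. p \<notin> S \<Longrightarrow> \<phi> p = 0) \<Longrightarrow> closed S \<Longrightarrow> support \<phi> \<subseteq> S"
  unfolding support_def by (intro closure_minimal) auto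

lemma not_in_support: "p \<notin> support \<phi> \<Longrightarrow> \<phi> p = 0"
  using closure_subset[of "{p. \<phi> p \<noteq> 0}"] by (auto simp: support_def)

lemma test_functionsI:
  assumes "smooth \<phi>" "\<And>p. p \<notin> S \<Longrightarrow> \<phi> p = 0" "compact S"
  shows "\<phi> \<in> test_functions"
proof -
  have "support \<phi> \<subseteq> S" using assms by (intro support_subset compact_imp_closed)
  then have "compact (support \<phi>)"
    using assms(3) by (metis compact_Int_closed closed_closure inf.absorb_iff2 support_def)
  then show ?thesis using assms by (simp add: test_functions_def)
qed

lemma box_bump_test: "\<epsilon> > 0 \<Longrightarrow> (\<lambda>p. of_real (box_bump \<epsilon> a b p)) \<in> test_functions"
proof (rule test_functionsI[where S = "cbox a b"])
  fix p assume "p \<notin> cbox a b"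
  then have "p \<notin> box a b" using box_subset_cbox by blast
  then show "complex_of_real (box_bump \<epsilon> a b p) = 0" by (simp add: box_bump_zero)
qed (auto intro: smooth_box_bump)

lemma test_smooth: "\<phi> \<in> test_functions \<Longrightarrow> smooth \<phi>"
  by (simp add: test_functions_def)

lemma d_t_outside_support:
  assumes "smooth \<phi>" "p \<notin> support \<phi>"
  shows "d_t \<phi> p = 0" "d_x \<phi> p = 0"
proof -
  obtain t x where p: "p = (t, x)" by force
  have op: "open (- support \<phi>)" unfolding support_def by auto
  have 1: "open {t'. (t', x) \<in> - support \<phi>}"
    using open_vimage[OF op, of "\<lambda>t'. (t', x)"] by (simp add: vimage_def continuous_on_Pair)
  have 2: "open {x'. (t, x') \<in> - support \<phi>}"
    using open_vimage[OF op, of "\<lambda>x'. (t, x')"] by (simp add: vimage_def continuous_on_Pair)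
  have "((\<lambda>t'. \<phi> (t', x)) has_vector_derivative 0) (at t)"
    by (rule has_vector_derivative_transform_within_open[OF has_vector_derivative_const 1])
       (use assms p in \<open>auto simp: not_in_support\<close>)
  moreover have "((\<lambda>t'. \<phi> (t', x)) has_vector_derivative d_t \<phi> p) (at t)"
    using smooth_has_dt[OF assms(1)] p by (auto simp: has_dt_def)
  ultimately show "d_t \<phi> p = 0" by (rule vector_derivative_unique_at[symmetric])
  have "((\<lambda>x'. \<phi> (t, x')) has_vector_derivative 0) (at x)"
    by (rule has_vector_derivative_transform_within_open[OF has_vector_derivative_const 2])
       (use assms p in \<open>auto simp: not_in_support\<close>)
  moreover have "((\<lambda>x'. \<phi> (t, x')) has_vector_derivative d_x \<phi> p) (at x)"
    using smooth_has_dx[OF assms(1)] p by (auto simp: has_dx_def)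
  ultimately show "d_x \<phi> p = 0" by (rule vector_derivative_unique_at[symmetric])
qed

lemma support_partial: "smooth \<phi> \<Longrightarrow> support (partial j k \<phi>) \<subseteq> support \<phi>"
proof -
  assume s: "smooth \<phi>"
  have cl: "closed (support \<psi>)" for \<psi> by (simp add: support_def)
  have t: "support (d_t \<psi>) \<subseteq> support \<psi>" "support (d_x \<psi>) \<subseteq> support \<psi>" if "smooth \<psi>" for \<psi>
    by (rule support_subset[OF d_t_outside_support(1)[OF that] cl], assumption,
        rule support_subset[OF d_t_outside_support(2)[OF that] cl], assumption)
  have 1: "support ((d_x ^^ k) \<phi>) \<subseteq> support \<phi>"
  proof (induction k)
    case (Suc k)
    have "support (d_x ((d_x ^^ k) \<phi>)) \<subseteq> support ((d_x ^^ k) \<phi>)" by (rule t(2)[OF smooth_d_x_pow[OF s]])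
    then show ?case using Suc by simp
  qed simp
  have "support (partial j k \<phi>) \<subseteq> support ((d_x ^^ k) \<phi>)"
  proof (induction j)
    case (Suc j)
    have "partial (Suc j) k \<phi> = d_t (partial j k \<phi>)" by (simp add: partial_def)
    then show ?case using Suc t(1)[OF smooth_partial[OF s], of j k] by simp
  qed (simp add: partial_def)
  with 1 show ?thesis by blast
qed

lemma test_seminorm_upper:
  assumes \<phi>: "\<phi> \<in> test_functions" and jk: "j \<le> N" "k \<le> N"
  shows "norm (partial j k \<phi> p) \<le> test_seminorm N \<phi>"
proof -
  have s: "smooth \<phi>" "compact (support \<phi>)" using \<phi> by (auto simp: test_functions_def)
  have bd: "bdd_above (range (\<lambda>p. norm (partial j k \<phi> p)))" for j k
  proof -
    have C: "compact (partial j k \<phi> ` support \<phi>)"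
      using s by (intro compact_continuous_image continuous_on_subset[OF smooth_imp_continuous[OF smooth_partial]]) auto
    obtain B where "\<forall>z\<in>partial j k \<phi> ` support \<phi>. norm z \<le> B"
      using compact_imp_bounded[OF C] unfolding bounded_iff by (elim exE)
    then have B: "norm (partial j k \<phi> p) \<le> B" if "p \<in> support \<phi>" for p using that by simp
    have "norm (partial j k \<phi> p) \<le> max B 0" for p
    proof (cases "p \<in> support \<phi>")
      case True
      then show ?thesis using B[of p] by simp
    next
      case False
      then have "partial j k \<phi> p = 0" using support_partial[OF s(1)] not_in_support by blast
      then show ?thesis by simp
    qed
    then show ?thesis by (intro bdd_aboveI[of _ "max B 0"]) auto
  qed
  have nn: "0 \<le> (SUP p. norm (partial j k \<phi> p))" for j k
    by (rule cSUP_upper2[OF bd, of 0]) auto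
  have "norm (partial j k \<phi> p) \<le> (SUP p. norm (partial j k \<phi> p))" by (intro cSUP_upper bd) auto
  also have "\<dots> \<le> (\<Sum>k\<le>N. SUP p. norm (partial j k \<phi> p))" using jk nn by (intro member_le_sum) auto
  also have "\<dots> \<le> (\<Sum>j\<le>N. \<Sum>k\<le>N. SUP p. norm (partial j k \<phi> p))"
    using jk nn by (intro member_le_sum[of j]) (auto intro: sum_nonneg)
  finally show ?thesis by (simp add: test_seminorm_def)
qed

lemma test_seminorm_nonneg: "\<phi> \<in> test_functions \<Longrightarrow> 0 \<le> test_seminorm N \<phi>"
  by (rule order_trans[OF norm_ge_zero test_seminorm_upper[of \<phi> 0 N 0 0]]) auto

lemma test_derivs_le:
  assumes \<phi>: "\<phi> \<in> test_functions"
  shows "derivs_le m \<phi> (\<lambda>p. test_seminorm m \<phi> * indicator (support \<phi>) p)"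
  unfolding derivs_le_iff_partial[OF test_smooth[OF \<phi>]]
proof (intro allI impI)
  fix j k p assume jk: "j + k \<le> m"
  show "norm (partial j k \<phi> p) \<le> test_seminorm m \<phi> * indicator (support \<phi>) p"
  proof (cases "p \<in> support \<phi>")
    case True
    then show ?thesis using test_seminorm_upper[OF \<phi>, of j m k p] jk by simp
  next
    case False
    then have "partial j k \<phi> p = 0" using support_partial[OF test_smooth[OF \<phi>]] not_in_support by blast
    then show ?thesis using test_seminorm_nonneg[OF \<phi>] by simp
  qed
qed

definition exp_fst :: "real \<Rightarrow> planefun" where
  "exp_fst \<gamma> p = of_real (exp (\<gamma> * fst p))"

lemma has_dt_exp_fst: "has_dt (exp_fst \<gamma>) (\<lambda>p. of_real \<gamma> * exp_fst \<gamma> p)"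
  and has_dx_exp_fst: "has_dx (exp_fst \<gamma>) (\<lambda>p. 0)"
  using has_dt_compose_affine[OF DERIV_exp, of \<gamma> 0 0] by (simp_all add: exp_fst_def[abs_def])

lemma smooth_exp_fst: "smooth (exp_fst \<gamma>)"
  using smooth_compose_affine[where D = "\<lambda>n. exp", OF DERIV_exp, of \<gamma> 0 0] by (simp add: exp_fst_def[abs_def])

lemma derivs_le_exp_fst: "derivs_le m (\<lambda>p. a * exp_fst \<gamma> p) (\<lambda>p. norm a * (1 + \<bar>\<gamma>\<bar>) ^ m * exp (\<gamma> * fst p))"
proof (induction m arbitrary: a)
  case 0
  then show ?case by (simp add: exp_fst_def norm_mult)
next
  case (Suc m)
  have g: "(1 + \<bar>\<gamma>\<bar>) ^ m \<ge> 1" by (intro one_le_power) simp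
  have 0: "norm (a * exp_fst \<gamma> p) \<le> norm a * (1 + \<bar>\<gamma>\<bar>) ^ Suc m * exp (\<gamma> * fst p)" for p
  proof -
    have "norm a * 1 * exp (\<gamma> * fst p) \<le> norm a * (1 + \<bar>\<gamma>\<bar>) ^ Suc m * exp (\<gamma> * fst p)"
      by (intro mult_right_mono mult_left_mono one_le_power) auto
    then show ?thesis by (simp add: exp_fst_def norm_mult)
  qed
  have 1: "derivs_le m (\<lambda>p. a * (of_real \<gamma> * exp_fst \<gamma> p)) (\<lambda>p. norm a * (1 + \<bar>\<gamma>\<bar>) ^ Suc m * exp (\<gamma> * fst p))"
  proof (rule derivs_le_weaken)
    show "derivs_le m (\<lambda>p. a * (of_real \<gamma> * exp_fst \<gamma> p)) (\<lambda>p. norm (a * of_real \<gamma>) * (1 + \<bar>\<gamma>\<bar>) ^ m * exp (\<gamma> * fst p))"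
      using Suc.IH[of "a * of_real \<gamma>"] by (simp add: mult.assoc)
    show "norm (a * of_real \<gamma>) * (1 + \<bar>\<gamma>\<bar>) ^ m * exp (\<gamma> * fst p) \<le> norm a * (1 + \<bar>\<gamma>\<bar>) ^ Suc m * exp (\<gamma> * fst p)" for p :: "real \<times> real"
    proof -
      have "norm a * (\<bar>\<gamma>\<bar> * (1 + \<bar>\<gamma>\<bar>) ^ m) * exp (\<gamma> * fst p) \<le> norm a * ((1 + \<bar>\<gamma>\<bar>) * (1 + \<bar>\<gamma>\<bar>) ^ m) * exp (\<gamma> * fst p)"
        by (intro mult_right_mono mult_left_mono) auto
      then show ?thesis by (simp add: norm_mult mult.assoc)
    qed
  qed
  have 2: "derivs_le m (\<lambda>p. 0) (\<lambda>p. norm a * (1 + \<bar>\<gamma>\<bar>) ^ Suc m * exp (\<gamma> * fst p))"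
    by (rule derivs_le_weaken[OF derivs_le_const[of 0 0]]) auto
  show ?case
    using 0 1 2 has_dt_imp_d_t[OF has_dt_cmult[OF has_dt_exp_fst, of a]] has_dx_imp_d_x[OF has_dx_cmult[OF has_dx_exp_fst, of a]]
    by simp
qed

lemma test_mult_exp_fst: "\<phi> \<in> test_functions \<Longrightarrow> (\<lambda>p. exp_fst \<gamma> p * \<phi> p) \<in> test_functions"
  by (rule test_functionsI[where S = "support \<phi>"])
     (auto simp: not_in_support test_functions_def intro: smooth_mult smooth_exp_fst)

text \<open>On a fixed compact set the exponential and the polynomial weight are both bounded, so
  multiplication by the exponential is continuous from test functions supported there into the
  Schwartz space. Schwartz functions in general do not tolerate this factor.\<close>

lemma test_exp_derivs_le:
  assumes K: "compact K"
  shows "\<exists>C\<ge>0. \<forall>\<phi>\<in>test_functions. support \<phi> \<subseteq> K \<longrightarrow>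
    derivs_le m (\<lambda>p. exp_fst \<gamma> p * \<phi> p) (\<lambda>p. C * test_seminorm m \<phi> / (1 + norm p) ^ N)"
proof -
  obtain R where R: "R > 0" "\<And>p. p \<in> K \<Longrightarrow> norm p \<le> R" using compact_imp_bounded[OF K] bounded_pos by metis
  define C where "C = 2 ^ m * ((1 + \<bar>\<gamma>\<bar>) ^ m * exp (\<bar>\<gamma>\<bar> * R)) * (1 + R) ^ N"
  show ?thesis
  proof (intro exI[of _ C] conjI ballI impI)
    show "0 \<le> C" using R by (simp add: C_def)
    fix \<phi> assume \<phi>: "\<phi> \<in> test_functions" and sup: "support \<phi> \<subseteq> K"
    have "derivs_le m (\<lambda>p. exp_fst \<gamma> p * \<phi> p) (\<lambda>p. 2 ^ m * ((1 + \<bar>\<gamma>\<bar>) ^ m * exp (\<gamma> * fst p) * (test_seminorm m \<phi> * indicator (support \<phi>) p)))"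
      using derivs_le_exp_fst[of m 1 \<gamma>] by (intro derivs_le_mult smooth_exp_fst test_smooth \<phi> test_derivs_le) simp
    then show "derivs_le m (\<lambda>p. exp_fst \<gamma> p * \<phi> p) (\<lambda>p. C * test_seminorm m \<phi> / (1 + norm p) ^ N)"
    proof (rule derivs_le_weaken)
      fix p :: "real \<times> real"
      have T: "0 \<le> test_seminorm m \<phi>" by (rule test_seminorm_nonneg[OF \<phi>])
      have pos: "(1 + norm p) ^ N > 0" by (simp add: add_pos_nonneg)
      show "2 ^ m * ((1 + \<bar>\<gamma>\<bar>) ^ m * exp (\<gamma> * fst p) * (test_seminorm m \<phi> * indicator (support \<phi>) p)) \<le> C * test_seminorm m \<phi> / (1 + norm p) ^ N"
      proof (cases "p \<in> support \<phi>")
        case True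
        then have n: "norm p \<le> R" using R(2)[of p] sup by blast
        then have "\<bar>\<gamma> * fst p\<bar> \<le> \<bar>\<gamma>\<bar> * R" using abs_fst_le[of p] by (simp add: abs_mult mult_left_mono)
        then have e: "exp (\<gamma> * fst p) \<le> exp (\<bar>\<gamma>\<bar> * R)" by simp
        have "2 ^ m * ((1 + \<bar>\<gamma>\<bar>) ^ m * exp (\<gamma> * fst p)) * (1 + norm p) ^ N * test_seminorm m \<phi> \<le> C * test_seminorm m \<phi>"
          unfolding C_def using n e R T by (intro mult_mono power_mono mult_left_mono) auto
        then show ?thesis using True pos by (simp add: field_simps)
      next
        case False
        then show ?thesis using T pos \<open>0 \<le> C\<close> by simp
      qed
    qed
  qed
qed

lemma test_imp_schwartz:
  assumes "\<phi> \<in> test_functions"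
  shows "\<phi> \<in> schwartz_functions"
proof (rule schwartz_functionsI[OF test_smooth[OF assms]])
  fix N m
  have "compact (support \<phi>)" using assms by (simp add: test_functions_def)
  from test_exp_derivs_le[OF this, of m 0 N] assms show "\<exists>B. derivs_le m \<phi> (\<lambda>p. B / (1 + norm p) ^ N)"
    by (auto simp: exp_fst_def)
qed

lemma schwartz_seminorm_exp_test:
  assumes K: "compact K"
  shows "\<exists>C\<ge>0. \<forall>\<phi>\<in>test_functions. support \<phi> \<subseteq> K \<longrightarrow>
    schwartz_seminorm N (\<lambda>p. exp_fst \<gamma> p * \<phi> p) \<le> C * test_seminorm (2 * N) \<phi>"
proof -
  obtain C where C: "C \<ge> 0" "\<forall>\<phi>\<in>test_functions. support \<phi> \<subseteq> K \<longrightarrow>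
    derivs_le (2 * N) (\<lambda>p. exp_fst \<gamma> p * \<phi> p) (\<lambda>p. C * test_seminorm (2 * N) \<phi> / (1 + norm p) ^ N)"
    using test_exp_derivs_le[OF K] by metis
  show ?thesis
  proof (intro exI[of _ "(real N + 1)\<^sup>2 * C"] conjI ballI impI)
    show "0 \<le> (real N + 1)\<^sup>2 * C" using C by simp
    fix \<phi> assume \<phi>: "\<phi> \<in> test_functions" "support \<phi> \<subseteq> K"
    then show "schwartz_seminorm N (\<lambda>p. exp_fst \<gamma> p * \<phi> p) \<le> (real N + 1)\<^sup>2 * C * test_seminorm (2 * N) \<phi>"
      using schwartz_seminorm_le[OF test_smooth[OF test_mult_exp_fst[OF \<phi>(1)]], of N \<gamma> "C * test_seminorm (2 * N) \<phi>"] C(2)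
      by (simp add: mult.assoc)
  qed
qed

section \<open>Dilations, cutoffs and density of the test functions\<close>

lemma has_dt_dilation: "has_dt \<phi> \<psi> \<Longrightarrow> has_dt (\<lambda>p. \<phi> (r *\<^sub>R p)) (\<lambda>p. of_real r * \<psi> (r *\<^sub>R p))"
  and has_dx_dilation: "has_dx \<phi> \<psi> \<Longrightarrow> has_dx (\<lambda>p. \<phi> (r *\<^sub>R p)) (\<lambda>p. of_real r * \<psi> (r *\<^sub>R p))"
proof -
  have d: "((\<lambda>t. r * t) has_vector_derivative r) (at t)" for t
    by (auto intro!: derivative_eq_intros simp: has_vector_derivative_def mult.commute)
  show "has_dt (\<lambda>p. \<phi> (r *\<^sub>R p)) (\<lambda>p. of_real r * \<psi> (r *\<^sub>R p))" if "has_dt \<phi> \<psi>"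
    using vector_diff_chain_at[OF d] that by (fastforce simp: has_dt_def o_def scaleR_conv_of_real)
  show "has_dx (\<lambda>p. \<phi> (r *\<^sub>R p)) (\<lambda>p. of_real r * \<psi> (r *\<^sub>R p))" if "has_dx \<phi> \<psi>"
    using vector_diff_chain_at[OF d] that by (fastforce simp: has_dx_def o_def scaleR_conv_of_real)
qed

lemma smooth_dilation:
  assumes "smooth \<phi>"
  shows "smooth (\<lambda>p. \<phi> (r *\<^sub>R p))"
proof (rule smooth_coinduct[where P = "\<lambda>\<omega>. \<exists>a \<phi>. smooth \<phi> \<and> \<omega> = (\<lambda>p. a * \<phi> (r *\<^sub>R p))"])
  show "\<exists>a \<phi>'. smooth \<phi>' \<and> (\<lambda>p. \<phi> (r *\<^sub>R p)) = (\<lambda>p. a * \<phi>' (r *\<^sub>R p))"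
    using assms by (intro exI[of _ 1] exI[of _ \<phi>]) simp
  fix \<omega> :: planefun assume "\<exists>a \<phi>. smooth \<phi> \<and> \<omega> = (\<lambda>p. a * \<phi> (r *\<^sub>R p))"
  then obtain a \<phi> where \<phi>: "smooth \<phi>" and \<omega>: "\<omega> = (\<lambda>p. a * \<phi> (r *\<^sub>R p))" by blast
  show "continuous_on UNIV \<omega>"
    unfolding \<omega> by (intro continuous_intros continuous_on_compose2[OF smooth_imp_continuous[OF \<phi>]]) auto
  show "\<exists>\<psi>. has_dt \<omega> \<psi> \<and> (\<exists>a \<phi>. smooth \<phi> \<and> \<psi> = (\<lambda>p. a * \<phi> (r *\<^sub>R p)))"
  proof (intro exI conjI)
    show "has_dt \<omega> (\<lambda>p. a * (of_real r * d_t \<phi> (r *\<^sub>R p)))"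
      unfolding \<omega> by (intro has_dt_cmult has_dt_dilation smooth_has_dt \<phi>)
    show "smooth (d_t \<phi>)" by (rule smooth_d_t[OF \<phi>])
    show "(\<lambda>p. a * (of_real r * d_t \<phi> (r *\<^sub>R p))) = (\<lambda>p. (a * of_real r) * d_t \<phi> (r *\<^sub>R p))" by (simp add: mult.assoc)
  qed
  show "\<exists>\<psi>. has_dx \<omega> \<psi> \<and> (\<exists>a \<phi>. smooth \<phi> \<and> \<psi> = (\<lambda>p. a * \<phi> (r *\<^sub>R p)))"
  proof (intro exI conjI)
    show "has_dx \<omega> (\<lambda>p. a * (of_real r * d_x \<phi> (r *\<^sub>R p)))"
      unfolding \<omega> by (intro has_dx_cmult has_dx_dilation smooth_has_dx \<phi>)
    show "smooth (d_x \<phi>)" by (rule smooth_d_x[OF \<phi>])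
    show "(\<lambda>p. a * (of_real r * d_x \<phi> (r *\<^sub>R p))) = (\<lambda>p. (a * of_real r) * d_x \<phi> (r *\<^sub>R p))" by (simp add: mult.assoc)
  qed
qed

lemma derivs_le_dilation:
  assumes "smooth \<phi>" "derivs_le m \<phi> h" "\<bar>r\<bar> \<le> 1"
  shows "derivs_le m (\<lambda>p. a * \<phi> (r *\<^sub>R p)) (\<lambda>p. norm a * h (r *\<^sub>R p))"
  using assms(1,2)
proof (induction m arbitrary: \<phi> a)
  case 0
  then show ?case by (auto simp: norm_mult intro: mult_left_mono)
next
  case (Suc m)
  have h: "0 \<le> h p" for p using derivs_le_0[OF Suc.prems(2), of p] norm_ge_zero order_trans by blast
  have *: "derivs_le m (\<lambda>p. a * (of_real r * \<psi> (r *\<^sub>R p))) (\<lambda>p. norm a * h (r *\<^sub>R p))" if "smooth \<psi>" "derivs_le m \<psi> h" for \<psi>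
  proof (rule derivs_le_weaken)
    show "derivs_le m (\<lambda>p. a * (of_real r * \<psi> (r *\<^sub>R p))) (\<lambda>p. norm (a * of_real r) * h (r *\<^sub>R p))"
      using Suc.IH[OF that, of "a * of_real r"] by (simp add: mult.assoc)
    show "norm (a * of_real r) * h (r *\<^sub>R p) \<le> norm a * h (r *\<^sub>R p)" for p
      using assms(3) h by (intro mult_right_mono) (auto simp: norm_mult intro: mult_right_le_one_le)
  qed
  show ?case
    unfolding derivs_le.simps has_dt_imp_d_t[OF has_dt_cmult[OF has_dt_dilation[OF smooth_has_dt[OF Suc.prems(1)]]]]
      has_dx_imp_d_x[OF has_dx_cmult[OF has_dx_dilation[OF smooth_has_dx[OF Suc.prems(1)]]]]
    using Suc.prems by (auto simp: norm_mult intro!: mult_left_mono * smooth_d_t smooth_d_x)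
qed

lemma schwartz_reflect:
  assumes \<phi>: "\<phi> \<in> schwartz_functions"
  shows "(\<lambda>p. \<phi> (- p)) \<in> schwartz_functions"
proof (rule schwartz_functionsI)
  show "smooth (\<lambda>p. \<phi> (- p))" using smooth_dilation[OF schwartz_smooth[OF \<phi>], of "-1"] by simp
  fix N m
  obtain B where "derivs_le m \<phi> (\<lambda>p. B / (1 + norm p) ^ N)" using schwartz_derivs_le_ex[OF \<phi>] by blast
  from derivs_le_dilation[OF schwartz_smooth[OF \<phi>] this, of "-1" 1]
  show "\<exists>B. derivs_le m (\<lambda>p. \<phi> (- p)) (\<lambda>p. B / (1 + norm p) ^ N)" by auto
qed

text \<open>The mean value inequality is applied along the two coordinate legs of a path from
  \<open>p\<close> to the origin, which accounts for the factor 2.\<close>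

lemma smooth_increment_le:
  assumes s: "smooth \<phi>" and d: "derivs_le 1 \<phi> (\<lambda>p. B)"
  shows "norm (\<phi> p - \<phi> 0) \<le> 2 * B * norm p"
proof -
  obtain t x where p: "p = (t, x)" by force
  have dB: "norm (d_t \<phi> q) \<le> B" "norm (d_x \<phi> q) \<le> B" for q using d by auto
  have bd: "norm (f u - f 0) \<le> B * norm (u - 0)"
    if "\<And>s. (f has_vector_derivative f' s) (at s)" "\<And>s. norm (f' s) \<le> B" for f f' :: "real \<Rightarrow> complex" and u
  proof (rule differentiable_bound[of UNIV])
    show "(f has_derivative (\<lambda>h. h *\<^sub>R f' s)) (at s within UNIV)" for s
      using that(1) by (simp add: has_vector_derivative_def)
    show "onorm (\<lambda>h. h *\<^sub>R f' s) \<le> B" for s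
    proof (rule onorm_le)
      fix h :: real
      have "norm h * norm (f' s) \<le> norm h * B" by (intro mult_left_mono that(2)) simp
      then show "norm (h *\<^sub>R f' s) \<le> B * norm h" by (simp add: mult.commute)
    qed
  qed auto
  have "norm (\<phi> (t, x) - \<phi> (0, x)) \<le> B * norm (t - 0)"
    using smooth_has_dt[OF s] by (intro bd[of "\<lambda>t. \<phi> (t, x)" "\<lambda>t. d_t \<phi> (t, x)"] dB) (auto simp: has_dt_def)
  moreover have "norm (\<phi> (0, x) - \<phi> (0, 0)) \<le> B * norm (x - 0)"
    using smooth_has_dx[OF s] by (intro bd[of "\<lambda>x. \<phi> (0, x)" "\<lambda>x. d_x \<phi> (0, x)"] dB) (auto simp: has_dx_def)
  moreover have "norm (\<phi> (t, x) - \<phi> (0, 0)) \<le> norm (\<phi> (t, x) - \<phi> (0, x)) + norm (\<phi> (0, x) - \<phi> (0, 0))"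
    using norm_triangle_ineq[of "\<phi> (t, x) - \<phi> (0, x)" "\<phi> (0, x) - \<phi> (0, 0)"] by simp
  moreover have "B * \<bar>t\<bar> \<le> B * norm p" "B * \<bar>x\<bar> \<le> B * norm p"
    using abs_fst_le[of p] abs_snd_le[of p] order_trans[OF norm_ge_zero dB(1)[of 0]]
    by (auto simp: p intro!: mult_left_mono)
  ultimately show ?thesis by (simp add: p zero_prod_def)
qed

lemma cutoff_exists:
  obtains \<kappa> where "\<kappa> \<in> test_functions" "\<kappa> 0 = 1" "\<And>p. norm p \<ge> 2 \<Longrightarrow> \<kappa> p = 0"
proof -
  define K where "K = box_bump 1 (-1, -1) (1, 1) 0"
  define \<kappa> :: planefun where "\<kappa> p = of_real (1 / K) * of_real (box_bump 1 (-1, -1) (1, 1) p)" for p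
  have K: "K > 0" by (simp add: K_def box_bump_def flat_def)
  have z: "\<kappa> p = 0" if "norm p \<ge> 2" for p
  proof -
    have "norm p \<le> \<bar>fst p\<bar> + \<bar>snd p\<bar>" using norm_Pair_le[of "fst p" "snd p"] by simp
    then have "p \<notin> box (-1, -1) (1, 1)" using that by (auto simp: mem_box_plane)
    then show ?thesis by (simp add: \<kappa>_def box_bump_zero)
  qed
  have "smooth \<kappa>" unfolding \<kappa>_def[abs_def] by (intro smooth_mult smooth_const smooth_box_bump) simp
  then have "\<kappa> \<in> test_functions"
    by (rule test_functionsI[where S = "cball 0 2"]) (use z in auto)
  moreover have "\<kappa> 0 = 1" using K by (simp add: \<kappa>_def K_def)
  ultimately show ?thesis using that z by blast
qed

text \<open>Everything gains a factor r: the derivatives by the chain rule, and the function itself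
  by the mean value inequality, because \<open>\<kappa> 0 = 1\<close>. The price is one power of
  \<open>1 + norm p\<close>.\<close>

lemma one_minus_cutoff_derivs_le:
  assumes s: "smooth \<kappa>" and B: "derivs_le (Suc m) \<kappa> (\<lambda>p. B)" and c: "\<kappa> 0 = 1" and r: "0 \<le> r" "r \<le> 1"
  shows "derivs_le m (\<lambda>p. 1 - \<kappa> (r *\<^sub>R p)) (\<lambda>p. r * (2 * B) * (1 + norm p))"
proof -
  have B0: "0 \<le> B" using derivs_le_0[OF B, of 0] norm_ge_zero order_trans by blast
  have 0: "norm (1 - \<kappa> (r *\<^sub>R p)) \<le> r * (2 * B) * (1 + norm p)" for p
  proof -
    have "norm (\<kappa> (r *\<^sub>R p) - \<kappa> 0) \<le> 2 * B * norm (r *\<^sub>R p)"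
      by (rule smooth_increment_le[OF s derivs_le_mono[OF B]]) simp
    also have "\<dots> \<le> r * (2 * B) * (1 + norm p)" using r B0 by (simp add: algebra_simps)
    finally show ?thesis using c by (simp add: norm_minus_commute)
  qed
  show ?thesis
  proof (cases m)
    case 0
    then show ?thesis using \<open>\<And>p. norm (1 - \<kappa> (r *\<^sub>R p)) \<le> _ p\<close> by simp
  next
    case (Suc m')
    have eq: "(\<lambda>p. 1 - \<kappa> (r *\<^sub>R p)) = (\<lambda>p. 1 + (-1) * \<kappa> (r *\<^sub>R p))" by simp
    have dt: "d_t (\<lambda>p. 1 - \<kappa> (r *\<^sub>R p)) = (\<lambda>p. of_real (- r) * d_t \<kappa> (r *\<^sub>R p))"
      using has_dt_imp_d_t[OF has_dt_add[OF has_dt_const has_dt_cmult[OF has_dt_dilation[OF smooth_has_dt[OF s]]]], of 1 "-1" r]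
      unfolding eq by simp
    have dx: "d_x (\<lambda>p. 1 - \<kappa> (r *\<^sub>R p)) = (\<lambda>p. of_real (- r) * d_x \<kappa> (r *\<^sub>R p))"
      using has_dx_imp_d_x[OF has_dx_add[OF has_dx_const has_dx_cmult[OF has_dx_dilation[OF smooth_has_dx[OF s]]]], of 1 "-1" r]
      unfolding eq by simp
    have w: "derivs_le m' (\<lambda>p. of_real (- r) * \<psi> (r *\<^sub>R p)) (\<lambda>p. r * (2 * B) * (1 + norm p))"
      if "smooth \<psi>" "derivs_le m' \<psi> (\<lambda>p. B)" for \<psi>
    proof (rule derivs_le_weaken[OF derivs_le_dilation[OF that, of r "of_real (- r)"]])
      fix p :: "real \<times> real"
      have "r * B * 1 \<le> r * (2 * B) * (1 + norm p)" using r B0 by (intro mult_mono mult_left_mono) auto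
      then show "norm (complex_of_real (- r)) * B \<le> r * (2 * B) * (1 + norm p)" using r by simp
    qed (use r in auto)
    have "derivs_le m' (d_t \<kappa>) (\<lambda>p. B)" "derivs_le m' (d_x \<kappa>) (\<lambda>p. B)"
      using derivs_le_SucD[OF B] Suc by simp_all
    then show ?thesis using 0 w s by (simp add: Suc dt dx smooth_d_t smooth_d_x)
  qed
qed

text \<open>Multiplying \<phi> by a cutoff dilated by r = 1 / (n + 1) leaves an error of order r in
  every seminorm; the growth \<open>1 + norm p\<close> of the cutoff error is paid for with one
  extra power of decay of \<phi>. Density is what lets a tempered distribution be recovered from its
  restriction to test functions.\<close>

lemma test_functions_dense:
  assumes \<phi>: "\<phi> \<in> schwartz_functions"
  shows "\<exists>\<psi>. (\<forall>n. \<psi> n \<in> test_functions) \<and> (\<forall>N. (\<lambda>n. schwartz_seminorm N (\<lambda>p. \<phi> p - \<psi> n p)) \<longlonglongrightarrow> 0)"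
proof -
  obtain \<kappa> where \<kappa>: "\<kappa> \<in> test_functions" "\<kappa> 0 = 1" "\<And>p. norm p \<ge> 2 \<Longrightarrow> \<kappa> p = 0" using cutoff_exists by blast
  define r where "r n = 1 / real (Suc n)" for n
  have r: "0 < r n" "r n \<le> 1" for n by (auto simp: r_def)
  define \<psi> where "\<psi> n p = \<kappa> (r n *\<^sub>R p) * \<phi> p" for n p
  have s\<kappa>: "smooth \<kappa>" by (rule test_smooth[OF \<kappa>(1)])
  have test: "\<psi> n \<in> test_functions" for n
  proof (rule test_functionsI[where S = "cball 0 (2 / r n)"])
    show "smooth (\<psi> n)" unfolding \<psi>_def[abs_def] by (intro smooth_mult smooth_dilation s\<kappa> schwartz_smooth \<phi>)
    fix p :: "real \<times> real" assume "p \<notin> cball 0 (2 / r n)"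
    then have "norm (r n *\<^sub>R p) \<ge> 2" using r[of n] by (simp add: field_simps)
    then show "\<psi> n p = 0" using \<kappa>(3) by (simp add: \<psi>_def)
  qed auto
  have "(\<lambda>n. schwartz_seminorm N (\<lambda>p. \<phi> p - \<psi> n p)) \<longlonglongrightarrow> 0" for N
  proof -
    define B where "B = test_seminorm (Suc (2 * N)) \<kappa>"
    have "derivs_le (Suc (2 * N)) \<kappa> (\<lambda>p. B)"
      by (rule derivs_le_weaken[OF test_derivs_le[OF \<kappa>(1)]])
         (auto simp: B_def indicator_def test_seminorm_nonneg[OF \<kappa>(1)])
    note cut = one_minus_cutoff_derivs_le[OF s\<kappa> this \<kappa>(2)]
    obtain A where A: "derivs_le (2 * N) \<phi> (\<lambda>p. A / (1 + norm p) ^ (Suc N))" using schwartz_derivs_le_ex[OF \<phi>] by blast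
    define C where "C = (real N + 1)\<^sup>2 * (2 ^ (2 * N) * (2 * B * A))"
    have up: "schwartz_seminorm N (\<lambda>p. \<phi> p - \<psi> n p) \<le> r n * C" for n
    proof -
      have sm: "smooth (\<lambda>p. 1 - \<kappa> (r n *\<^sub>R p))"
        using smooth_add[OF smooth_const smooth_mult[OF smooth_const smooth_dilation[OF s\<kappa>]], of 1 "-1" "r n"] by simp
      have eq: "(\<lambda>p. \<phi> p - \<psi> n p) = (\<lambda>p. (1 - \<kappa> (r n *\<^sub>R p)) * \<phi> p)" by (simp add: \<psi>_def algebra_simps)
      have "derivs_le (2 * N) (\<lambda>p. (1 - \<kappa> (r n *\<^sub>R p)) * \<phi> p)
        (\<lambda>p. 2 ^ (2 * N) * (r n * (2 * B) * (1 + norm p) * (A / (1 + norm p) ^ (Suc N))))"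
        using r[of n] by (intro derivs_le_mult sm schwartz_smooth \<phi> cut A) auto
      also have "(\<lambda>p::real\<times>real. 2 ^ (2 * N) * (r n * (2 * B) * (1 + norm p) * (A / (1 + norm p) ^ (Suc N)))) =
         (\<lambda>p. (r n * (2 ^ (2 * N) * (2 * B * A))) / (1 + norm p) ^ N)"
      proof
        fix p :: "real \<times> real"
        have "1 + norm p \<noteq> 0" using norm_ge_zero[of p] by linarith
        then show "2 ^ (2 * N) * (r n * (2 * B) * (1 + norm p) * (A / (1 + norm p) ^ (Suc N))) = (r n * (2 ^ (2 * N) * (2 * B * A))) / (1 + norm p) ^ N"
          by simp
      qed
      finally have "schwartz_seminorm N (\<lambda>p. \<phi> p - \<psi> n p) \<le> (real N + 1)\<^sup>2 * (r n * (2 ^ (2 * N) * (2 * B * A)))"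
        unfolding eq by (intro schwartz_seminorm_le smooth_mult sm schwartz_smooth \<phi>)
      then show ?thesis by (simp add: C_def algebra_simps)
    qed
    have low: "0 \<le> schwartz_seminorm N (\<lambda>p. \<phi> p - \<psi> n p)" for n
      using schwartz_add[OF \<phi> schwartz_cmult[OF test_imp_schwartz[OF test[of n]], of "-1"]]
      by (intro schwartz_seminorm_nonneg) simp
    have "(\<lambda>n. r n * C) \<longlonglongrightarrow> 0 * C" unfolding r_def by (intro tendsto_mult tendsto_const LIMSEQ_Suc[OF lim_1_over_n])
    then have lim: "(\<lambda>n. r n * C) \<longlonglongrightarrow> 0" by simp
    show ?thesis
      by (rule tendsto_sandwich[OF _ _ tendsto_const lim]) (intro always_eventually allI low up)+
  qed
  with test show ?thesis by blast
qed

section \<open>The Fourier transform of Schwartz functions\<close>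

lemma integrable_inverse_square: "integrable lborel (\<lambda>x::real. inverse (1 + x\<^sup>2))"
  using integrable_inverse_1_plus_square by (simp add: set_integrable_def einterval_def)

text \<open>A tensor product, so that integrability over the plane follows by Fubini from that of 1
  / (1 + x^2) on the line.\<close>

definition plane_weight :: "real \<times> real \<Rightarrow> real" where
  "plane_weight p = inverse (1 + (fst p)\<^sup>2) * inverse (1 + (snd p)\<^sup>2)"

lemma plane_weight_pos: "plane_weight p > 0"
  by (simp add: plane_weight_def add_pos_nonneg)

lemma plane_weight_measurable[measurable]: "plane_weight \<in> borel_measurable borel"
  unfolding plane_weight_def by (auto intro!: borel_measurable_continuous_onI continuous_intros simp: add_nonneg_eq_0_iff)

lemma integrable_plane_weight: "integrable lborel plane_weight"
proof -
  have "integrable (lborel \<Otimes>\<^sub>M lborel) plane_weight"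
  proof (rule lborel_pair.Fubini_integrable)
    show "plane_weight \<in> borel_measurable (lborel \<Otimes>\<^sub>M lborel)"
      by (simp add: lborel_prod)
    show "integrable lborel (\<lambda>t. \<integral>x. norm (plane_weight (t, x)) \<partial>lborel)"
      using integrable_inverse_square by (simp add: abs_mult plane_weight_def)
    show "AE t in lborel. integrable lborel (\<lambda>x. plane_weight (t, x))"
      using integrable_inverse_square by (simp add: plane_weight_def)
  qed
  then show ?thesis by (simp add: lborel_prod)
qed

definition plane_const :: real where "plane_const = (\<integral>p. plane_weight p \<partial>lborel)"

text \<open>Each factor 1 + x^2 is at most \<open>(1 + norm p)\<^sup>2\<close>, so four powers of
  decay are enough for integrability. This is the origin of the exponent 4 used throughout.\<close>

lemma decay_le_plane_weight: "1 / (1 + norm p) ^ 4 \<le> plane_weight p"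
proof -
  have "(1 + norm p)\<^sup>2 = 1 + 2 * norm p + (norm p)\<^sup>2" by (simp add: power2_sum)
  moreover have "(fst p)\<^sup>2 \<le> (norm p)\<^sup>2" "(snd p)\<^sup>2 \<le> (norm p)\<^sup>2"
    using power_mono[OF abs_fst_le[of p], of 2] power_mono[OF abs_snd_le[of p], of 2] by simp_all
  ultimately have "1 + (fst p)\<^sup>2 \<le> (1 + norm p)\<^sup>2" "1 + (snd p)\<^sup>2 \<le> (1 + norm p)\<^sup>2"
    using norm_ge_zero[of p] by linarith+
  then have "(1 + (fst p)\<^sup>2) * (1 + (snd p)\<^sup>2) \<le> (1 + norm p)\<^sup>2 * (1 + norm p)\<^sup>2" by (intro mult_mono) auto
  then have "(1 + (fst p)\<^sup>2) * (1 + (snd p)\<^sup>2) \<le> (1 + norm p) ^ 4" by (simp add: power2_eq_square power4_eq_xxxx)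
  moreover have "(1 + (fst p)\<^sup>2) * (1 + (snd p)\<^sup>2) > 0" by (simp add: add_pos_nonneg)
  ultimately have "1 / (1 + norm p) ^ 4 \<le> 1 / ((1 + (fst p)\<^sup>2) * (1 + (snd p)\<^sup>2))"
    by (intro divide_left_mono mult_pos_pos zero_less_power) (simp_all add: add_pos_nonneg)
  then show ?thesis by (simp add: plane_weight_def divide_inverse)
qed

lemma decay_integrable:
  fixes f :: "real \<times> real \<Rightarrow> complex"
  assumes [measurable]: "f \<in> borel_measurable borel" and B: "\<And>p. norm (f p) \<le> B / (1 + norm p) ^ 4"
  shows "integrable lborel f" "norm (\<integral>p. f p \<partial>lborel) \<le> B * plane_const"
proof -
  have B0: "0 \<le> B" using order_trans[OF norm_ge_zero B[of 0]] by simp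
  have le: "norm (f p) \<le> B * plane_weight p" for p
    using mult_left_mono[OF decay_le_plane_weight[of p] B0] B[of p] by simp
  show i: "integrable lborel f"
    by (rule Bochner_Integration.integrable_bound[OF integrable_mult_right[OF integrable_plane_weight, of B]])
       (use le B0 in \<open>simp_all add: abs_mult abs_of_pos[OF plane_weight_pos]\<close>)
  have "norm (\<integral>p. f p \<partial>lborel) \<le> (\<integral>p. norm (f p) \<partial>lborel)" by (rule integral_norm_bound)
  also have "\<dots> \<le> (\<integral>p. B * plane_weight p \<partial>lborel)"
    using i by (intro integral_mono integrable_norm integrable_mult_right integrable_plane_weight le)
  finally show "norm (\<integral>p. f p \<partial>lborel) \<le> B * plane_const" by (simp add: plane_const_def)
qed

lemma schwartz_measurable[measurable_dest]: "\<phi> \<in> schwartz_functions \<Longrightarrow> \<phi> \<in> borel_measurable borel"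
  by (intro smooth_measurable schwartz_smooth)

lemma schwartz_integrable: "\<phi> \<in> schwartz_functions \<Longrightarrow> integrable lborel \<phi>"
  using schwartz_derivs_le_ex[of \<phi> 0 4] decay_integrable(1)[OF schwartz_measurable] by auto

section \<open>The transform maps the Schwartz space to itself\<close>

lemma integrable_cis_mult:
  fixes \<phi> :: planefun
  assumes "integrable lborel \<phi>"
  shows "integrable lborel (\<lambda>p. cis (a * (\<xi> \<bullet> p)) * \<phi> p)"
proof (rule Bochner_Integration.integrable_bound[OF assms])
  have "(\<lambda>p. cis (a * (\<xi> \<bullet> p))) \<in> borel_measurable borel"
    by (intro borel_measurable_continuous_onI continuous_intros)
  then show "(\<lambda>p. cis (a * (\<xi> \<bullet> p)) * \<phi> p) \<in> borel_measurable lborel" using assms by simp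
qed (auto simp: norm_mult)

lemma integrable_fourier_kernel:
  fixes \<phi> :: planefun
  shows "integrable lborel \<phi> \<Longrightarrow> integrable lborel (\<lambda>p. cis (- (\<xi> \<bullet> p)) * \<phi> p)"
  using integrable_cis_mult[of \<phi> "-1" \<xi>] by simp

lemma cis_approx: "norm (cis \<theta> - 1 - \<i> * of_real \<theta>) \<le> \<theta>\<^sup>2 / 2"
  using iexp_approx1[of \<theta> 1] by (simp add: cis_conv_exp diff_diff_eq power2_eq_square)

lemma has_vector_derivative_quadratic:
  fixes f :: "real \<Rightarrow> 'a::real_normed_vector"
  assumes "\<And>h. norm (f (s + h) - f s - h *\<^sub>R f') \<le> C * h\<^sup>2"
  shows "(f has_vector_derivative f') (at s)"
  unfolding has_vector_derivative_def
proof (rule has_derivativeI_sandwich[where e = 1 and H = "\<lambda>y. C * \<bar>y - s\<bar>"])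
  fix y assume y: "y \<in> (UNIV :: real set)" "y \<noteq> s"
  have "norm (f y - f s - (y - s) *\<^sub>R f') \<le> C * (y - s)\<^sup>2" using assms[of "y - s"] by simp
  then have "norm (f y - f s - (y - s) *\<^sub>R f') / norm (y - s) \<le> C * (y - s)\<^sup>2 / norm (y - s)"
    by (intro divide_right_mono) auto
  also have "(y - s)\<^sup>2 = \<bar>y - s\<bar> * \<bar>y - s\<bar>" by (simp add: power2_eq_square)
  also have "C * (\<bar>y - s\<bar> * \<bar>y - s\<bar>) / norm (y - s) = C * \<bar>y - s\<bar>" using y by (simp del: abs_mult_self_eq)
  finally show "norm (f y - f s - (y - s) *\<^sub>R f') / norm (y - s) \<le> C * \<bar>y - s\<bar>" .
next
  have "((\<lambda>y. C * \<bar>y - s\<bar>) \<longlongrightarrow> C * \<bar>s - s\<bar>) (at s)" by (intro tendsto_intros)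
  then show "((\<lambda>y. C * \<bar>y - s\<bar>) \<longlongrightarrow> 0) (at s)" by simp
qed (auto intro: bounded_linear_scaleR_left)

text \<open>The second order remainder of \<open>cis\<close> is at most half the square of its
  argument, so the error of the difference quotient is controlled by the second moment of \<phi>,
  and no limit has to be taken under the integral. The pair \<open>L\<close>, \<open>e\<close>
  covers both coordinate directions.\<close>

lemma fourier_increment:
  assumes \<phi>: "\<phi> \<in> schwartz_functions" and L: "L \<in> {fst, snd}" and e: "\<And>p. e \<bullet> p = L p"
  shows "norm (fourier \<phi> (\<xi> + h *\<^sub>R e) - fourier \<phi> \<xi> - h *\<^sub>R fourier (\<lambda>p. - \<i> * (of_real (L p) * \<phi> p)) \<xi>)
     \<le> ((\<integral>p. norm (of_real (L p) * (of_real (L p) * \<phi> p)) \<partial>lborel) / 2) * h\<^sup>2"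
proof -
  have S1: "(\<lambda>p. of_real (L p) * \<psi> p) \<in> schwartz_functions" if "\<psi> \<in> schwartz_functions" for \<psi>
    using L schwartz_mult_fst[OF that] schwartz_mult_snd[OF that] by auto
  note i = schwartz_integrable[OF \<phi>] schwartz_integrable[OF schwartz_cmult[OF S1[OF \<phi>], of "- \<i>"]]
    schwartz_integrable[OF S1[OF S1[OF \<phi>]]]
  let ?k = "\<lambda>p. cis (- (\<xi> \<bullet> p)) * \<phi> p"
  let ?d = "\<lambda>p. cis (- (\<xi> \<bullet> p)) * ((cis (- h * L p) - 1 - \<i> * of_real (- h * L p)) * \<phi> p)"
  have d: "?d p = cis (- ((\<xi> + h *\<^sub>R e) \<bullet> p)) * \<phi> p - ?k p - h *\<^sub>R (cis (- (\<xi> \<bullet> p)) * (- \<i> * (of_real (L p) * \<phi> p)))" for p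
    by (simp add: inner_add_left e cis_mult[symmetric] scaleR_conv_of_real algebra_simps)
       (simp add: cis_mult)
  have "fourier \<phi> (\<xi> + h *\<^sub>R e) - fourier \<phi> \<xi> - h *\<^sub>R fourier (\<lambda>p. - \<i> * (of_real (L p) * \<phi> p)) \<xi> = (\<integral>p. ?d p \<partial>lborel)"
    unfolding d fourier_def
    by (simp only: integrable_fourier_kernel i Bochner_Integration.integral_diff Bochner_Integration.integrable_diff
          integrable_scaleR_right integral_scaleR_right)
  also have "norm \<dots> \<le> (\<integral>p. norm (?d p) \<partial>lborel)" by (rule integral_norm_bound)
  also have "\<dots> \<le> (\<integral>p. h\<^sup>2 / 2 * norm (of_real (L p) * (of_real (L p) * \<phi> p)) \<partial>lborel)"
  proof (rule integral_mono)
    show "integrable lborel (\<lambda>p. norm (?d p))" unfolding d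
      by (intro integrable_norm Bochner_Integration.integrable_diff integrable_fourier_kernel integrable_scaleR_right i)
    show "integrable lborel (\<lambda>p. h\<^sup>2 / 2 * norm (of_real (L p) * (of_real (L p) * \<phi> p)))"
      using i(3) by (intro integrable_mult_right integrable_norm)
    fix p
    have "norm (?d p) \<le> (- h * L p)\<^sup>2 / 2 * norm (\<phi> p)"
      unfolding norm_mult norm_cis mult_1 by (intro mult_right_mono cis_approx) simp
    then show "norm (?d p) \<le> h\<^sup>2 / 2 * norm (of_real (L p) * (of_real (L p) * \<phi> p))"
      by (simp add: norm_mult power2_eq_square algebra_simps)
  qed
  finally show ?thesis by (simp add: algebra_simps)
qed

lemma has_dt_fourier:
  assumes \<phi>: "\<phi> \<in> schwartz_functions"
  shows "has_dt (fourier \<phi>) (fourier (\<lambda>p. - \<i> * (of_real (fst p) * \<phi> p)))"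
  unfolding has_dt_def
proof (intro allI, rule has_vector_derivative_quadratic)
  fix t x h
  have e: "(1, 0) \<bullet> p = fst p" for p :: "real \<times> real" by (cases p) simp
  show "norm (fourier \<phi> (t + h, x) - fourier \<phi> (t, x) - h *\<^sub>R fourier (\<lambda>p. - \<i> * (of_real (fst p) * \<phi> p)) (t, x))
    \<le> ((\<integral>p. norm (of_real (fst p) * (of_real (fst p) * \<phi> p)) \<partial>lborel) / 2) * h\<^sup>2"
    using fourier_increment[OF \<phi> _ e, of "(t, x)" h] by simp
qed

lemma has_dx_fourier:
  assumes \<phi>: "\<phi> \<in> schwartz_functions"
  shows "has_dx (fourier \<phi>) (fourier (\<lambda>p. - \<i> * (of_real (snd p) * \<phi> p)))"
  unfolding has_dx_def
proof (intro allI, rule has_vector_derivative_quadratic)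
  fix t x h
  have e: "(0, 1) \<bullet> p = snd p" for p :: "real \<times> real" by (cases p) simp
  show "norm (fourier \<phi> (t, x + h) - fourier \<phi> (t, x) - h *\<^sub>R fourier (\<lambda>p. - \<i> * (of_real (snd p) * \<phi> p)) (t, x))
    \<le> ((\<integral>p. norm (of_real (snd p) * (of_real (snd p) * \<phi> p)) \<partial>lborel) / 2) * h\<^sup>2"
    using fourier_increment[OF \<phi> _ e, of "(t, x)" h] by simp
qed

lemma continuous_fourier:
  assumes i: "integrable lborel \<phi>"
  shows "continuous_on UNIV (fourier \<phi>)"
  unfolding continuous_on_sequentially
proof (intro allI ballI impI, elim conjE)
  fix X and \<xi> :: "real \<times> real" assume X: "X \<longlonglongrightarrow> \<xi>"
  show "(fourier \<phi> \<circ> X) \<longlonglongrightarrow> fourier \<phi> \<xi>"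
    unfolding o_def fourier_def
  proof (rule integral_dominated_convergence[where w = "\<lambda>p. norm (\<phi> p)"])
    show "AE p in lborel. (\<lambda>n. cis (- (X n \<bullet> p)) * \<phi> p) \<longlonglongrightarrow> cis (- (\<xi> \<bullet> p)) * \<phi> p"
      by (intro AE_I2 tendsto_intros X)
  qed (use i integrable_fourier_kernel[OF i] in \<open>auto simp: norm_mult\<close>)
qed

lemma smooth_fourier:
  assumes "\<phi> \<in> schwartz_functions"
  shows "smooth (fourier \<phi>)"
proof (rule smooth_coinduct[where P = "\<lambda>\<omega>. \<exists>\<phi>\<in>schwartz_functions. \<omega> = fourier \<phi>"])
  show "\<exists>\<phi>'\<in>schwartz_functions. fourier \<phi> = fourier \<phi>'" using assms by blast
  fix \<omega> assume "\<exists>\<phi>\<in>schwartz_functions. \<omega> = fourier \<phi>"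
  then obtain \<phi> where \<phi>: "\<phi> \<in> schwartz_functions" and \<omega>: "\<omega> = fourier \<phi>" by blast
  show "continuous_on UNIV \<omega>" unfolding \<omega> by (intro continuous_fourier schwartz_integrable \<phi>)
  show "\<exists>\<psi>. has_dt \<omega> \<psi> \<and> (\<exists>\<phi>\<in>schwartz_functions. \<psi> = fourier \<phi>)"
    unfolding \<omega> using has_dt_fourier[OF \<phi>] schwartz_cmult[OF schwartz_mult_fst[OF \<phi>]] by blast
  show "\<exists>\<psi>. has_dx \<omega> \<psi> \<and> (\<exists>\<phi>\<in>schwartz_functions. \<psi> = fourier \<phi>)"
    unfolding \<omega> using has_dx_fourier[OF \<phi>] schwartz_cmult[OF schwartz_mult_snd[OF \<phi>]] by blast
qed

lemma integral_real_derivative_zero: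
  fixes F :: "real \<Rightarrow> complex"
  assumes d: "\<And>t. (F has_vector_derivative F' t) (at t)" and c: "continuous_on UNIV F'" and i: "integrable lborel F'"
    and B: "\<And>t. norm (F t) \<le> B / (1 + \<bar>t\<bar>)"
  shows "(\<integral>t. F' t \<partial>lborel) = 0"
proof -
  have 1: "((\<lambda>t. B / (1 + \<bar>t\<bar>)) \<longlongrightarrow> 0) at_top" by real_asymp
  have 2: "((\<lambda>t. B / (1 + \<bar>t\<bar>)) \<longlongrightarrow> 0) at_bot" by real_asymp
  note lim = Lim_null_comparison[OF always_eventually[OF allI[OF B]] 1]
    Lim_null_comparison[OF always_eventually[OF allI[OF B]] 2]
  have "(LBINT t=-\<infinity>..\<infinity>. F' t) = 0 - 0"
  proof (rule interval_integral_FTC_integrable)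
    show "isCont F' x" for x using c by (simp add: continuous_on_eq_continuous_at)
    show "set_integrable lborel (einterval (- \<infinity>) \<infinity>) F'" using i by (simp add: set_integrable_def einterval_def)
    show "((F \<circ> real_of_ereal) \<longlongrightarrow> 0) (at_right (- \<infinity>))" "((F \<circ> real_of_ereal) \<longlongrightarrow> 0) (at_left \<infinity>)"
      using lim by (simp_all add: ereal_tendsto_simps)
  qed (auto intro: d)
  then show ?thesis by (simp add: interval_lebesgue_integral_def einterval_def set_lebesgue_integral_def)
qed

lemma cont_slices:
  assumes "continuous_on UNIV (\<Psi> :: planefun)"
  shows "continuous_on UNIV (\<lambda>t. \<Psi> (t, x))" "continuous_on UNIV (\<lambda>x. \<Psi> (t, x))"
  by (auto intro!: continuous_on_compose2[OF assms] continuous_intros)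

lemma decay_slices:
  assumes "B \<ge> 0"
  shows "B / (1 + norm (t, x)) ^ 4 \<le> B / (1 + \<bar>t\<bar>)" "B / (1 + norm (t, x)) ^ 4 \<le> B / (1 + \<bar>x\<bar>)"
proof -
  have p: "(1 + norm (t, x)) ^ 4 \<ge> 1 + norm (t, x)"
    using power_increasing[of 1 4 "1 + norm (t, x)"] by simp
  have "(1 + norm (t, x)) ^ 4 \<ge> 1 + \<bar>t\<bar>" "(1 + norm (t, x)) ^ 4 \<ge> 1 + \<bar>x\<bar>"
    using p abs_fst_le[of "(t, x)"] abs_snd_le[of "(t, x)"] by simp_all
  then show "B / (1 + norm (t, x)) ^ 4 \<le> B / (1 + \<bar>t\<bar>)" "B / (1 + norm (t, x)) ^ 4 \<le> B / (1 + \<bar>x\<bar>)"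
    using assms by (auto intro!: divide_left_mono mult_pos_pos simp: add_pos_nonneg)
qed

text \<open>By Fubini the slices of \<open>\<Psi>'\<close> are integrable on almost every line;
  there the fundamental theorem of calculus applies, and the decay of \<open>\<Psi>\<close> removes
  the boundary terms.\<close>

lemma integral_d_t_zero:
  assumes d: "has_dt \<Psi> \<Psi>'" and c: "continuous_on UNIV \<Psi>'" and i: "integrable lborel \<Psi>'"
    and B: "\<And>p. norm (\<Psi> p) \<le> B / (1 + norm p) ^ 4"
  shows "(\<integral>p. \<Psi>' p \<partial>lborel) = 0"
proof -
  have B0: "0 \<le> B" using order_trans[OF norm_ge_zero B[of 0]] by simp
  have i': "integrable (lborel \<Otimes>\<^sub>M lborel) (case_prod (\<lambda>t x. \<Psi>' (t, x)))" using i by (simp add: lborel_prod)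
  have "(\<integral>p. \<Psi>' p \<partial>lborel) = (\<integral>x. (\<integral>t. \<Psi>' (t, x) \<partial>lborel) \<partial>lborel)"
    using lborel_pair.integral_snd[OF i'] by (simp add: lborel_prod)
  also have "\<dots> = 0"
  proof (rule integral_eq_zero_AE)
    show "AE x in lborel. (\<integral>t. \<Psi>' (t, x) \<partial>lborel) = 0"
      using lborel_pair.AE_integrable_snd[OF i']
    proof eventually_elim
      case (elim x)
      show ?case
        by (rule integral_real_derivative_zero[where F = "\<lambda>t. \<Psi> (t, x)" and B = B, OF _ cont_slices(1)[OF c] elim])
           (use d in \<open>simp add: has_dt_def\<close>, rule order_trans[OF B decay_slices(1)[OF B0]])
    qed
  qed
  finally show ?thesis .
qed

lemma integral_d_x_zero:
  assumes d: "has_dx \<Psi> \<Psi>'" and c: "continuous_on UNIV \<Psi>'" and i: "integrable lborel \<Psi>'"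
    and B: "\<And>p. norm (\<Psi> p) \<le> B / (1 + norm p) ^ 4"
  shows "(\<integral>p. \<Psi>' p \<partial>lborel) = 0"
proof -
  have B0: "0 \<le> B" using order_trans[OF norm_ge_zero B[of 0]] by simp
  have i': "integrable (lborel \<Otimes>\<^sub>M lborel) (case_prod (\<lambda>t x. \<Psi>' (t, x)))" using i by (simp add: lborel_prod)
  have "(\<integral>p. \<Psi>' p \<partial>lborel) = (\<integral>t. (\<integral>x. \<Psi>' (t, x) \<partial>lborel) \<partial>lborel)"
    using lborel_pair.integral_fst[OF i'] by (simp add: lborel_prod)
  also have "\<dots> = 0"
  proof (rule integral_eq_zero_AE)
    show "AE t in lborel. (\<integral>x. \<Psi>' (t, x) \<partial>lborel) = 0"
      using lborel_pair.AE_integrable_fst[OF i']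
    proof eventually_elim
      case (elim t)
      show ?case
        by (rule integral_real_derivative_zero[where F = "\<lambda>x. \<Psi> (t, x)" and B = B, OF _ cont_slices(2)[OF c] elim])
           (use d in \<open>simp add: has_dx_def\<close>, rule order_trans[OF B decay_slices(2)[OF B0]])
    qed
  qed
  finally show ?thesis .
qed

lemma has_dt_cis: "has_dt (\<lambda>p. cis (- (\<xi> \<bullet> p))) (\<lambda>p. - \<i> * of_real (fst \<xi>) * cis (- (\<xi> \<bullet> p)))"
  and has_dx_cis: "has_dx (\<lambda>p. cis (- (\<xi> \<bullet> p))) (\<lambda>p. - \<i> * of_real (snd \<xi>) * cis (- (\<xi> \<bullet> p)))"
proof -
  obtain \<delta> \<eta> where \<xi>: "\<xi> = (\<delta>, \<eta>)" by force
  have cis_d: "((\<lambda>s. cis (a * s + b)) has_vector_derivative \<i> * of_real a * cis (a * s + b)) (at s)" for a b s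
  proof -
    have "((\<lambda>z. exp (\<i> * (of_real a * z + of_real b))) has_field_derivative \<i> * of_real a * exp (\<i> * (of_real a * of_real s + of_real b))) (at (of_real s))"
      by (auto intro!: derivative_eq_intros)
    from has_vector_derivative_real_field[OF this]
    show ?thesis by (simp add: cis_conv_exp)
  qed
  have eq: "- (\<xi> \<bullet> (t, x)) = - \<delta> * t + - \<eta> * x" and eq': "- (\<xi> \<bullet> (t, x)) = - \<eta> * x + - \<delta> * t" for t x by (simp_all add: \<xi>)
  show "has_dt (\<lambda>p. cis (- (\<xi> \<bullet> p))) (\<lambda>p. - \<i> * of_real (fst \<xi>) * cis (- (\<xi> \<bullet> p)))"
    unfolding has_dt_def eq using cis_d[of "- \<delta>" "- \<eta> * x" for x] by (simp add: \<xi>)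
  show "has_dx (\<lambda>p. cis (- (\<xi> \<bullet> p))) (\<lambda>p. - \<i> * of_real (snd \<xi>) * cis (- (\<xi> \<bullet> p)))"
    unfolding has_dx_def eq' using cis_d[of "- \<eta>" "- \<delta> * x" for x] by (simp add: \<xi>)
qed

text \<open>Integration by parts: the total derivative of the kernel times \<phi> integrates to
  zero, and its product rule expansion is the claim.\<close>

lemma fourier_derivative:
  assumes \<phi>: "\<phi> \<in> schwartz_functions"
  shows "fourier (d_t \<phi>) \<xi> = \<i> * of_real (fst \<xi>) * fourier \<phi> \<xi>"
    "fourier (d_x \<phi>) \<xi> = \<i> * of_real (snd \<xi>) * fourier \<phi> \<xi>"
proof -
  obtain B where "derivs_le 0 \<phi> (\<lambda>p. B / (1 + norm p) ^ 4)" using schwartz_derivs_le_ex[OF \<phi>] by blast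
  then have B: "norm (cis (- (\<xi> \<bullet> p)) * \<phi> p) \<le> B / (1 + norm p) ^ 4" for p by (simp add: norm_mult)
  note s = schwartz_smooth[OF \<phi>]
  note i = integrable_fourier_kernel[OF schwartz_integrable[OF \<phi>], of \<xi>]
    integrable_fourier_kernel[OF schwartz_integrable[OF schwartz_d_t[OF \<phi>]], of \<xi>]
    integrable_fourier_kernel[OF schwartz_integrable[OF schwartz_d_x[OF \<phi>]], of \<xi>]
  note c = smooth_imp_continuous[OF s] smooth_imp_continuous[OF smooth_d_t[OF s]] smooth_imp_continuous[OF smooth_d_x[OF s]]
  have "(\<integral>p. cis (- (\<xi> \<bullet> p)) * d_t \<phi> p + - \<i> * of_real (fst \<xi>) * cis (- (\<xi> \<bullet> p)) * \<phi> p \<partial>lborel) = 0"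
    by (rule integral_d_t_zero[OF has_dt_mult[OF has_dt_cis smooth_has_dt[OF s]] _ _ B])
       (intro continuous_intros c, use i in \<open>simp add: mult.assoc\<close>)
  then show "fourier (d_t \<phi>) \<xi> = \<i> * of_real (fst \<xi>) * fourier \<phi> \<xi>"
    using i by (simp add: fourier_def mult.assoc)
  have "(\<integral>p. cis (- (\<xi> \<bullet> p)) * d_x \<phi> p + - \<i> * of_real (snd \<xi>) * cis (- (\<xi> \<bullet> p)) * \<phi> p \<partial>lborel) = 0"
    by (rule integral_d_x_zero[OF has_dx_mult[OF has_dx_cis smooth_has_dx[OF s]] _ _ B])
       (intro continuous_intros c, use i in \<open>simp add: mult.assoc\<close>)
  then show "fourier (d_x \<phi>) \<xi> = \<i> * of_real (snd \<xi>) * fourier \<phi> \<xi>"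
    using i by (simp add: fourier_def mult.assoc)
qed

text \<open>One factor \<open>1 + norm \<xi>\<close> is at most 1 plus the moduli of the two
  coordinates, and multiplication by a coordinate is the transform of a derivative. Each power thus
  produces three transforms, of \<phi>, \<open>d_t \<phi>\<close> and \<open>d_x \<phi>\<close>, all
  with the same constant \<open>B\<close>; hence \<open>3 ^ N\<close>.\<close>

lemma fourier_decay:
  "\<phi> \<in> schwartz_functions \<Longrightarrow> derivs_le N \<phi> (\<lambda>p. B / (1 + norm p) ^ 4) \<Longrightarrow>
    (1 + norm \<xi>) ^ N * norm (fourier \<phi> \<xi>) \<le> 3 ^ N * (B * plane_const)"
proof (induction N arbitrary: \<phi>)
  case 0
  have "norm (\<integral>p. cis (- (\<xi> \<bullet> p)) * \<phi> p \<partial>lborel) \<le> B * plane_const"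
    using 0 integrable_fourier_kernel[OF schwartz_integrable[OF 0(1)], of \<xi>]
    by (intro decay_integrable) (auto simp: norm_mult)
  then show ?case by (simp add: fourier_def)
next
  case (Suc N)
  have IH: "(1 + norm \<xi>) ^ N * norm (fourier \<psi> \<xi>) \<le> 3 ^ N * (B * plane_const)"
    if "\<psi> \<in> {\<phi>, d_t \<phi>, d_x \<phi>}" for \<psi>
    using that Suc.prems derivs_le_SucD[OF Suc.prems(2)] by (intro Suc.IH) (auto intro: schwartz_d_t schwartz_d_x)
  have "norm \<xi> \<le> \<bar>fst \<xi>\<bar> + \<bar>snd \<xi>\<bar>" using norm_Pair_le[of "fst \<xi>" "snd \<xi>"] by simp
  then have "(1 + norm \<xi>) * norm (fourier \<phi> \<xi>) \<le> (1 + \<bar>fst \<xi>\<bar> + \<bar>snd \<xi>\<bar>) * norm (fourier \<phi> \<xi>)"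
    by (intro mult_right_mono) auto
  also have "\<dots> = norm (fourier \<phi> \<xi>) + norm (fourier (d_t \<phi>) \<xi>) + norm (fourier (d_x \<phi>) \<xi>)"
    by (simp add: fourier_derivative[OF Suc.prems(1)] norm_mult algebra_simps)
  finally have "(1 + norm \<xi>) ^ N * ((1 + norm \<xi>) * norm (fourier \<phi> \<xi>)) \<le>
     (1 + norm \<xi>) ^ N * (norm (fourier \<phi> \<xi>) + norm (fourier (d_t \<phi>) \<xi>) + norm (fourier (d_x \<phi>) \<xi>))"
    by (intro mult_left_mono) auto
  also have "\<dots> \<le> 3 * (3 ^ N * (B * plane_const))"
    using IH[of \<phi>] IH[of "d_t \<phi>"] IH[of "d_x \<phi>"] by (simp add: algebra_simps)
  finally show ?case by (simp add: algebra_simps)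
qed

text \<open>A derivative of the transform is the transform of a moment, which is again a Schwartz
  function, so the induction on \<open>m\<close> runs over all \<phi> at once; the base case is
  \<open>fourier_decay\<close>.\<close>

lemma schwartz_fourier:
  assumes "\<phi> \<in> schwartz_functions"
  shows "fourier \<phi> \<in> schwartz_functions"
proof (rule schwartz_functionsI)
  show "smooth (fourier \<phi>)" by (rule smooth_fourier[OF assms])
  show "\<exists>B. derivs_le m (fourier \<phi>) (\<lambda>p. B / (1 + norm p) ^ N)" for N m
    using assms
  proof (induction m arbitrary: \<phi>)
    case (0 \<phi>)
    obtain B where B: "derivs_le N \<phi> (\<lambda>p. B / (1 + norm p) ^ 4)" using schwartz_derivs_le_ex[OF 0] by blast
    have "norm (fourier \<phi> \<xi>) \<le> 3 ^ N * (B * plane_const) / (1 + norm \<xi>) ^ N" for \<xi>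
    proof -
      have "(1 + norm \<xi>) ^ N > 0" by (simp add: add_pos_nonneg)
      then show ?thesis using fourier_decay[OF 0 B, of \<xi>] by (simp add: pos_le_divide_eq mult.commute)
    qed
    then show ?case unfolding derivs_le.simps by (intro exI allI)
  next
    case (Suc m \<phi>)
    from Suc.IH[OF Suc.prems] obtain B0 where B0: "derivs_le m (fourier \<phi>) (\<lambda>p. B0 / (1 + norm p) ^ N)" ..
    from Suc.IH[OF schwartz_cmult[OF schwartz_mult_fst[OF Suc.prems]]] obtain B1 where
      B1: "derivs_le m (fourier (\<lambda>p. - \<i> * (of_real (fst p) * \<phi> p))) (\<lambda>p. B1 / (1 + norm p) ^ N)" ..
    from Suc.IH[OF schwartz_cmult[OF schwartz_mult_snd[OF Suc.prems]]] obtain B2 where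
      B2: "derivs_le m (fourier (\<lambda>p. - \<i> * (of_real (snd p) * \<phi> p))) (\<lambda>p. B2 / (1 + norm p) ^ N)" ..
    define M where "M = max B0 (max B1 B2)"
    have w: "derivs_le m \<psi> (\<lambda>p. M / (1 + norm p) ^ N)" if "derivs_le m \<psi> (\<lambda>p. b / (1 + norm p) ^ N)" "b \<le> M" for \<psi> b
      by (rule derivs_le_weaken[OF that(1)]) (auto intro!: divide_right_mono that(2))
    have "derivs_le m (fourier \<phi>) (\<lambda>p. M / (1 + norm p) ^ N)" by (rule w[OF B0]) (simp add: M_def)
    then have "norm (fourier \<phi> p) \<le> M / (1 + norm p) ^ N" for p by (rule derivs_le_0)
    moreover have "derivs_le m (d_t (fourier \<phi>)) (\<lambda>p. M / (1 + norm p) ^ N)"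
      unfolding has_dt_imp_d_t[OF has_dt_fourier[OF Suc.prems]] by (rule w[OF B1]) (simp add: M_def)
    moreover have "derivs_le m (d_x (fourier \<phi>)) (\<lambda>p. M / (1 + norm p) ^ N)"
      unfolding has_dx_imp_d_x[OF has_dx_fourier[OF Suc.prems]] by (rule w[OF B2]) (simp add: M_def)
    ultimately show ?case by (intro exI[of _ M]) simp
  qed
qed

text \<open>In the order N + 4, N derivatives pay for the decay in \<xi> and four powers of decay of
  \<phi> for integrability.\<close>

lemma fourier_le_seminorm:
  assumes \<phi>: "\<phi> \<in> schwartz_functions"
  shows "norm (fourier \<phi> \<xi>) \<le> 3 ^ N * (schwartz_seminorm (N + 4) \<phi> * plane_const) / (1 + norm \<xi>) ^ N"
proof -
  have "derivs_le N \<phi> (\<lambda>p. schwartz_seminorm (N + 4) \<phi> / (1 + norm p) ^ 4)"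
  proof (rule derivs_le_weaken[OF schwartz_derivs_le[OF \<phi>, of N "N + 4"]])
    show "schwartz_seminorm (N + 4) \<phi> / (1 + norm p) ^ (N + 4) \<le> schwartz_seminorm (N + 4) \<phi> / (1 + norm p) ^ 4" for p :: "real \<times> real"
      by (intro divide_left_mono power_increasing mult_pos_pos zero_less_power add_pos_nonneg schwartz_seminorm_nonneg[OF \<phi>]) auto
  qed simp
  from fourier_decay[OF \<phi> this, of \<xi>] show ?thesis
    by (simp add: pos_le_divide_eq mult.commute add_pos_nonneg)
qed

section \<open>Gaussians and Fourier inversion\<close>

lemma lborel_integral_affine_plane:
  fixes f :: "real \<times> real \<Rightarrow> complex"
  assumes [measurable]: "f \<in> borel_measurable borel" and c: "c \<noteq> 0"
  shows "(\<integral>q. f q \<partial>lborel) = of_real (c\<^sup>2) * (\<integral>q. f (p + c *\<^sub>R q) \<partial>lborel)"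
proof -
  have m[measurable]: "(\<lambda>q. p + c *\<^sub>R q) \<in> borel_measurable borel"
    by (intro borel_measurable_continuous_onI continuous_intros)
  have "(\<integral>q. f q \<partial>lborel) = (\<integral>q. f q \<partial>density (distr lborel borel (\<lambda>q. p + c *\<^sub>R q)) (\<lambda>_. ennreal (c\<^sup>2)))"
    by (subst lborel_affine[OF c, of p]) (simp add: power2_eq_square)
  also have "\<dots> = (\<integral>q. c\<^sup>2 *\<^sub>R f q \<partial>distr lborel borel (\<lambda>q. p + c *\<^sub>R q))"
    by (rule integral_density) auto
  also have "\<dots> = (\<integral>q. c\<^sup>2 *\<^sub>R f (p + c *\<^sub>R q) \<partial>lborel)"
    by (rule integral_distr) auto
  finally show ?thesis by (simp add: scaleR_conv_of_real)
qed

definition gauss :: planefun where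
  "gauss p = of_real (exp (- (fst p)\<^sup>2 / 2)) * of_real (exp (- (snd p)\<^sup>2 / 2))"

lemma integrable_gauss_real: "integrable lborel (\<lambda>x::real. complex_of_real (exp (- x\<^sup>2 / 2)))"
proof -
  have "integrable lborel (\<lambda>x. sqrt (2 * pi) * std_normal_density x)"
    using integrable_std_normal_moment[of 0] by simp
  also have "(\<lambda>x. sqrt (2 * pi) * std_normal_density x) = (\<lambda>x. exp (- x\<^sup>2 / 2))"
    by (simp add: std_normal_density_def)
  finally show ?thesis by (rule integrable_of_real)
qed

text \<open>Up to the normalisation sqrt (2 pi), the left-hand side is the characteristic function
  of the standard normal distribution at \<open>- u\<close>.\<close>

lemma fourier_gauss_real:
  "(\<integral>x. cis (- (u * x)) * complex_of_real (exp (- x\<^sup>2 / 2)) \<partial>lborel) = of_real (sqrt (2 * pi)) * of_real (exp (- u\<^sup>2 / 2))"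
proof -
  have "complex_of_real (exp (- (- u)\<^sup>2 / 2)) = char std_normal_distribution (- u)"
    by (simp add: char_std_normal_distribution)
  also have "\<dots> = (\<integral>x. iexp (- u * x) \<partial>std_normal_distribution)" by (simp add: char_def)
  also have "\<dots> = (\<integral>x. std_normal_density x *\<^sub>R iexp (- u * x) \<partial>lborel)"
    by (rule integral_density) (auto simp: normal_density_nonneg)
  also have "\<dots> = (\<integral>x. of_real (1 / sqrt (2 * pi)) * (cis (- (u * x)) * complex_of_real (exp (- x\<^sup>2 / 2))) \<partial>lborel)"
    by (intro Bochner_Integration.integral_cong) (auto simp: std_normal_density_def cis_conv_exp scaleR_conv_of_real mult_ac)
  also have "\<dots> = of_real (1 / sqrt (2 * pi)) * (\<integral>x. cis (- (u * x)) * complex_of_real (exp (- x\<^sup>2 / 2)) \<partial>lborel)"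
    by simp
  finally have *: "complex_of_real (exp (- u\<^sup>2 / 2)) = of_real (1 / sqrt (2 * pi)) * (\<integral>x. cis (- (u * x)) * complex_of_real (exp (- x\<^sup>2 / 2)) \<partial>lborel)"
    by simp
  have "complex_of_real (sqrt (2 * pi)) * of_real (1 / sqrt (2 * pi)) = 1"
    unfolding of_real_mult[symmetric] by simp
  then show ?thesis unfolding * mult.assoc[symmetric] by simp
qed

lemma integrable_gauss: "integrable lborel gauss"
proof -
  have "integrable (lborel \<Otimes>\<^sub>M lborel) gauss"
  proof (rule lborel_pair.Fubini_integrable)
    show "gauss \<in> borel_measurable (lborel \<Otimes>\<^sub>M lborel)"
      unfolding lborel_prod gauss_def by (auto intro!: borel_measurable_continuous_onI continuous_intros)
    show "integrable lborel (\<lambda>t. \<integral>x. norm (gauss (t, x)) \<partial>lborel)"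
      using integrable_gauss_real[THEN integrable_norm] by (simp add: norm_mult gauss_def)
    show "AE t in lborel. integrable lborel (\<lambda>x. gauss (t, x))"
      using integrable_gauss_real by (simp add: gauss_def)
  qed
  then show ?thesis by (simp add: lborel_prod)
qed

lemma fourier_gauss: "fourier gauss u = of_real (2 * pi) * gauss u"
proof -
  obtain a b where u: "u = (a, b)" by force
  have i: "integrable (lborel \<Otimes>\<^sub>M lborel) (case_prod (\<lambda>t x. cis (- (u \<bullet> (t, x))) * gauss (t, x)))"
    using integrable_fourier_kernel[OF integrable_gauss, of u] by (simp add: lborel_prod case_prod_beta')
  have "fourier gauss u = (\<integral>t. (\<integral>x. cis (- (u \<bullet> (t, x))) * gauss (t, x) \<partial>lborel) \<partial>lborel)"
    using lborel_pair.integral_fst[OF i] by (simp add: lborel_prod fourier_def case_prod_beta')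
  also have "\<dots> = (\<integral>t. (\<integral>x. (cis (- (a * t)) * of_real (exp (- t\<^sup>2 / 2))) * (cis (- (b * x)) * of_real (exp (- x\<^sup>2 / 2))) \<partial>lborel) \<partial>lborel)"
  proof (intro Bochner_Integration.integral_cong refl)
    fix t x
    have "cis (- (u \<bullet> (t, x))) = cis (- (a * t)) * cis (- (b * x))" by (simp add: u cis_mult)
    then show "cis (- (u \<bullet> (t, x))) * gauss (t, x) = (cis (- (a * t)) * of_real (exp (- t\<^sup>2 / 2))) * (cis (- (b * x)) * of_real (exp (- x\<^sup>2 / 2)))"
      by (simp add: gauss_def mult_ac)
  qed
  also have "\<dots> = (of_real (sqrt (2 * pi)) * of_real (exp (- a\<^sup>2 / 2))) * (of_real (sqrt (2 * pi)) * of_real (exp (- b\<^sup>2 / 2)))"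
    by (simp only: integral_mult_right_zero integral_mult_left_zero fourier_gauss_real)
  also have "\<dots> = (of_real (sqrt (2 * pi)) * of_real (sqrt (2 * pi))) * (of_real (exp (- a\<^sup>2 / 2)) * of_real (exp (- b\<^sup>2 / 2)))"
    by (simp only: mult_ac)
  also have "complex_of_real (sqrt (2 * pi)) * of_real (sqrt (2 * pi)) = of_real (2 * pi)"
    unfolding of_real_mult[symmetric] by simp
  finally show ?thesis unfolding u gauss_def[of "(a, b)"] by simp
qed

lemma integral_gauss: "(\<integral>p. gauss p \<partial>lborel) = of_real (2 * pi)"
  using fourier_gauss[of 0] by (simp add: fourier_def gauss_def[of 0])

lemma gauss_le_1: "norm (gauss p) \<le> 1"
  by (auto simp: gauss_def norm_mult intro!: mult_le_one)

lemma continuous_gauss: "continuous_on UNIV gauss"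
  unfolding gauss_def[abs_def] by (intro continuous_intros) auto

lemma gauss_measurable[measurable]: "gauss \<in> borel_measurable borel"
  by (intro borel_measurable_continuous_onI continuous_gauss)

lemma gauss_dilation_tendsto: "(\<lambda>n. gauss ((1 / real (Suc n)) *\<^sub>R p)) \<longlonglongrightarrow> 1"
proof -
  have l: "(\<lambda>n. (1 / real (Suc n)) *\<^sub>R p) \<longlonglongrightarrow> 0 *\<^sub>R p"
    by (intro tendsto_scaleR tendsto_const LIMSEQ_Suc[OF lim_1_over_n])
  have "isCont gauss 0" using continuous_gauss by (simp add: continuous_on_eq_continuous_at)
  from isCont_tendsto_compose[OF this] l show ?thesis by (simp add: gauss_def[of 0])
qed

lemma cis_inner_diff: "cis (\<xi> \<bullet> (p - q)) = cis (\<xi> \<bullet> p) * cis (- (\<xi> \<bullet> q))"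
  by (simp add: inner_diff_right cis_mult)

text \<open>Damp the inverse transform by a dilated Gaussian; Fubini turns it into an average of \<open>\<phi>\<close>
  around \<open>p\<close>.\<close>
lemma fourier_inversion_damped:
  assumes \<phi>: "\<phi> \<in> schwartz_functions" and r: "r > 0"
  shows "(\<integral>\<xi>. cis (\<xi> \<bullet> p) * fourier \<phi> \<xi> * gauss (r *\<^sub>R \<xi>) \<partial>lborel) = of_real (2 * pi) * (\<integral>w. \<phi> (p + r *\<^sub>R w) * gauss w \<partial>lborel)"
proof -
  note [measurable] = schwartz_measurable[OF \<phi>]
  have m1[measurable]: "(\<lambda>\<xi>. gauss (r *\<^sub>R \<xi>)) \<in> borel_measurable borel"
    by (intro borel_measurable_continuous_onI continuous_on_compose2[OF continuous_gauss] continuous_intros) auto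
  have ig: "integrable lborel (\<lambda>\<xi>. gauss (r *\<^sub>R \<xi>))"
  proof -
    have m: "(\<lambda>q. 0 + r *\<^sub>R q) \<in> borel_measurable (lborel :: (real \<times> real) measure)"
      by (intro borel_measurable_continuous_onI continuous_intros | simp)+
    have "integrable (density (distr lborel borel (\<lambda>q. 0 + r *\<^sub>R q)) (\<lambda>_. ennreal (\<bar>r\<bar> ^ DIM(real \<times> real)))) gauss"
      using integrable_gauss lborel_affine[of r "0 :: real \<times> real"] r by (simp add: power2_eq_square)
    then have "integrable (distr lborel borel (\<lambda>q. 0 + r *\<^sub>R q)) (\<lambda>q. (\<bar>r\<bar> ^ DIM(real \<times> real)) *\<^sub>R gauss q)"
      by (subst (asm) integrable_density) auto
    from integrable_scaleR_right[OF this, of "1 / r\<^sup>2"]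
    have "integrable (distr lborel borel (\<lambda>q. 0 + r *\<^sub>R q)) gauss" using r by (simp add: power2_eq_square)
    then show ?thesis using integrable_distr[OF m] by simp
  qed
  define k where "k \<xi> q = cis (\<xi> \<bullet> (p - q)) * (gauss (r *\<^sub>R \<xi>) * \<phi> q)" for \<xi> q
  have k_meas: "case_prod k \<in> borel_measurable (lborel \<Otimes>\<^sub>M lborel)"
  proof -
    have "(\<lambda>z. cis (fst z \<bullet> (p - snd z))) \<in> borel_measurable (borel :: ((real \<times> real) \<times> real \<times> real) measure)"
      by (intro borel_measurable_continuous_onI continuous_intros)
    moreover have "(\<lambda>z. gauss (r *\<^sub>R fst z) * \<phi> (snd z)) \<in> borel_measurable (borel \<Otimes>\<^sub>M borel)" by measurable
    ultimately have "(\<lambda>z. cis (fst z \<bullet> (p - snd z)) * (gauss (r *\<^sub>R fst z) * \<phi> (snd z))) \<in> borel_measurable (borel \<Otimes>\<^sub>M borel)"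
      by (simp add: borel_prod)
    then show ?thesis by (simp add: k_def case_prod_beta' cong: measurable_cong_sets)
  qed
  have k_int: "integrable (lborel \<Otimes>\<^sub>M lborel) (case_prod k)"
  proof (rule lborel_pair.Fubini_integrable[OF k_meas])
    show "integrable lborel (\<lambda>\<xi>. \<integral>q. norm (case (\<xi>, q) of (\<xi>, q) \<Rightarrow> k \<xi> q) \<partial>lborel)"
      using ig by (simp add: k_def norm_mult)
    have "integrable lborel (\<lambda>q. k \<xi> q)" for \<xi>
    proof -
      have "integrable lborel (\<lambda>q. cis (\<xi> \<bullet> p) * (cis (- (\<xi> \<bullet> q)) * \<phi> q) * gauss (r *\<^sub>R \<xi>))"
        using integrable_fourier_kernel[OF schwartz_integrable[OF \<phi>]] by simp
      moreover have "cis (\<xi> \<bullet> p) * (cis (- (\<xi> \<bullet> q)) * \<phi> q) * gauss (r *\<^sub>R \<xi>) = k \<xi> q" for q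
        by (simp add: k_def cis_inner_diff mult_ac)
      ultimately show ?thesis by simp
    qed
    then show "AE \<xi> in lborel. integrable lborel (\<lambda>q. case (\<xi>, q) of (\<xi>, q) \<Rightarrow> k \<xi> q)" by simp
  qed
  have inner1: "(\<integral>q. k \<xi> q \<partial>lborel) = cis (\<xi> \<bullet> p) * fourier \<phi> \<xi> * gauss (r *\<^sub>R \<xi>)" for \<xi>
  proof -
    have "k \<xi> q = cis (\<xi> \<bullet> p) * (cis (- (\<xi> \<bullet> q)) * \<phi> q) * gauss (r *\<^sub>R \<xi>)" for q
      by (simp add: k_def cis_inner_diff mult_ac)
    then show ?thesis unfolding fourier_def by simp
  qed
  \<comment> \<open>Rescaling \<xi> by r turns the inner integral into the transform of the Gaussian
    at (q - p) / r, which is a Gaussian again; the inverse square of r is the Jacobian.\<close>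
  have inner2: "(\<integral>\<xi>. k \<xi> q \<partial>lborel) = of_real (inverse (r\<^sup>2)) * (of_real (2 * pi) * gauss ((1 / r) *\<^sub>R (q - p)) * \<phi> q)" for q
  proof -
    have m: "(\<lambda>\<xi>. cis (- (((1 / r) *\<^sub>R (q - p)) \<bullet> \<xi>)) * gauss \<xi>) \<in> borel_measurable borel"
      by (intro borel_measurable_continuous_onI continuous_intros continuous_gauss)
    have eq: "cis (- (((1 / r) *\<^sub>R (q - p)) \<bullet> (0 + r *\<^sub>R \<xi>))) * gauss (0 + r *\<^sub>R \<xi>) * \<phi> q = k \<xi> q" for \<xi>
    proof -
      have "- (((1 / r) *\<^sub>R (q - p)) \<bullet> (0 + r *\<^sub>R \<xi>)) = \<xi> \<bullet> (p - q)"
        using r by (simp add: inner_diff_left inner_diff_right inner_commute)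
      then show ?thesis by (simp add: k_def)
    qed
    have "(\<integral>\<xi>. k \<xi> q \<partial>lborel) = (\<integral>\<xi>. cis (- (((1 / r) *\<^sub>R (q - p)) \<bullet> (0 + r *\<^sub>R \<xi>))) * gauss (0 + r *\<^sub>R \<xi>) \<partial>lborel) * \<phi> q"
      unfolding eq[symmetric] by (rule integral_mult_left_zero)
    moreover have "fourier gauss ((1 / r) *\<^sub>R (q - p)) = of_real (r\<^sup>2) * (\<integral>\<xi>. cis (- (((1 / r) *\<^sub>R (q - p)) \<bullet> (0 + r *\<^sub>R \<xi>))) * gauss (0 + r *\<^sub>R \<xi>) \<partial>lborel)"
      unfolding fourier_def by (rule lborel_integral_affine_plane[OF m]) (use r in simp)
    ultimately have "fourier gauss ((1 / r) *\<^sub>R (q - p)) * \<phi> q = of_real (r\<^sup>2) * (\<integral>\<xi>. k \<xi> q \<partial>lborel)"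
      by (simp only: mult.assoc)
    then show ?thesis using r by (simp add: fourier_gauss field_simps)
  qed
  have "(\<integral>\<xi>. cis (\<xi> \<bullet> p) * fourier \<phi> \<xi> * gauss (r *\<^sub>R \<xi>) \<partial>lborel) = (\<integral>q. (\<integral>\<xi>. k \<xi> q \<partial>lborel) \<partial>lborel)"
    unfolding inner1[symmetric] using lborel_pair.Fubini_integral[OF k_int] by simp
  also have "\<dots> = of_real (inverse (r\<^sup>2)) * (\<integral>q. of_real (2 * pi) * gauss ((1 / r) *\<^sub>R (q - p)) * \<phi> q \<partial>lborel)"
    unfolding inner2 by simp
  \<comment> \<open>The substitution q = p + r w cancels this Jacobian and centres the average at
    p.\<close>
  also have "(\<integral>q. of_real (2 * pi) * gauss ((1 / r) *\<^sub>R (q - p)) * \<phi> q \<partial>lborel) =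
     of_real (r\<^sup>2) * (\<integral>w. of_real (2 * pi) * gauss ((1 / r) *\<^sub>R (p + r *\<^sub>R w - p)) * \<phi> (p + r *\<^sub>R w) \<partial>lborel)"
  proof (rule lborel_integral_affine_plane)
    have "(\<lambda>q. gauss ((1 / r) *\<^sub>R (q - p))) \<in> borel_measurable borel"
      by (intro borel_measurable_continuous_onI continuous_on_compose2[OF continuous_gauss] continuous_intros) auto
    then show "(\<lambda>q. of_real (2 * pi) * gauss ((1 / r) *\<^sub>R (q - p)) * \<phi> q) \<in> borel_measurable borel" by simp
  qed (use r in auto)
  also have "of_real (inverse (r\<^sup>2)) * \<dots> = (\<integral>w. of_real (2 * pi) * (\<phi> (p + r *\<^sub>R w) * gauss w) \<partial>lborel)"
    using r by (simp add: mult_ac)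
  finally show ?thesis by simp
qed

text \<open>As r tends to 0 the damping disappears on the left, dominated by the integrable
  transform, and the average on the right concentrates at p, dominated by a multiple of the
  Gaussian. One factor 2 pi comes from the damped formula, the other is the mass of the
  Gaussian.\<close>

theorem fourier_inversion:
  assumes \<phi>: "\<phi> \<in> schwartz_functions"
  shows "(\<integral>\<xi>. cis (\<xi> \<bullet> p) * fourier \<phi> \<xi> \<partial>lborel) = of_real ((2 * pi)\<^sup>2) * \<phi> p"
proof -
  define r where "r n = 1 / real (Suc n)" for n
  have r: "r n > 0" for n by (simp add: r_def)
  note i = integrable_cis_mult[OF schwartz_integrable[OF schwartz_fourier[OF \<phi>]], of 1 p]
  have i: "integrable lborel (\<lambda>\<xi>. cis (\<xi> \<bullet> p) * fourier \<phi> \<xi>)"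
    using integrable_cis_mult[OF schwartz_integrable[OF schwartz_fourier[OF \<phi>]], of 1 p] by (simp add: inner_commute)
  have L1: "(\<lambda>n. \<integral>\<xi>. cis (\<xi> \<bullet> p) * fourier \<phi> \<xi> * gauss (r n *\<^sub>R \<xi>) \<partial>lborel) \<longlonglongrightarrow> (\<integral>\<xi>. cis (\<xi> \<bullet> p) * fourier \<phi> \<xi> \<partial>lborel)"
  proof (rule integral_dominated_convergence[where w = "\<lambda>\<xi>. norm (cis (\<xi> \<bullet> p) * fourier \<phi> \<xi>)"])
    show "integrable lborel (\<lambda>\<xi>. norm (cis (\<xi> \<bullet> p) * fourier \<phi> \<xi>))" by (intro integrable_norm i)
    show "(\<lambda>\<xi>. cis (\<xi> \<bullet> p) * fourier \<phi> \<xi>) \<in> borel_measurable lborel" using i by simp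
    have "(\<lambda>\<xi>. gauss (r n *\<^sub>R \<xi>)) \<in> borel_measurable borel" for n
      by (intro borel_measurable_continuous_onI continuous_on_compose2[OF continuous_gauss] continuous_intros) auto
    then show "(\<lambda>\<xi>. cis (\<xi> \<bullet> p) * fourier \<phi> \<xi> * gauss (r n *\<^sub>R \<xi>)) \<in> borel_measurable lborel" for n using i by simp
    show "AE \<xi> in lborel. (\<lambda>n. cis (\<xi> \<bullet> p) * fourier \<phi> \<xi> * gauss (r n *\<^sub>R \<xi>)) \<longlonglongrightarrow> cis (\<xi> \<bullet> p) * fourier \<phi> \<xi>"
    proof (rule AE_I2)
      fix \<xi>
      show "(\<lambda>n. cis (\<xi> \<bullet> p) * fourier \<phi> \<xi> * gauss (r n *\<^sub>R \<xi>)) \<longlonglongrightarrow> cis (\<xi> \<bullet> p) * fourier \<phi> \<xi>"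
        using tendsto_mult_left[OF gauss_dilation_tendsto[of \<xi>], of "cis (\<xi> \<bullet> p) * fourier \<phi> \<xi>"] by (simp add: r_def)
    qed
    show "AE \<xi> in lborel. norm (cis (\<xi> \<bullet> p) * fourier \<phi> \<xi> * gauss (r n *\<^sub>R \<xi>)) \<le> norm (cis (\<xi> \<bullet> p) * fourier \<phi> \<xi>)" for n
    proof (rule AE_I2)
      fix \<xi>
      show "norm (cis (\<xi> \<bullet> p) * fourier \<phi> \<xi> * gauss (r n *\<^sub>R \<xi>)) \<le> norm (cis (\<xi> \<bullet> p) * fourier \<phi> \<xi>)"
        unfolding norm_mult[of "cis (\<xi> \<bullet> p) * fourier \<phi> \<xi>"] by (intro mult_right_le_one_le gauss_le_1) auto
    qed
  qed
  obtain B where "derivs_le 0 \<phi> (\<lambda>p. B / (1 + norm p) ^ 0)" using schwartz_derivs_le_ex[OF \<phi>] by blast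
  then have B: "norm (\<phi> q) \<le> B" for q by simp
  have B0: "0 \<le> B" using B[of 0] norm_ge_zero order_trans by blast
  have m\<phi>: "(\<lambda>w. \<phi> (p + r n *\<^sub>R w)) \<in> borel_measurable borel" for n
    by (intro borel_measurable_continuous_onI continuous_on_compose2[OF smooth_imp_continuous[OF schwartz_smooth[OF \<phi>]]] continuous_intros) auto
  have L2: "(\<lambda>n. \<integral>w. \<phi> (p + r n *\<^sub>R w) * gauss w \<partial>lborel) \<longlonglongrightarrow> (\<integral>w. \<phi> p * gauss w \<partial>lborel)"
  proof (rule integral_dominated_convergence[where w = "\<lambda>w. B * norm (gauss w)"])
    show "integrable lborel (\<lambda>w. B * norm (gauss w))" using integrable_gauss by (intro integrable_mult_right integrable_norm)
    show "(\<lambda>w. \<phi> (p + r n *\<^sub>R w) * gauss w) \<in> borel_measurable lborel" for n using m\<phi> by simp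
    show "AE w in lborel. (\<lambda>n. \<phi> (p + r n *\<^sub>R w) * gauss w) \<longlonglongrightarrow> \<phi> p * gauss w"
    proof (rule AE_I2, rule tendsto_mult_right)
      fix w
      have "(\<lambda>n. p + r n *\<^sub>R w) \<longlonglongrightarrow> p + 0 *\<^sub>R w"
        unfolding r_def by (intro tendsto_add tendsto_scaleR tendsto_const LIMSEQ_Suc[OF lim_1_over_n])
      moreover have "isCont \<phi> p"
        using smooth_imp_continuous[OF schwartz_smooth[OF \<phi>]] by (simp add: continuous_on_eq_continuous_at)
      ultimately show "(\<lambda>n. \<phi> (p + r n *\<^sub>R w)) \<longlonglongrightarrow> \<phi> p" using isCont_tendsto_compose[of p \<phi>] by simp
    qed
    show "AE w in lborel. norm (\<phi> (p + r n *\<^sub>R w) * gauss w) \<le> B * norm (gauss w)" for n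
      by (rule AE_I2) (simp add: norm_mult mult_right_mono B)
  qed simp
  have "(\<lambda>n. \<integral>\<xi>. cis (\<xi> \<bullet> p) * fourier \<phi> \<xi> * gauss (r n *\<^sub>R \<xi>) \<partial>lborel) \<longlonglongrightarrow> of_real (2 * pi) * (\<integral>w. \<phi> p * gauss w \<partial>lborel)"
    unfolding fourier_inversion_damped[OF \<phi> r] by (intro tendsto_mult_left L2)
  from LIMSEQ_unique[OF L1 this] show ?thesis
    by (simp add: integral_gauss power2_eq_square mult_ac)
qed

definition inverse_fourier :: "planefun \<Rightarrow> planefun" where
  "inverse_fourier \<phi> p = of_real (1 / (2 * pi)\<^sup>2) * fourier \<phi> (- p)"

lemma inverse_fourier_fourier:
  assumes "\<phi> \<in> schwartz_functions"
  shows "inverse_fourier (fourier \<phi>) = \<phi>"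
proof
  fix p
  have "fourier (fourier \<phi>) (- p) = of_real ((2 * pi)\<^sup>2) * \<phi> p"
    using fourier_inversion[OF assms, of p] by (simp add: fourier_def inner_commute)
  then show "inverse_fourier (fourier \<phi>) p = \<phi> p" by (simp add: inverse_fourier_def)
qed

lemma schwartz_inverse_fourier:
  "\<phi> \<in> schwartz_functions \<Longrightarrow> inverse_fourier \<phi> \<in> schwartz_functions"
  unfolding inverse_fourier_def[abs_def]
  by (intro schwartz_cmult schwartz_reflect[where \<phi> = "fourier \<phi>"] schwartz_fourier)

lemma fourier_inverse_fourier:
  assumes \<phi>: "\<phi> \<in> schwartz_functions"
  shows "fourier (inverse_fourier \<phi>) = \<phi>"
proof
  fix \<xi>
  note [measurable] = schwartz_measurable[OF schwartz_fourier[OF \<phi>]]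
  have m: "(\<lambda>p. cis (\<xi> \<bullet> p) * fourier \<phi> p) \<in> borel_measurable borel"
  proof -
    have "(\<lambda>p. cis (\<xi> \<bullet> p)) \<in> borel_measurable borel"
      by (intro borel_measurable_continuous_onI continuous_intros)
    then show ?thesis by simp
  qed
  have "fourier (inverse_fourier \<phi>) \<xi> = of_real (1 / (2 * pi)\<^sup>2) * (\<integral>p. cis (- (\<xi> \<bullet> p)) * fourier \<phi> (- p) \<partial>lborel)"
    unfolding fourier_def[of "inverse_fourier \<phi>"] inverse_fourier_def
    by (simp only: mult.left_commute[of "cis _"] integral_mult_right_zero)
  also have "(\<integral>p. cis (- (\<xi> \<bullet> p)) * fourier \<phi> (- p) \<partial>lborel) = (\<integral>p. cis (\<xi> \<bullet> p) * fourier \<phi> p \<partial>lborel)"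
    using lborel_integral_affine_plane[OF m, of "-1" 0] by simp
  also have "\<dots> = of_real ((2 * pi)\<^sup>2) * \<phi> \<xi>"
    using fourier_inversion[OF \<phi>, of \<xi>] by (simp add: inner_commute)
  finally show "fourier (inverse_fourier \<phi>) \<xi> = \<phi> \<xi>" by simp
qed

section \<open>Weighted Sobolev spaces\<close>

text \<open>Boxes are closed under intersection and generate the Borel sets, so vanishing integrals
  pass from boxes to all Borel sets by a Dynkin argument. It is run inside one fixed box at a time,
  where \<open>g\<close> is integrable; countably many boxes exhaust the plane.\<close>

lemma AE_zero_of_box_integrals:
  fixes g :: planefun
  assumes i: "\<And>a b. integrable lborel (\<lambda>x. indicat_real (box a b) x *\<^sub>R g x)"
    and z: "\<And>a b. (\<integral>x. indicat_real (box a b) x *\<^sub>R g x \<partial>lborel) = 0"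
  shows "AE x in lborel. g x = 0"
proof -
  have "AE x in lborel. indicat_real (box l u) x *\<^sub>R g x = 0" for l u
  proof (rule sigma_finite_measure.density_zero[OF sigma_finite_lborel i])
    let ?f = "\<lambda>x. indicat_real (box l u) x *\<^sub>R g x"
    fix A :: "(real \<times> real) set" assume "A \<in> sets lborel"
    then have A: "A \<in> sigma_sets UNIV (range (\<lambda>(a, b). box a b))" by (simp add: borel_eq_box)
    have "Int_stable (range (\<lambda>(a, b). box a b :: (real \<times> real) set))"
    proof (rule Int_stableI)
      fix A B :: "(real \<times> real) set"
      assume "A \<in> range (\<lambda>(a, b). box a b)" "B \<in> range (\<lambda>(a, b). box a b)"
      then obtain a b c d where "A = box a b" "B = box c d" by auto
      then obtain l u where "A \<inter> B = box l u" using box_Int_box by blast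
      then show "A \<inter> B \<in> range (\<lambda>(a, b). box a b)" by (intro range_eqI[of _ _ "(l, u)"]) simp
    qed
    moreover have "(range (\<lambda>(a, b). box a b :: (real \<times> real) set)) \<subseteq> Pow UNIV" by auto
    ultimately show "set_lebesgue_integral lborel A ?f = 0"
      using A
    proof (induction rule: sigma_sets_induct_disjoint)
      case (basic A)
      then obtain a b where A: "A = box a b" by auto
      obtain c d where cd: "box a b \<inter> box l u = box c d" using box_Int_box by blast
      have eq: "indicat_real A x *\<^sub>R ?f x = indicat_real (box c d) x *\<^sub>R g x" for x
        unfolding A cd[symmetric] by (simp add: indicator_def)
      show ?case unfolding set_lebesgue_integral_def eq by (rule z)
    next
      case empty
      then show ?case by (simp add: set_lebesgue_integral_def)
    next
      case (compl A)
      then have A': "A \<in> sets lborel" by (simp add: borel_eq_box)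
      have eq: "indicat_real (UNIV - A) x *\<^sub>R ?f x = ?f x - indicat_real A x *\<^sub>R ?f x" for x
        by (simp add: indicator_def)
      have "integrable lborel (\<lambda>x. indicat_real A x *\<^sub>R ?f x)" by (rule integrable_mult_indicator[OF A' i])
      from Bochner_Integration.integral_diff[OF i this] show ?case
        using compl(2) unfolding set_lebesgue_integral_def eq by (simp only: z diff_zero)
    next
      case (union F)
      then have F: "F i \<in> sets lborel" for i by (auto simp: borel_eq_box)
      have "set_lebesgue_integral lborel (\<Union>i. F i) ?f = (\<Sum>i. set_lebesgue_integral lborel (F i) ?f)"
      proof (rule lebesgue_integral_countable_add[OF F])
        show "F i \<inter> F j = {}" if "i \<noteq> j" for i j using union(1) that by (auto simp: disjoint_family_on_def)
        show "set_integrable lborel (\<Union>i. F i) ?f"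
          unfolding set_integrable_def by (rule integrable_mult_indicator[OF _ i]) (use F in auto)
      qed
      then show ?case using union(3) by simp
    qed
  qed
  then have "AE x in lborel. \<forall>n::nat. indicat_real (box (- (real n, real n)) (real n, real n)) x *\<^sub>R g x = 0"
    by (simp only: AE_all_countable) blast
  then show ?thesis
  proof eventually_elim
    case (elim x)
    obtain n :: nat where n: "\<bar>fst x\<bar> + \<bar>snd x\<bar> < real n" using reals_Archimedean2 by blast
    then have "x \<in> box (- (real n, real n)) (real n, real n)" by (auto simp: mem_box_plane)
    then show ?case using elim[rule_format, of n] by simp
  qed
qed

text \<open>Integrability against Schwartz functions yields local integrability: a bump on a
  slightly larger box is bounded below on the given one and provides the dominating function
  \<open>w\<close>. The bumps on the box itself then converge to its indicator.\<close>

lemma AE_zero_of_schwartz_integrals: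
  fixes g :: planefun
  assumes [measurable]: "g \<in> borel_measurable borel"
    and i: "\<And>\<phi>. \<phi> \<in> schwartz_functions \<Longrightarrow> integrable lborel (\<lambda>\<xi>. g \<xi> * \<phi> \<xi>)"
    and z: "\<And>\<phi>. \<phi> \<in> schwartz_functions \<Longrightarrow> (\<integral>\<xi>. g \<xi> * \<phi> \<xi> \<partial>lborel) = 0"
  shows "AE \<xi> in lborel. g \<xi> = 0"
proof (rule AE_zero_of_box_integrals)
  fix a b :: "real \<times> real"
  let ?\<psi> = "\<lambda>p. complex_of_real (box_bump 1 (a - (1, 1)) (b + (1, 1)) p)"
  have \<psi>: "?\<psi> \<in> schwartz_functions" by (intro test_imp_schwartz box_bump_test) simp
  \<comment> \<open>On the inner box all four flat factors have arguments greater than 1, so each is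
    at least exp (-1).\<close>
  have low: "box_bump 1 (a - (1, 1)) (b + (1, 1)) p \<ge> exp (- 1) ^ 4" if "p \<in> box a b" for p
  proof -
    have f: "flat 1 1 t \<ge> exp (- 1)" if "t > 1" for t using that by (simp add: flat_def)
    have "exp (- 1) * exp (- 1) * (exp (- 1) * exp (- 1)) \<le> box_bump 1 (a - (1, 1)) (b + (1, 1)) p"
      unfolding box_bump_def using that by (intro mult_mono f mult_nonneg_nonneg) (auto simp: mem_box_plane flat_bounds)
    then show ?thesis by (simp add: power4_eq_xxxx mult.assoc)
  qed
  define w where "w \<xi> = (1 / exp (- 1) ^ 4) * norm (g \<xi> * ?\<psi> \<xi>)" for \<xi>
  have wi: "integrable lborel w" unfolding w_def by (intro integrable_mult_right integrable_norm i \<psi>)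
  have le: "norm (g \<xi>) * t \<le> w \<xi>" if "0 \<le> t" "t \<le> 1" "\<xi> \<notin> box a b \<Longrightarrow> t = 0" for \<xi> t
  proof (cases "\<xi> \<in> box a b")
    case True
    have "(1::real) = (1 / exp (- 1) ^ 4) * exp (- 1) ^ 4" by simp
    also have "\<dots> \<le> (1 / exp (- 1) ^ 4) * box_bump 1 (a - (1, 1)) (b + (1, 1)) \<xi>" by (intro mult_left_mono low True) simp
    finally have 1: "1 \<le> (1 / exp (- 1) ^ 4) * box_bump 1 (a - (1, 1)) (b + (1, 1)) \<xi>" .
    have "norm (g \<xi>) * t \<le> norm (g \<xi>) * ((1 / exp (- 1) ^ 4) * box_bump 1 (a - (1, 1)) (b + (1, 1)) \<xi>)"
      by (intro mult_left_mono order_trans[OF that(2) 1]) simp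
    then show ?thesis by (simp add: w_def norm_mult box_bump_bounds mult_ac)
  next
    case False
    then show ?thesis using that by (simp add: w_def)
  qed
  have ind: "norm (indicat_real (box a b) \<xi> *\<^sub>R g \<xi>) \<le> w \<xi>" for \<xi>
    using le[of "indicat_real (box a b) \<xi>" \<xi>] by (simp add: mult.commute indicator_def)
  show ib: "integrable lborel (\<lambda>\<xi>. indicat_real (box a b) \<xi> *\<^sub>R g \<xi>)"
    by (rule Bochner_Integration.integrable_bound[OF wi]) (use ind in \<open>auto intro!: AE_I2 order_trans[OF _ abs_ge_self]\<close>)
  have "(\<lambda>n. \<integral>\<xi>. g \<xi> * of_real (box_bump (1 / real (Suc n)) a b \<xi>) \<partial>lborel) \<longlonglongrightarrow> (\<integral>\<xi>. indicat_real (box a b) \<xi> *\<^sub>R g \<xi> \<partial>lborel)"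
  proof (rule integral_dominated_convergence[OF _ _ wi])
    show "(\<lambda>\<xi>. indicat_real (box a b) \<xi> *\<^sub>R g \<xi>) \<in> borel_measurable lborel" by simp
    show "(\<lambda>\<xi>. g \<xi> * of_real (box_bump (1 / real (Suc n)) a b \<xi>)) \<in> borel_measurable lborel" for n
      using smooth_measurable[OF smooth_box_bump, of "1 / real (Suc n)" a b] by simp
    show "AE \<xi> in lborel. (\<lambda>n. g \<xi> * of_real (box_bump (1 / real (Suc n)) a b \<xi>)) \<longlonglongrightarrow> indicat_real (box a b) \<xi> *\<^sub>R g \<xi>"
    proof (rule AE_I2)
      fix \<xi>
      show "(\<lambda>n. g \<xi> * of_real (box_bump (1 / real (Suc n)) a b \<xi>)) \<longlonglongrightarrow> indicat_real (box a b) \<xi> *\<^sub>R g \<xi>"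
        using tendsto_mult_left[OF tendsto_of_real[OF box_bump_tendsto[of a b \<xi>]], of "g \<xi>"]
        by (simp add: scaleR_conv_of_real mult.commute)
    qed
    show "AE \<xi> in lborel. norm (g \<xi> * of_real (box_bump (1 / real (Suc n)) a b \<xi>)) \<le> w \<xi>" for n
    proof (rule AE_I2)
      fix \<xi>
      show "norm (g \<xi> * of_real (box_bump (1 / real (Suc n)) a b \<xi>)) \<le> w \<xi>"
        using le[of "box_bump (1 / real (Suc n)) a b \<xi>" \<xi>] box_bump_bounds[of "1 / real (Suc n)" a b \<xi>]
        by (simp add: norm_mult box_bump_zero)
    qed
  qed
  moreover have "(\<integral>\<xi>. g \<xi> * of_real (box_bump (1 / real (Suc n)) a b \<xi>) \<partial>lborel) = 0" for n
    by (intro z test_imp_schwartz box_bump_test) simp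
  ultimately have "(\<lambda>n::nat. 0::complex) \<longlonglongrightarrow> (\<integral>\<xi>. indicat_real (box a b) \<xi> *\<^sub>R g \<xi> \<partial>lborel)" by simp
  then show "(\<integral>\<xi>. indicat_real (box a b) \<xi> *\<^sub>R g \<xi> \<partial>lborel) = 0" by (simp add: LIMSEQ_const_iff)
qed

section \<open>Functions as transforms of tempered distributions\<close>

lemma has_fourier_funD:
  assumes "has_fourier_fun w g"
  shows "g \<in> borel_measurable borel" "\<And>\<phi>. \<phi> \<in> schwartz_functions \<Longrightarrow> integrable lborel (\<lambda>\<xi>. g \<xi> * \<phi> \<xi>)"
  using assms by (auto simp: has_fourier_fun_def)

text \<open>The transform maps the Schwartz space onto itself, so testing the defining identity on
  \<open>inverse_fourier \<phi>\<close> recovers \<open>W\<close> from \<open>g\<close>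
  explicitly.\<close>

lemma has_fourier_fun_tempered:
  assumes "has_fourier_fun w g"
  obtains W where "W \<in> tempered_distributions" "w = restrict W test_functions"
    "\<And>\<phi>. \<phi> \<in> schwartz_functions \<Longrightarrow> W \<phi> = (\<integral>\<xi>. g \<xi> * inverse_fourier \<phi> \<xi> \<partial>lborel)"
proof -
  obtain W where W: "W \<in> tempered_distributions" "w = restrict W test_functions" "fourier_tempered W = regular_tempered g"
    using assms by (auto simp: has_fourier_fun_def)
  have "W \<phi> = (\<integral>\<xi>. g \<xi> * inverse_fourier \<phi> \<xi> \<partial>lborel)" if "\<phi> \<in> schwartz_functions" for \<phi>
    using fun_cong[OF W(3), of "inverse_fourier \<phi>"] schwartz_inverse_fourier[OF that] fourier_inverse_fourier[OF that]
    by (simp add: fourier_tempered_def regular_tempered_def)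
  then show ?thesis using that W by blast
qed

lemma has_fourier_fun_eq:
  assumes "has_fourier_fun w g"
  shows "w = (\<lambda>\<phi>\<in>test_functions. \<integral>\<xi>. g \<xi> * inverse_fourier \<phi> \<xi> \<partial>lborel)"
proof -
  obtain W where W: "w = restrict W test_functions"
    "\<And>\<phi>. \<phi> \<in> schwartz_functions \<Longrightarrow> W \<phi> = (\<integral>\<xi>. g \<xi> * inverse_fourier \<phi> \<xi> \<partial>lborel)"
    using has_fourier_fun_tempered[OF assms] by blast
  show ?thesis unfolding W(1) by (rule restrict_ext) (intro W(2) test_imp_schwartz)
qed

lemma has_fourier_fun_cong_AE:
  assumes w: "has_fourier_fun w g" and g': "g' \<in> borel_measurable borel" and ae: "AE \<xi> in lborel. g \<xi> = g' \<xi>"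
  shows "has_fourier_fun w g'"
proof -
  note [measurable] = g' has_fourier_funD(1)[OF w]
  have *: "integrable lborel (\<lambda>\<xi>. g' \<xi> * \<phi> \<xi>) \<and> (\<integral>\<xi>. g' \<xi> * \<phi> \<xi> \<partial>lborel) = (\<integral>\<xi>. g \<xi> * \<phi> \<xi> \<partial>lborel)"
    if \<phi>: "\<phi> \<in> schwartz_functions" for \<phi>
  proof -
    note [measurable] = schwartz_measurable[OF \<phi>]
    have ae': "AE \<xi> in lborel. g \<xi> * \<phi> \<xi> = g' \<xi> * \<phi> \<xi>" using ae by eventually_elim simp
    have m: "(\<lambda>\<xi>. g \<xi> * \<phi> \<xi>) \<in> borel_measurable lborel" "(\<lambda>\<xi>. g' \<xi> * \<phi> \<xi>) \<in> borel_measurable lborel"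
      by measurable
    show ?thesis
      using integral_cong_AE[OF m ae'] integrable_cong_AE[OF m ae'] has_fourier_funD(2)[OF w \<phi>] by simp
  qed
  then have "integrable lborel (\<lambda>\<xi>. g' \<xi> * \<phi> \<xi>)" if "\<phi> \<in> schwartz_functions" for \<phi> using that by blast
  moreover have "regular_tempered g' = regular_tempered g"
    unfolding regular_tempered_def by (rule restrict_ext) (use * in blast)
  ultimately show ?thesis using w g' by (simp add: has_fourier_fun_def)
qed

lemma schwartz_diff:
  "\<phi> \<in> schwartz_functions \<Longrightarrow> \<psi> \<in> schwartz_functions \<Longrightarrow> (\<lambda>p. \<phi> p - \<psi> p) \<in> schwartz_functions"
  using schwartz_add[of \<phi> "\<lambda>p. (-1) * \<psi> p"] schwartz_cmult[of \<psi> "-1"] by simp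

lemma tempered_continuous:
  assumes W: "W \<in> tempered_distributions" and \<phi>: "\<phi> \<in> schwartz_functions" and \<psi>: "\<And>n. \<psi> n \<in> schwartz_functions"
    and lim: "\<And>N. (\<lambda>n. schwartz_seminorm N (\<lambda>p. \<phi> p - \<psi> n p)) \<longlonglongrightarrow> 0"
  shows "(\<lambda>n. W (\<psi> n)) \<longlonglongrightarrow> W \<phi>"
proof -
  obtain N B where lin: "linear_functional_on schwartz_functions W"
    and B: "\<And>\<phi>. \<phi> \<in> schwartz_functions \<Longrightarrow> norm (W \<phi>) \<le> B * schwartz_seminorm N \<phi>"
    using W by (auto simp: tempered_distributions_def)
  have "W (\<lambda>p. 1 * \<phi> p + (-1) * \<psi> n p) = 1 * W \<phi> + (-1) * W (\<psi> n)" for n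
    using lin \<phi> \<psi>[of n] unfolding linear_functional_on_def by blast
  then have "W \<phi> - W (\<psi> n) = W (\<lambda>p. \<phi> p - \<psi> n p)" for n by simp
  then have le: "norm (W (\<psi> n) - W \<phi>) \<le> B * schwartz_seminorm N (\<lambda>p. \<phi> p - \<psi> n p)" for n
    using B[OF schwartz_diff[OF \<phi> \<psi>[of n]]] by (simp add: norm_minus_commute)
  have "(\<lambda>n. B * schwartz_seminorm N (\<lambda>p. \<phi> p - \<psi> n p)) \<longlonglongrightarrow> 0"
    using tendsto_mult_left[OF lim, of B] by simp
  then have "(\<lambda>n. W (\<psi> n) - W \<phi>) \<longlonglongrightarrow> 0"
    by (rule Lim_null_comparison[OF always_eventually[OF allI[OF le]]])
  then show ?thesis by (simp add: LIM_zero_iff)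
qed

text \<open>Two tempered extensions of \<open>w\<close> agree on the dense test functions, hence
  everywhere by continuity. Evaluating them at \<open>fourier \<phi>\<close> shows that
  \<open>g\<close> and \<open>g'\<close> have the same integrals against all Schwartz
  functions.\<close>

lemma has_fourier_fun_unique:
  assumes g: "has_fourier_fun w g" and g': "has_fourier_fun w g'"
  shows "AE \<xi> in lborel. g \<xi> = g' \<xi>"
proof -
  obtain W where W: "W \<in> tempered_distributions" "w = restrict W test_functions"
    "\<And>\<phi>. \<phi> \<in> schwartz_functions \<Longrightarrow> W \<phi> = (\<integral>\<xi>. g \<xi> * inverse_fourier \<phi> \<xi> \<partial>lborel)"
    using has_fourier_fun_tempered[OF g] by blast
  obtain W' where W': "W' \<in> tempered_distributions" "w = restrict W' test_functions"
    "\<And>\<phi>. \<phi> \<in> schwartz_functions \<Longrightarrow> W' \<phi> = (\<integral>\<xi>. g' \<xi> * inverse_fourier \<phi> \<xi> \<partial>lborel)"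
    using has_fourier_fun_tempered[OF g'] by blast
  have eqW: "W \<phi> = W' \<phi>" if \<phi>: "\<phi> \<in> schwartz_functions" for \<phi>
  proof -
    obtain \<psi> where \<psi>: "\<And>n. \<psi> n \<in> test_functions" "\<And>N. (\<lambda>n. schwartz_seminorm N (\<lambda>p. \<phi> p - \<psi> n p)) \<longlonglongrightarrow> 0"
      using test_functions_dense[OF \<phi>] by blast
    have "W (\<psi> n) = W' (\<psi> n)" for n using \<psi>(1)[of n] W(2) W'(2) by (metis restrict_apply')
    then show ?thesis
      using tempered_continuous[OF W(1) \<phi> test_imp_schwartz[OF \<psi>(1)] \<psi>(2)]
        tempered_continuous[OF W'(1) \<phi> test_imp_schwartz[OF \<psi>(1)] \<psi>(2)] by (simp add: LIMSEQ_unique)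
  qed
  have "AE \<xi> in lborel. g \<xi> - g' \<xi> = 0"
  proof (rule AE_zero_of_schwartz_integrals)
    show "(\<lambda>\<xi>. g \<xi> - g' \<xi>) \<in> borel_measurable borel"
      using has_fourier_funD(1)[OF g] has_fourier_funD(1)[OF g'] by simp
    fix \<phi> assume \<phi>: "\<phi> \<in> schwartz_functions"
    note i = has_fourier_funD(2)[OF g \<phi>] has_fourier_funD(2)[OF g' \<phi>]
    show "integrable lborel (\<lambda>\<xi>. (g \<xi> - g' \<xi>) * \<phi> \<xi>)" using i by (simp add: left_diff_distrib)
    have "(\<integral>\<xi>. g \<xi> * \<phi> \<xi> \<partial>lborel) = (\<integral>\<xi>. g' \<xi> * \<phi> \<xi> \<partial>lborel)"
      using eqW[OF schwartz_fourier[OF \<phi>]] W(3)[OF schwartz_fourier[OF \<phi>]] W'(3)[OF schwartz_fourier[OF \<phi>]]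
      by (simp add: inverse_fourier_fourier[OF \<phi>])
    then show "(\<integral>\<xi>. (g \<xi> - g' \<xi>) * \<phi> \<xi> \<partial>lborel) = 0" using i by (simp add: left_diff_distrib)
  qed
  then show ?thesis by eventually_elim simp
qed

lemma has_fourier_fun_fourier_fun: "has_fourier_fun w g \<Longrightarrow> has_fourier_fun w (fourier_fun w)"
  unfolding fourier_fun_def by (rule someI[where P = "has_fourier_fun w"])

text \<open>The choice made in \<open>fourier_fun\<close> is thereby harmless: norms can be computed
  from any transform at hand.\<close>

lemma fourier_fun_AE: "has_fourier_fun w g \<Longrightarrow> AE \<xi> in lborel. fourier_fun w \<xi> = g \<xi>"
  using has_fourier_fun_unique has_fourier_fun_fourier_fun by blast

section \<open>Exponential weights and differences of distributions\<close>

lemma exp_weight_eq: "\<phi> \<in> test_functions \<Longrightarrow> exp_weight \<gamma> u \<phi> = u (\<lambda>p. exp_fst (- \<gamma>) p * \<phi> p)"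
  by (simp add: exp_weight_def exp_fst_def)

lemma exp_fst_cancel: "exp_fst \<gamma> p * (exp_fst (- \<gamma>) p * z) = z" "exp_fst (- \<gamma>) p * (exp_fst \<gamma> p * z) = z"
  unfolding exp_fst_def mult.assoc[symmetric] of_real_mult[symmetric] exp_add[symmetric] by simp_all

lemma exp_weight_inject:
  assumes "f \<in> distributions" "f' \<in> distributions" "exp_weight \<gamma> f = exp_weight \<gamma> f'"
  shows "f = f'"
proof (rule extensionalityI[where A = test_functions])
  show "f \<in> extensional test_functions" "f' \<in> extensional test_functions" using assms by (auto simp: distributions_def)
  fix \<phi> assume \<phi>: "\<phi> \<in> test_functions"
  show "f \<phi> = f' \<phi>"
    using fun_cong[OF assms(3), of "\<lambda>p. exp_fst \<gamma> p * \<phi> p"] test_mult_exp_fst[OF \<phi>, of \<gamma>]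
    by (simp add: exp_weight_eq exp_fst_cancel)
qed

lemma test_lincomb:
  assumes "\<phi> \<in> test_functions" "\<psi> \<in> test_functions"
  shows "(\<lambda>p. a * \<phi> p + b * \<psi> p) \<in> test_functions"
proof (rule test_functionsI[where S = "support \<phi> \<union> support \<psi>"])
  show "smooth (\<lambda>p. a * \<phi> p + b * \<psi> p)"
    using assms by (intro smooth_add smooth_mult smooth_const test_smooth)
  show "compact (support \<phi> \<union> support \<psi>)" using assms by (auto simp: test_functions_def)
qed (auto simp: not_in_support)

text \<open>Test functions keep compact support when multiplied by the exponential, and
  \<open>schwartz_seminorm_exp_test\<close> controls the result on each compact set. In this way a
  tempered distribution built on the frequency side becomes an element of the weighted
  space.\<close>

lemma tempered_exp_distribution:
  assumes W: "W \<in> tempered_distributions"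
  shows "(\<lambda>\<phi>\<in>test_functions. W (\<lambda>p. exp_fst \<gamma> p * \<phi> p)) \<in> distributions"
  unfolding distributions_def
proof (intro CollectI conjI allI impI)
  obtain N B where lin: "linear_functional_on schwartz_functions W"
    and B: "\<And>\<phi>. \<phi> \<in> schwartz_functions \<Longrightarrow> norm (W \<phi>) \<le> B * schwartz_seminorm N \<phi>"
    using W by (auto simp: tempered_distributions_def)
  note S = test_imp_schwartz[OF test_mult_exp_fst]
  show "linear_functional_on test_functions (\<lambda>\<phi>\<in>test_functions. W (\<lambda>p. exp_fst \<gamma> p * \<phi> p))"
    unfolding linear_functional_on_def
  proof (intro ballI allI)
    fix \<phi> \<psi> a b assume t: "\<phi> \<in> test_functions" "\<psi> \<in> test_functions"
    have "W (\<lambda>p. a * (exp_fst \<gamma> p * \<phi> p) + b * (exp_fst \<gamma> p * \<psi> p)) = a * W (\<lambda>p. exp_fst \<gamma> p * \<phi> p) + b * W (\<lambda>p. exp_fst \<gamma> p * \<psi> p)"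
      by (rule lin[unfolded linear_functional_on_def, rule_format, OF S[OF t(1)] S[OF t(2)]])
    then show "(\<lambda>\<phi>\<in>test_functions. W (\<lambda>p. exp_fst \<gamma> p * \<phi> p)) (\<lambda>p. a * \<phi> p + b * \<psi> p) =
       a * (\<lambda>\<phi>\<in>test_functions. W (\<lambda>p. exp_fst \<gamma> p * \<phi> p)) \<phi> + b * (\<lambda>\<phi>\<in>test_functions. W (\<lambda>p. exp_fst \<gamma> p * \<phi> p)) \<psi>"
      using t test_lincomb[OF t, of a b] by (simp add: distrib_left mult.left_commute)
  qed
  fix K :: "(real \<times> real) set" assume K: "compact K"
  obtain C where C: "C \<ge> 0" "\<And>\<phi>. \<phi> \<in> test_functions \<Longrightarrow> support \<phi> \<subseteq> K \<Longrightarrow> schwartz_seminorm N (\<lambda>p. exp_fst \<gamma> p * \<phi> p) \<le> C * test_seminorm (2 * N) \<phi>"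
    using schwartz_seminorm_exp_test[OF K] by blast
  show "\<exists>N B. \<forall>\<phi>\<in>test_functions. support \<phi> \<subseteq> K \<longrightarrow> norm ((\<lambda>\<phi>\<in>test_functions. W (\<lambda>p. exp_fst \<gamma> p * \<phi> p)) \<phi>) \<le> B * test_seminorm N \<phi>"
  proof (intro exI ballI impI)
    fix \<phi> assume \<phi>: "\<phi> \<in> test_functions" "support \<phi> \<subseteq> K"
    have "norm (W (\<lambda>p. exp_fst \<gamma> p * \<phi> p)) \<le> B * schwartz_seminorm N (\<lambda>p. exp_fst \<gamma> p * \<phi> p)"
      by (rule B[OF S[OF \<phi>(1)]])
    also have "\<dots> \<le> \<bar>B\<bar> * schwartz_seminorm N (\<lambda>p. exp_fst \<gamma> p * \<phi> p)"
      using schwartz_seminorm_nonneg[OF S[OF \<phi>(1)]] by (intro mult_right_mono) auto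
    also have "\<dots> \<le> \<bar>B\<bar> * (C * test_seminorm (2 * N) \<phi>)" by (intro mult_left_mono C(2) \<phi>) simp
    finally show "norm ((\<lambda>\<phi>\<in>test_functions. W (\<lambda>p. exp_fst \<gamma> p * \<phi> p)) \<phi>) \<le> (\<bar>B\<bar> * C) * test_seminorm (2 * N) \<phi>"
      using \<phi> by (simp add: mult.assoc)
  qed
qed simp

lemma tempered_restrict_distribution:
  assumes W: "W \<in> tempered_distributions"
  shows "restrict W test_functions \<in> distributions"
  using tempered_exp_distribution[OF W, of 0] by (simp add: exp_fst_def)

lemma tempered_exp_weight:
  "exp_weight \<gamma> (\<lambda>\<phi>\<in>test_functions. W (\<lambda>p. exp_fst \<gamma> p * \<phi> p)) = restrict W test_functions"
proof
  fix \<phi>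
  show "exp_weight \<gamma> (\<lambda>\<phi>\<in>test_functions. W (\<lambda>p. exp_fst \<gamma> p * \<phi> p)) \<phi> = restrict W test_functions \<phi>"
  proof (cases "\<phi> \<in> test_functions")
    case True
    then show ?thesis using test_mult_exp_fst[OF True, of "- \<gamma>"] by (simp add: exp_weight_eq exp_fst_cancel)
  qed (simp add: exp_weight_def)
qed

lemma schwartz_seminorm_mono:
  assumes \<phi>: "\<phi> \<in> schwartz_functions" and N: "2 * N \<le> M"
  shows "schwartz_seminorm N \<phi> \<le> (real N + 1)\<^sup>2 * schwartz_seminorm M \<phi>"
proof (rule schwartz_seminorm_le[OF schwartz_smooth[OF \<phi>]])
  show "derivs_le (2 * N) \<phi> (\<lambda>p. schwartz_seminorm M \<phi> / (1 + norm p) ^ N)"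
  proof (rule derivs_le_weaken[OF schwartz_derivs_le[OF \<phi> N]])
    show "schwartz_seminorm M \<phi> / (1 + norm p) ^ M \<le> schwartz_seminorm M \<phi> / (1 + norm p) ^ N" for p :: "real \<times> real"
      using N by (intro divide_left_mono power_increasing mult_pos_pos zero_less_power add_pos_nonneg schwartz_seminorm_nonneg[OF \<phi>]) auto
  qed
qed

lemma tempered_diff:
  assumes W: "W \<in> tempered_distributions" and V: "V \<in> tempered_distributions"
  shows "(\<lambda>\<phi>\<in>schwartz_functions. W \<phi> - V \<phi>) \<in> tempered_distributions"
  unfolding tempered_distributions_def
proof (intro CollectI conjI)
  obtain N B where lin: "linear_functional_on schwartz_functions W"
    and B: "\<And>\<phi>. \<phi> \<in> schwartz_functions \<Longrightarrow> norm (W \<phi>) \<le> B * schwartz_seminorm N \<phi>"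
    using W by (auto simp: tempered_distributions_def)
  obtain N' B' where lin': "linear_functional_on schwartz_functions V"
    and B': "\<And>\<phi>. \<phi> \<in> schwartz_functions \<Longrightarrow> norm (V \<phi>) \<le> B' * schwartz_seminorm N' \<phi>"
    using V by (auto simp: tempered_distributions_def)
  show "linear_functional_on schwartz_functions (\<lambda>\<phi>\<in>schwartz_functions. W \<phi> - V \<phi>)"
    unfolding linear_functional_on_def
  proof (intro ballI allI)
    fix \<phi> \<psi> a b assume t: "\<phi> \<in> schwartz_functions" "\<psi> \<in> schwartz_functions"
    have "W (\<lambda>p. a * \<phi> p + b * \<psi> p) = a * W \<phi> + b * W \<psi>" "V (\<lambda>p. a * \<phi> p + b * \<psi> p) = a * V \<phi> + b * V \<psi>"
      using lin lin' t unfolding linear_functional_on_def by blast+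
    then show "(\<lambda>\<phi>\<in>schwartz_functions. W \<phi> - V \<phi>) (\<lambda>p. a * \<phi> p + b * \<psi> p) =
      a * (\<lambda>\<phi>\<in>schwartz_functions. W \<phi> - V \<phi>) \<phi> + b * (\<lambda>\<phi>\<in>schwartz_functions. W \<phi> - V \<phi>) \<psi>"
      using t schwartz_add[OF schwartz_cmult[OF t(1)] schwartz_cmult[OF t(2)], of a b] by (simp add: algebra_simps)
  qed
  define M where "M = 2 * max N N'"
  have up: "c * schwartz_seminorm k \<phi> \<le> \<bar>c\<bar> * ((real k + 1)\<^sup>2 * schwartz_seminorm M \<phi>)"
    if "\<phi> \<in> schwartz_functions" "2 * k \<le> M" for c k \<phi>
  proof -
    have "c * schwartz_seminorm k \<phi> \<le> \<bar>c\<bar> * schwartz_seminorm k \<phi>"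
      by (intro mult_right_mono schwartz_seminorm_nonneg that) simp
    also have "\<dots> \<le> \<bar>c\<bar> * ((real k + 1)\<^sup>2 * schwartz_seminorm M \<phi>)"
      by (intro mult_left_mono schwartz_seminorm_mono that) simp
    finally show ?thesis .
  qed
  show "\<exists>N B. \<forall>\<phi>\<in>schwartz_functions. norm ((\<lambda>\<phi>\<in>schwartz_functions. W \<phi> - V \<phi>) \<phi>) \<le> B * schwartz_seminorm N \<phi>"
  proof (intro exI ballI)
    fix \<phi> assume \<phi>: "\<phi> \<in> schwartz_functions"
    have "norm (W \<phi> - V \<phi>) \<le> norm (W \<phi>) + norm (V \<phi>)" by (rule norm_triangle_ineq4)
    also have "\<dots> \<le> \<bar>B\<bar> * ((real N + 1)\<^sup>2 * schwartz_seminorm M \<phi>) + \<bar>B'\<bar> * ((real N' + 1)\<^sup>2 * schwartz_seminorm M \<phi>)"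
      by (intro add_mono order_trans[OF B[OF \<phi>]] order_trans[OF B'[OF \<phi>]] up \<phi>) (auto simp: M_def)
    finally show "norm ((\<lambda>\<phi>\<in>schwartz_functions. W \<phi> - V \<phi>) \<phi>) \<le> (\<bar>B\<bar> * (real N + 1)\<^sup>2 + \<bar>B'\<bar> * (real N' + 1)\<^sup>2) * schwartz_seminorm M \<phi>"
      using \<phi> by (simp add: algebra_simps)
  qed
qed simp

text \<open>\<open>dist_diff\<close> occurs in the Bochner condition, so distances have to be read
  off from transforms. The tempered extension of the difference is the difference of the
  extensions.\<close>

lemma has_fourier_fun_diff:
  assumes g: "has_fourier_fun (exp_weight \<gamma> u) g" and h: "has_fourier_fun (exp_weight \<gamma> w) h"
  shows "has_fourier_fun (exp_weight \<gamma> (dist_diff u w)) (\<lambda>\<xi>. g \<xi> - h \<xi>)"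
  unfolding has_fourier_fun_def
proof (intro conjI ballI)
  show "(\<lambda>\<xi>. g \<xi> - h \<xi>) \<in> borel_measurable borel"
    using has_fourier_funD(1)[OF g] has_fourier_funD(1)[OF h] by simp
  show "integrable lborel (\<lambda>\<xi>. (g \<xi> - h \<xi>) * \<phi> \<xi>)" if "\<phi> \<in> schwartz_functions" for \<phi>
    using has_fourier_funD(2)[OF g that] has_fourier_funD(2)[OF h that] by (simp add: left_diff_distrib)
  obtain W where W: "W \<in> tempered_distributions" "exp_weight \<gamma> u = restrict W test_functions" "fourier_tempered W = regular_tempered g"
    using g by (auto simp: has_fourier_fun_def)
  obtain V where V: "V \<in> tempered_distributions" "exp_weight \<gamma> w = restrict V test_functions" "fourier_tempered V = regular_tempered h"
    using h by (auto simp: has_fourier_fun_def)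
  define U where "U = (\<lambda>\<phi>\<in>schwartz_functions. W \<phi> - V \<phi>)"
  show "\<exists>U\<in>tempered_distributions. exp_weight \<gamma> (dist_diff u w) = restrict U test_functions \<and> fourier_tempered U = regular_tempered (\<lambda>\<xi>. g \<xi> - h \<xi>)"
  proof (intro bexI conjI)
    show "U \<in> tempered_distributions" unfolding U_def by (rule tempered_diff[OF W(1) V(1)])
    show "exp_weight \<gamma> (dist_diff u w) = restrict U test_functions"
    proof
      fix \<phi>
      show "exp_weight \<gamma> (dist_diff u w) \<phi> = restrict U test_functions \<phi>"
      proof (cases "\<phi> \<in> test_functions")
        case True
        have "exp_weight \<gamma> u \<phi> = W \<phi>" "exp_weight \<gamma> w \<phi> = V \<phi>" unfolding W(2) V(2) using True by simp_all
        then show ?thesis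
          using True test_mult_exp_fst[OF True, of "- \<gamma>"] test_imp_schwartz[OF True]
          by (simp add: exp_weight_eq dist_diff_def U_def)
      qed (simp add: exp_weight_def)
    qed
    show "fourier_tempered U = regular_tempered (\<lambda>\<xi>. g \<xi> - h \<xi>)"
    proof
      fix \<phi>
      show "fourier_tempered U \<phi> = regular_tempered (\<lambda>\<xi>. g \<xi> - h \<xi>) \<phi>"
      proof (cases "\<phi> \<in> schwartz_functions")
        case True
        then have "W (fourier \<phi>) = (\<integral>\<xi>. g \<xi> * \<phi> \<xi> \<partial>lborel)" "V (fourier \<phi>) = (\<integral>\<xi>. h \<xi> * \<phi> \<xi> \<partial>lborel)"
          using fun_cong[OF W(3), of \<phi>] fun_cong[OF V(3), of \<phi>] by (simp_all add: fourier_tempered_def regular_tempered_def)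
        then show ?thesis
          using True schwartz_fourier[OF True] has_fourier_funD(2)[OF g True] has_fourier_funD(2)[OF h True]
          by (simp add: fourier_tempered_def regular_tempered_def U_def left_diff_distrib)
      qed (simp add: fourier_tempered_def regular_tempered_def)
    qed
  qed
qed

section \<open>Weighted norms and distributions with a prescribed transform\<close>

definition freq_weight :: "real \<Rightarrow> real \<times> real \<Rightarrow> real" where
  "freq_weight \<gamma> \<xi> = \<gamma>\<^sup>2 + (fst \<xi>)\<^sup>2 + (snd \<xi>)\<^sup>2"

lemma freq_weight_measurable[measurable]: "freq_weight \<gamma> \<in> borel_measurable borel"
  unfolding freq_weight_def by (intro borel_measurable_continuous_onI continuous_intros)

lemma freq_weight_pos: "\<gamma> \<ge> 1 \<Longrightarrow> freq_weight \<gamma> \<xi> \<ge> 1"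
  by (simp add: freq_weight_def add_increasing2 power_increasing one_le_power)

lemma sobolev_iff:
  "w \<in> sobolev s \<longleftrightarrow> w \<in> distributions \<and> (\<exists>g. has_fourier_fun w g \<and> integrable lborel (\<lambda>\<xi>. freq_weight 1 \<xi> powr s * (norm (g \<xi>))\<^sup>2))"
proof -
  have "(\<lambda>(\<delta>, \<eta>). (1 + \<delta>\<^sup>2 + \<eta>\<^sup>2) powr s * (norm (g (\<delta>, \<eta>)))\<^sup>2) = (\<lambda>\<xi>. freq_weight 1 \<xi> powr s * (norm (g \<xi>))\<^sup>2)" for g :: planefun
    by (auto simp: freq_weight_def)
  then show ?thesis by (simp add: sobolev_def)
qed

lemma sobolev_norm_eq:
  assumes "has_fourier_fun w g"
  shows "(sobolev_norm s \<gamma> w)\<^sup>2 = 1 / (2 * pi)\<^sup>2 * (\<integral>\<xi>. freq_weight \<gamma> \<xi> powr s * (norm (g \<xi>))\<^sup>2 \<partial>lborel)"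
proof -
  have "(\<lambda>(\<delta>, \<eta>). (\<gamma>\<^sup>2 + \<delta>\<^sup>2 + \<eta>\<^sup>2) powr s * (norm (fourier_fun w (\<delta>, \<eta>)))\<^sup>2) = (\<lambda>\<xi>. freq_weight \<gamma> \<xi> powr s * (norm (fourier_fun w \<xi>))\<^sup>2)"
    by (auto simp: freq_weight_def)
  moreover have "(\<integral>\<xi>. freq_weight \<gamma> \<xi> powr s * (norm (fourier_fun w \<xi>))\<^sup>2 \<partial>lborel) = (\<integral>\<xi>. freq_weight \<gamma> \<xi> powr s * (norm (g \<xi>))\<^sup>2 \<partial>lborel)"
  proof (rule integral_cong_AE)
    show "AE \<xi> in lborel. freq_weight \<gamma> \<xi> powr s * (norm (fourier_fun w \<xi>))\<^sup>2 = freq_weight \<gamma> \<xi> powr s * (norm (g \<xi>))\<^sup>2"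
      using fourier_fun_AE[OF assms] by eventually_elim simp
  qed (use has_fourier_funD(1)[OF assms] has_fourier_funD(1)[OF has_fourier_fun_fourier_fun[OF assms]] in simp_all)
  ultimately show ?thesis by (simp add: sobolev_norm_def)
qed

text \<open>The exponent \<open>\<bar>s\<bar>\<close> covers both signs of s, for which powers are
  monotone in opposite directions.\<close>

lemma powr_comparison:
  fixes a b k s :: real
  assumes "0 < a" "a \<le> b" "b \<le> k * a" "1 \<le> k"
  shows "b powr s \<le> k powr \<bar>s\<bar> * a powr s" "a powr s \<le> k powr \<bar>s\<bar> * b powr s"
proof -
  have k: "1 \<le> k powr \<bar>s\<bar>" using assms by (simp add: ge_one_powr_ge_zero)
  have "b powr s \<le> k powr \<bar>s\<bar> * a powr s \<and> a powr s \<le> k powr \<bar>s\<bar> * b powr s"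
  proof (cases "s \<ge> 0")
    case True
    have "b powr s \<le> (k * a) powr s" using assms True by (intro powr_mono2) auto
    moreover have "1 * a powr s \<le> k powr \<bar>s\<bar> * b powr s" using assms True k by (intro mult_mono powr_mono2) auto
    ultimately show ?thesis using True assms by (simp add: powr_mult)
  next
    case False
    have "(k * a) powr s \<le> b powr s" using assms False by (intro powr_mono2') auto
    then have "k powr s * a powr s \<le> b powr s" using assms by (simp add: powr_mult)
    then have "k powr (- s) * (k powr s * a powr s) \<le> k powr (- s) * b powr s" by (intro mult_left_mono) auto
    moreover have "k powr (- s) * (k powr s * a powr s) = a powr s"
      using assms by (simp add: mult.assoc[symmetric] powr_add[symmetric])
    moreover have "1 * b powr s \<le> 1 * a powr s" using assms False by (simp add: powr_mono2')
    moreover have "1 * a powr s \<le> k powr \<bar>s\<bar> * a powr s" using k by (intro mult_right_mono) auto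
    ultimately show ?thesis using False by simp
  qed
  then show "b powr s \<le> k powr \<bar>s\<bar> * a powr s" "a powr s \<le> k powr \<bar>s\<bar> * b powr s" by auto
qed

text \<open>For \<gamma> \<ge> 1 the weights with parameters \<gamma> and 1 differ at most by the
  factor \<gamma>^2. Membership in \<open>Hsg\<close> is phrased with parameter 1 and its norm with
  \<gamma>; this equivalence moves between the two.\<close>

lemma integrable_freq_weight_iff:
  fixes g :: planefun
  assumes [measurable]: "g \<in> borel_measurable borel" and \<gamma>: "\<gamma> \<ge> 1"
  shows "integrable lborel (\<lambda>\<xi>. freq_weight \<gamma> \<xi> powr s * (norm (g \<xi>))\<^sup>2) \<longleftrightarrow> integrable lborel (\<lambda>\<xi>. freq_weight 1 \<xi> powr s * (norm (g \<xi>))\<^sup>2)"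
proof -
  have c: "freq_weight \<gamma> \<xi> powr s \<le> (\<gamma>\<^sup>2) powr \<bar>s\<bar> * freq_weight 1 \<xi> powr s"
    "freq_weight 1 \<xi> powr s \<le> (\<gamma>\<^sup>2) powr \<bar>s\<bar> * freq_weight \<gamma> \<xi> powr s" for \<xi>
  proof -
    have g1: "1 \<le> \<gamma>\<^sup>2" using \<gamma> by (simp add: one_le_power)
    have 1: "0 < freq_weight 1 \<xi>" using freq_weight_pos[of 1 \<xi>] by simp
    have 2: "freq_weight 1 \<xi> \<le> freq_weight \<gamma> \<xi>" using g1 by (simp add: freq_weight_def)
    have "1 * (fst \<xi>)\<^sup>2 \<le> \<gamma>\<^sup>2 * (fst \<xi>)\<^sup>2" "1 * (snd \<xi>)\<^sup>2 \<le> \<gamma>\<^sup>2 * (snd \<xi>)\<^sup>2" using g1 by (intro mult_right_mono; simp)+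
    then have 3: "freq_weight \<gamma> \<xi> \<le> \<gamma>\<^sup>2 * freq_weight 1 \<xi>" by (simp add: freq_weight_def distrib_left)
    show "freq_weight \<gamma> \<xi> powr s \<le> (\<gamma>\<^sup>2) powr \<bar>s\<bar> * freq_weight 1 \<xi> powr s"
      "freq_weight 1 \<xi> powr s \<le> (\<gamma>\<^sup>2) powr \<bar>s\<bar> * freq_weight \<gamma> \<xi> powr s"
      using powr_comparison[OF 1 2 3 g1] by auto
  qed
  have m: "integrable lborel (\<lambda>\<xi>. freq_weight b \<xi> powr s * (norm (g \<xi>))\<^sup>2)"
    if "integrable lborel (\<lambda>\<xi>. freq_weight a \<xi> powr s * (norm (g \<xi>))\<^sup>2)"
      and "\<And>\<xi>. freq_weight b \<xi> powr s \<le> (\<gamma>\<^sup>2) powr \<bar>s\<bar> * freq_weight a \<xi> powr s" for a b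
  proof (rule Bochner_Integration.integrable_bound[OF integrable_mult_right[OF that(1), of "(\<gamma>\<^sup>2) powr \<bar>s\<bar>"]])
    show "AE \<xi> in lborel. norm (freq_weight b \<xi> powr s * (norm (g \<xi>))\<^sup>2) \<le> norm ((\<gamma>\<^sup>2) powr \<bar>s\<bar> * (freq_weight a \<xi> powr s * (norm (g \<xi>))\<^sup>2))"
    proof (rule AE_I2)
      fix \<xi>
      show "norm (freq_weight b \<xi> powr s * (norm (g \<xi>))\<^sup>2) \<le> norm ((\<gamma>\<^sup>2) powr \<bar>s\<bar> * (freq_weight a \<xi> powr s * (norm (g \<xi>))\<^sup>2))"
        using mult_right_mono[OF that(2)[of \<xi>], of "(norm (g \<xi>))\<^sup>2"] by (simp add: abs_mult mult.assoc)
    qed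
  qed simp
  show ?thesis using m[OF _ c(1)] m[OF _ c(2)] by blast
qed

lemma Hsg_integrable:
  assumes "u \<in> Hsg s \<gamma>" "\<gamma> \<ge> 1" "has_fourier_fun (exp_weight \<gamma> u) g"
  shows "integrable lborel (\<lambda>\<xi>. freq_weight \<gamma> \<xi> powr s * (norm (g \<xi>))\<^sup>2)"
proof -
  obtain h where h: "has_fourier_fun (exp_weight \<gamma> u) h" "integrable lborel (\<lambda>\<xi>. freq_weight 1 \<xi> powr s * (norm (h \<xi>))\<^sup>2)"
    using assms(1) by (auto simp: Hsg_def sobolev_iff)
  note m = has_fourier_funD(1)[OF assms(3)] has_fourier_funD(1)[OF h(1)]
  have "integrable lborel (\<lambda>\<xi>. freq_weight 1 \<xi> powr s * (norm (g \<xi>))\<^sup>2)"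
  proof (rule Bochner_Integration.integrable_cong_AE_imp[OF h(2)])
    show "AE \<xi> in lborel. freq_weight 1 \<xi> powr s * (norm (h \<xi>))\<^sup>2 = freq_weight 1 \<xi> powr s * (norm (g \<xi>))\<^sup>2"
      using has_fourier_fun_unique[OF h(1) assms(3)] by eventually_elim simp
  qed (use m in simp)
  then show ?thesis using integrable_freq_weight_iff[OF m(1) assms(2)] by simp
qed

lemma Hsg_has_fourier_fun:
  assumes "u \<in> Hsg s \<gamma>"
  shows "has_fourier_fun (exp_weight \<gamma> u) (fourier_fun (exp_weight \<gamma> u))"
  using assms has_fourier_fun_fourier_fun by (auto simp: Hsg_def sobolev_iff)

text \<open>The inequality 2 x y \<le> x^2 + y^2, with x = \<omega>^(s/2) |g| and y =
  \<omega>^(-s/2) / (1 + |\<xi>|)^M, takes the place of Hoelder's inequality. The resulting bound is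
  not homogeneous in \<open>g\<close>, but it is linear in \<open>B\<close>, as continuity of the
  pairing requires.\<close>

lemma weighted_L2_pairing:
  fixes g h :: planefun
  assumes [measurable]: "g \<in> borel_measurable borel" "h \<in> borel_measurable borel"
    and i: "integrable lborel (\<lambda>\<xi>. freq_weight 1 \<xi> powr s * (norm (g \<xi>))\<^sup>2)"
    and M: "M = nat \<lceil>\<bar>s\<bar>\<rceil> + 2" and h: "\<And>\<xi>. norm (h \<xi>) \<le> B / (1 + norm \<xi>) ^ M"
  shows "integrable lborel (\<lambda>\<xi>. g \<xi> * h \<xi>)"
    "norm (\<integral>\<xi>. g \<xi> * h \<xi> \<partial>lborel) \<le> B * ((\<integral>\<xi>. freq_weight 1 \<xi> powr s * (norm (g \<xi>))\<^sup>2 + plane_weight \<xi> \<partial>lborel) / 2)"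
proof -
  have B0: "0 \<le> B" using order_trans[OF norm_ge_zero h[of 0]] by simp
  let ?k = "\<lambda>\<xi>. freq_weight 1 \<xi> powr s * (norm (g \<xi>))\<^sup>2 + plane_weight \<xi>"
  have ki: "integrable lborel ?k" using i integrable_plane_weight by simp
  have le: "norm (g \<xi> * h \<xi>) \<le> B * (?k \<xi> / 2)" for \<xi>
  proof -
    define r where "r = 1 + norm \<xi>"
    define \<omega> where "\<omega> = freq_weight 1 \<xi>"
    have r: "r \<ge> 1" by (simp add: r_def)
    have \<omega>1: "\<omega> \<ge> 1" by (simp add: \<omega>_def freq_weight_pos)
    have \<omega>r: "\<omega> \<le> r\<^sup>2"
    proof -
      have "(norm \<xi>)\<^sup>2 = (fst \<xi>)\<^sup>2 + (snd \<xi>)\<^sup>2" by (cases \<xi>) (simp add: norm_Pair)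
      then show ?thesis by (simp add: \<omega>_def freq_weight_def r_def power2_sum)
    qed
    \<comment> \<open>\<open>M\<close> exceeds |s| by at least 2: after \<omega>^|s| has been
      absorbed, four powers of r are left for \<open>plane_weight\<close>.\<close>
    have "\<omega> powr (- s) \<le> \<omega> powr \<bar>s\<bar>" using \<omega>1 by (intro powr_mono) auto
    also have "\<dots> \<le> (r\<^sup>2) powr \<bar>s\<bar>" using \<omega>r \<omega>1 by (intro powr_mono2) auto
    also have "\<dots> \<le> (r\<^sup>2) powr real (M - 2)" using r unfolding M by (intro powr_mono) (auto simp: one_le_power)
    also have "\<dots> = (r\<^sup>2) ^ (M - 2)" using r by (intro powr_realpow) simp
    finally have \<omega>s: "\<omega> powr (- s) \<le> (r\<^sup>2) ^ (M - 2)" .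
    have rM: "(r ^ M)\<^sup>2 = (r\<^sup>2) ^ (M - 2) * r ^ 4"
    proof -
      have e: "M * 2 = 2 * (M - 2) + 4" by (simp add: M)
      show ?thesis unfolding power_mult[symmetric] power_add[symmetric] e ..
    qed
    have "\<omega> powr (- s) / (r ^ M)\<^sup>2 \<le> (r\<^sup>2) ^ (M - 2) / (r ^ M)\<^sup>2"
      using \<omega>s by (intro divide_right_mono) auto
    also have "\<dots> = 1 / r ^ 4" unfolding rM using r by simp
    also have "\<dots> \<le> plane_weight \<xi>" unfolding r_def by (rule decay_le_plane_weight)
    finally have y2: "\<omega> powr (- s) / (r ^ M)\<^sup>2 \<le> plane_weight \<xi>" .
    have "2 * (\<omega> powr (s / 2) * norm (g \<xi>)) * (\<omega> powr (- s / 2) / r ^ M) \<le> (\<omega> powr (s / 2) * norm (g \<xi>))\<^sup>2 + (\<omega> powr (- s / 2) / r ^ M)\<^sup>2"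
      by (rule sum_squares_bound)
    also have "(\<omega> powr (s / 2) * norm (g \<xi>))\<^sup>2 = \<omega> powr s * (norm (g \<xi>))\<^sup>2"
      by (simp add: power_mult_distrib power2_eq_square[of "\<omega> powr _"] powr_add[symmetric])
    also have "(\<omega> powr (- s / 2) / r ^ M)\<^sup>2 = \<omega> powr (- s) / (r ^ M)\<^sup>2"
      by (simp add: power_divide power2_eq_square[of "\<omega> powr _"] powr_add[symmetric])
    also have "2 * (\<omega> powr (s / 2) * norm (g \<xi>)) * (\<omega> powr (- s / 2) / r ^ M) = 2 * (norm (g \<xi>) / r ^ M) * (\<omega> powr (s / 2) * \<omega> powr (- s / 2))"
      by simp
    also have "\<omega> powr (s / 2) * \<omega> powr (- s / 2) = 1" using \<omega>1 by (simp add: powr_add[symmetric])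
    finally have "2 * (norm (g \<xi>) / r ^ M) * 1 \<le> ?k \<xi>" using y2 unfolding \<omega>_def by linarith
    from divide_right_mono[OF this, of 2] have "norm (g \<xi>) / r ^ M \<le> ?k \<xi> / 2"
      by (simp only: mult_1_right nonzero_mult_div_cancel_left zero_neq_numeral[symmetric] not_False_eq_True zero_le_numeral)
    then have *: "B * (norm (g \<xi>) / r ^ M) \<le> B * (?k \<xi> / 2)" using B0 by (rule mult_left_mono)
    have "norm (g \<xi> * h \<xi>) = norm (g \<xi>) * norm (h \<xi>)" by (rule norm_mult)
    also have "\<dots> \<le> norm (g \<xi>) * (B / r ^ M)"
      unfolding r_def by (rule mult_left_mono[OF h norm_ge_zero])
    also have "\<dots> = B * (norm (g \<xi>) / r ^ M)" by simp
    also note *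
    finally show ?thesis .
  qed
  have ki2: "integrable lborel (\<lambda>\<xi>. B * (?k \<xi> / 2))" using ki by simp
  show ig: "integrable lborel (\<lambda>\<xi>. g \<xi> * h \<xi>)"
    by (rule Bochner_Integration.integrable_bound[OF ki2]) (use le in \<open>auto intro!: AE_I2 order_trans[OF _ abs_ge_self] simp del: norm_mult\<close>)
  have "norm (\<integral>\<xi>. g \<xi> * h \<xi> \<partial>lborel) \<le> (\<integral>\<xi>. norm (g \<xi> * h \<xi>) \<partial>lborel)" by (rule integral_norm_bound)
  also have "\<dots> \<le> (\<integral>\<xi>. B * (?k \<xi> / 2) \<partial>lborel)" by (intro integral_mono integrable_norm ig ki2 le)
  also have "\<dots> = B * ((\<integral>\<xi>. ?k \<xi> \<partial>lborel) / 2)" by simp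
  finally show "norm (\<integral>\<xi>. g \<xi> * h \<xi> \<partial>lborel) \<le> B * ((\<integral>\<xi>. ?k \<xi> \<partial>lborel) / 2)" .
qed

lemma inverse_fourier_le_seminorm:
  assumes \<phi>: "\<phi> \<in> schwartz_functions"
  shows "norm (inverse_fourier \<phi> \<xi>) \<le> (1 / (2 * pi)\<^sup>2 * 3 ^ N * plane_const) * schwartz_seminorm (N + 4) \<phi> / (1 + norm \<xi>) ^ N"
proof -
  have "norm (inverse_fourier \<phi> \<xi>) = 1 / (2 * pi)\<^sup>2 * norm (fourier \<phi> (- \<xi>))"
    unfolding inverse_fourier_def norm_mult by (simp add: norm_divide norm_mult norm_power)
  also have "\<dots> \<le> 1 / (2 * pi)\<^sup>2 * (3 ^ N * (schwartz_seminorm (N + 4) \<phi> * plane_const) / (1 + norm (- \<xi>)) ^ N)"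
    by (intro mult_left_mono fourier_le_seminorm \<phi>) simp
  also have "\<dots> = (1 / (2 * pi)\<^sup>2 * 3 ^ N * plane_const) * schwartz_seminorm (N + 4) \<phi> / (1 + norm \<xi>) ^ N" by simp
  finally show ?thesis .
qed

lemma inverse_fourier_lincomb:
  assumes "\<phi> \<in> schwartz_functions" "\<psi> \<in> schwartz_functions"
  shows "inverse_fourier (\<lambda>p. a * \<phi> p + b * \<psi> p) \<xi> = a * inverse_fourier \<phi> \<xi> + b * inverse_fourier \<psi> \<xi>"
proof -
  note i = integrable_fourier_kernel[OF schwartz_integrable[OF assms(1)], of "- \<xi>"]
    integrable_fourier_kernel[OF schwartz_integrable[OF assms(2)], of "- \<xi>"]
  have eq: "z * (a * x + b * y) = a * (z * x) + b * (z * y)" for x y z :: complex by (simp add: algebra_simps)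
  have "fourier (\<lambda>p. a * \<phi> p + b * \<psi> p) (- \<xi>) = (\<integral>p. a * (cis (- (- \<xi> \<bullet> p)) * \<phi> p) + b * (cis (- (- \<xi> \<bullet> p)) * \<psi> p) \<partial>lborel)"
    unfolding fourier_def eq ..
  also have "\<dots> = a * fourier \<phi> (- \<xi>) + b * fourier \<psi> (- \<xi>)"
    unfolding fourier_def using i by (subst Bochner_Integration.integral_add) auto
  finally show ?thesis by (simp add: inverse_fourier_def add_divide_distrib)
qed

text \<open>The inverse transform of \<open>g\<close> is defined by duality, as \<phi> \<mapsto>
  \<integral> g \<cdot> \<open>inverse_fourier \<phi>\<close>. \<open>weighted_L2_pairing\<close>
  and the decay of \<open>inverse_fourier \<phi>\<close> in terms of a Schwartz seminorm make it
  tempered; multiplying by the exponential undoes \<open>exp_weight\<close>.\<close>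

lemma Hsg_exists:
  fixes g :: planefun
  assumes g: "g \<in> borel_measurable borel" and i: "integrable lborel (\<lambda>\<xi>. freq_weight 1 \<xi> powr s * (norm (g \<xi>))\<^sup>2)"
  shows "\<exists>f\<in>Hsg s \<gamma>. has_fourier_fun (exp_weight \<gamma> f) g"
proof -
  define M where "M = nat \<lceil>\<bar>s\<bar>\<rceil> + 2"
  define K where "K = (\<integral>\<xi>. freq_weight 1 \<xi> powr s * (norm (g \<xi>))\<^sup>2 + plane_weight \<xi> \<partial>lborel) / 2"
  define W where "W = (\<lambda>\<phi>\<in>schwartz_functions. \<integral>\<xi>. g \<xi> * inverse_fourier \<phi> \<xi> \<partial>lborel)"
  have pair: "integrable lborel (\<lambda>\<xi>. g \<xi> * \<phi> \<xi>)" if \<phi>: "\<phi> \<in> schwartz_functions" for \<phi>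
  proof -
    obtain B where "derivs_le 0 \<phi> (\<lambda>p. B / (1 + norm p) ^ M)" using schwartz_derivs_le_ex[OF \<phi>] by blast
    then show ?thesis by (intro weighted_L2_pairing(1)[OF g schwartz_measurable[OF \<phi>] i M_def]) auto
  qed
  have WT: "W \<in> tempered_distributions"
    unfolding tempered_distributions_def
  proof (intro CollectI conjI)
    show "linear_functional_on schwartz_functions W"
      unfolding linear_functional_on_def
    proof (intro ballI allI)
      fix \<phi> \<psi> a b assume t: "\<phi> \<in> schwartz_functions" "\<psi> \<in> schwartz_functions"
      note p = pair[OF schwartz_inverse_fourier[OF t(1)]] pair[OF schwartz_inverse_fourier[OF t(2)]]
      have eq: "z * (a * x + b * y) = a * (z * x) + b * (z * y)" for x y z :: complex by (simp add: algebra_simps)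
      have "(\<integral>\<xi>. g \<xi> * inverse_fourier (\<lambda>p. a * \<phi> p + b * \<psi> p) \<xi> \<partial>lborel) = (\<integral>\<xi>. a * (g \<xi> * inverse_fourier \<phi> \<xi>) + b * (g \<xi> * inverse_fourier \<psi> \<xi>) \<partial>lborel)"
        unfolding inverse_fourier_lincomb[OF t] eq ..
      also have "\<dots> = a * (\<integral>\<xi>. g \<xi> * inverse_fourier \<phi> \<xi> \<partial>lborel) + b * (\<integral>\<xi>. g \<xi> * inverse_fourier \<psi> \<xi> \<partial>lborel)"
        using p by (subst Bochner_Integration.integral_add) auto
      finally show "W (\<lambda>p. a * \<phi> p + b * \<psi> p) = a * W \<phi> + b * W \<psi>"
        using t schwartz_add[OF schwartz_cmult[OF t(1)] schwartz_cmult[OF t(2)], of a b] by (simp add: W_def)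
    qed
    show "\<exists>N B. \<forall>\<phi>\<in>schwartz_functions. norm (W \<phi>) \<le> B * schwartz_seminorm N \<phi>"
    proof (intro exI ballI)
      fix \<phi> assume \<phi>: "\<phi> \<in> schwartz_functions"
      have "norm (W \<phi>) \<le> (1 / (2 * pi)\<^sup>2 * 3 ^ M * plane_const) * schwartz_seminorm (M + 4) \<phi> * K"
        unfolding K_def W_def using \<phi>
        by (simp only: restrict_apply if_True) (rule weighted_L2_pairing(2)[OF g schwartz_measurable[OF schwartz_inverse_fourier[OF \<phi>]] i M_def inverse_fourier_le_seminorm[OF \<phi>]])
      then show "norm (W \<phi>) \<le> (1 / (2 * pi)\<^sup>2 * 3 ^ M * plane_const * K) * schwartz_seminorm (M + 4) \<phi>" by (simp only: mult_ac)
    qed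
  qed (simp add: W_def)
  have "has_fourier_fun (restrict W test_functions) g"
    unfolding has_fourier_fun_def
  proof (intro conjI ballI bexI[OF _ WT] g pair refl)
    show "fourier_tempered W = regular_tempered g"
      unfolding fourier_tempered_def regular_tempered_def
      by (rule restrict_ext) (simp add: W_def schwartz_fourier inverse_fourier_fourier)
  qed
  then have F: "has_fourier_fun (exp_weight \<gamma> (\<lambda>\<phi>\<in>test_functions. W (\<lambda>p. exp_fst \<gamma> p * \<phi> p))) g"
    by (simp add: tempered_exp_weight)
  moreover have "(\<lambda>\<phi>\<in>test_functions. W (\<lambda>p. exp_fst \<gamma> p * \<phi> p)) \<in> Hsg s \<gamma>"
    unfolding Hsg_def sobolev_iff using tempered_exp_distribution[OF WT] tempered_restrict_distribution[OF WT] F i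
    by (auto simp: tempered_exp_weight)
  ultimately show ?thesis by blast
qed

lemma Hsg_unique:
  assumes "f \<in> Hsg s \<gamma>" "f' \<in> Hsg s' \<gamma>" "has_fourier_fun (exp_weight \<gamma> f) g" "has_fourier_fun (exp_weight \<gamma> f') g'"
    and ae: "AE \<xi> in lborel. g \<xi> = g' \<xi>"
  shows "f = f'"
proof (rule exp_weight_inject)
  show "f \<in> distributions" "f' \<in> distributions" using assms by (auto simp: Hsg_def)
  have "has_fourier_fun (exp_weight \<gamma> f) g'"
    by (rule has_fourier_fun_cong_AE[OF assms(3) has_fourier_funD(1)[OF assms(4)] ae])
  then show "exp_weight \<gamma> f = exp_weight \<gamma> f'" using has_fourier_fun_eq assms(4) by metis
qed

section \<open>Tangential transforms\<close>

lemma nn_integral_freq_weight: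
  fixes g :: planefun
  assumes "integrable lborel (\<lambda>\<xi>. freq_weight \<gamma> \<xi> powr s * (norm (g \<xi>))\<^sup>2)"
    and "(sobolev_norm s \<gamma> w)\<^sup>2 = 1 / (2 * pi)\<^sup>2 * (\<integral>\<xi>. freq_weight \<gamma> \<xi> powr s * (norm (g \<xi>))\<^sup>2 \<partial>lborel)"
  shows "(\<integral>\<^sup>+\<xi>. ennreal (freq_weight \<gamma> \<xi> powr s * (norm (g \<xi>))\<^sup>2) \<partial>lborel) = ennreal ((2 * pi)\<^sup>2 * (sobolev_norm s \<gamma> w)\<^sup>2)"
  using assms by (subst nn_integral_eq_integral) (auto simp: field_simps)

lemma Hsg_nn_integral:
  assumes "u \<in> Hsg s \<gamma>" "\<gamma> \<ge> 1" "has_fourier_fun (exp_weight \<gamma> u) g"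
  shows "(\<integral>\<^sup>+\<xi>. ennreal (freq_weight \<gamma> \<xi> powr s * (norm (g \<xi>))\<^sup>2) \<partial>lborel) = ennreal ((2 * pi)\<^sup>2 * (Hsg_norm s \<gamma> u)\<^sup>2)"
  unfolding Hsg_norm_def by (intro nn_integral_freq_weight Hsg_integrable[OF assms] sobolev_norm_eq assms(3))

lemma norm_diff_squared_le: "(norm (a - b))\<^sup>2 \<le> 2 * (norm (a - c))\<^sup>2 + 2 * (norm (c - b))\<^sup>2"
  for a b c :: "'a::real_normed_vector"
proof -
  have "norm (a - b) \<le> norm (a - c) + norm (c - b)" using norm_triangle_ineq[of "a - c" "c - b"] by simp
  then have "(norm (a - b))\<^sup>2 \<le> (norm (a - c) + norm (c - b))\<^sup>2" by (intro power_mono) auto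
  also have "\<dots> \<le> 2 * (norm (a - c))\<^sup>2 + 2 * (norm (c - b))\<^sup>2"
    using sum_squares_bound[of "norm (a - c)" "norm (c - b)"] by (simp add: power2_sum)
  finally show ?thesis .
qed

text \<open>The distance in the Bochner condition is a weighted L2 distance of transforms. The
  extended integral suits the measurability and summability arguments that follow.\<close>

lemma Hsg_diff_nn_integral:
  assumes u: "u \<in> Hsg s \<gamma>" and w: "w \<in> Hsg s \<gamma>" and \<gamma>: "\<gamma> \<ge> 1"
    and g: "has_fourier_fun (exp_weight \<gamma> u) g" and h: "has_fourier_fun (exp_weight \<gamma> w) h"
  shows "(\<integral>\<^sup>+\<xi>. ennreal (freq_weight \<gamma> \<xi> powr s * (norm (g \<xi> - h \<xi>))\<^sup>2) \<partial>lborel) = ennreal ((2 * pi)\<^sup>2 * (Hsg_norm s \<gamma> (dist_diff u w))\<^sup>2)"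
  unfolding Hsg_norm_def
proof (intro nn_integral_freq_weight sobolev_norm_eq has_fourier_fun_diff g h)
  note m[measurable] = has_fourier_funD(1)[OF g] has_fourier_funD(1)[OF h]
  have i: "integrable lborel (\<lambda>\<xi>. 2 * (freq_weight \<gamma> \<xi> powr s * (norm (g \<xi>))\<^sup>2) + 2 * (freq_weight \<gamma> \<xi> powr s * (norm (h \<xi>))\<^sup>2))"
    by (intro Bochner_Integration.integrable_add integrable_mult_right Hsg_integrable[OF u \<gamma> g] Hsg_integrable[OF w \<gamma> h])
  show "integrable lborel (\<lambda>\<xi>. freq_weight \<gamma> \<xi> powr s * (norm (g \<xi> - h \<xi>))\<^sup>2)"
  proof (rule Bochner_Integration.integrable_bound[OF i])
    show "AE \<xi> in lborel. norm (freq_weight \<gamma> \<xi> powr s * (norm (g \<xi> - h \<xi>))\<^sup>2) \<le>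
       norm (2 * (freq_weight \<gamma> \<xi> powr s * (norm (g \<xi>))\<^sup>2) + 2 * (freq_weight \<gamma> \<xi> powr s * (norm (h \<xi>))\<^sup>2))"
    proof (rule AE_I2)
      fix \<xi>
      have "freq_weight \<gamma> \<xi> powr s * (norm (g \<xi> - h \<xi>))\<^sup>2 \<le> freq_weight \<gamma> \<xi> powr s * (2 * (norm (g \<xi>))\<^sup>2 + 2 * (norm (h \<xi>))\<^sup>2)"
        using norm_diff_squared_le[of "g \<xi>" "h \<xi>" 0] by (intro mult_left_mono) auto
      then show "norm (freq_weight \<gamma> \<xi> powr s * (norm (g \<xi> - h \<xi>))\<^sup>2) \<le>
         norm (2 * (freq_weight \<gamma> \<xi> powr s * (norm (g \<xi>))\<^sup>2) + 2 * (freq_weight \<gamma> \<xi> powr s * (norm (h \<xi>))\<^sup>2))"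
        by (simp add: algebra_simps)
    qed
  qed measurable
qed

text \<open>Level sets in the Bochner condition are only Lebesgue measurable. Replacing them by
  Borel sets, off a null set, makes the transforms of the simple functions jointly Borel
  measurable.\<close>

lemma lebesgue_set_AE_borel:
  assumes "A \<in> sets (lebesgue :: real measure)"
  shows "\<exists>B\<in>sets borel. AE y in lborel. y \<in> B \<longleftrightarrow> y \<in> A"
proof -
  obtain S N N' where A: "A = S \<union> N" "N \<subseteq> N'" "N' \<in> null_sets lborel" "S \<in> sets lborel"
    using assms by (rule sets_completionE)
  have "AE y in lborel. y \<notin> N'" using A(3) by (rule AE_not_in)
  then have "AE y in lborel. y \<in> S \<longleftrightarrow> y \<in> A" by eventually_elim (use A in auto)
  then show ?thesis using A(4) by auto
qed

text \<open>The series of integrals converges, so the sum of the functions has a finite integral and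
  is finite almost everywhere. It is applied first in y and then in \<xi>.\<close>

lemma AE_summable_of_nn_integrals:
  fixes f :: "nat \<Rightarrow> 'a \<Rightarrow> real"
  assumes [measurable]: "\<And>k. f k \<in> borel_measurable M" and nn: "\<And>k x. 0 \<le> f k x"
    and b: "\<And>k. (\<integral>\<^sup>+x. ennreal (f k x) \<partial>M) \<le> ennreal (a k)" and a: "summable a" "\<And>k. 0 \<le> a k"
  shows "AE x in M. summable (\<lambda>k. f k x)"
proof -
  have "(\<integral>\<^sup>+x. (\<Sum>k. ennreal (f k x)) \<partial>M) = (\<Sum>k. \<integral>\<^sup>+x. ennreal (f k x) \<partial>M)"
    by (rule nn_integral_suminf) simp
  also have "\<dots> \<le> (\<Sum>k. ennreal (a k))" by (intro suminf_le b) auto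
  also have "\<dots> = ennreal (\<Sum>k. a k)" using a by (intro suminf_ennreal2) auto
  finally have "(\<integral>\<^sup>+x. (\<Sum>k. ennreal (f k x)) \<partial>M) \<noteq> \<infinity>" by (auto simp: top_unique)
  then have "AE x in M. (\<Sum>k. ennreal (f k x)) \<noteq> \<infinity>" by (intro nn_integral_PInf_AE) auto
  then show ?thesis by eventually_elim (use nn in \<open>auto intro: summable_suminf_not_top\<close>)
qed

text \<open>The approximating simple functions have jointly measurable transforms. Their mutual distances
  are measurable in \<open>y\<close>, unlike a priori their distances to \<open>F\<close>, and control a subsequence that
  converges almost everywhere.\<close>
lemma joint_measurable_limit:
  fixes G :: "nat \<Rightarrow> (real \<times> real) \<Rightarrow> real \<Rightarrow> complex" and H :: "real \<Rightarrow> planefun" and \<omega> :: "real \<times> real \<Rightarrow> real"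
  assumes Gm: "\<And>n. case_prod (G n) \<in> borel_measurable borel" and \<omega>m: "\<omega> \<in> borel_measurable borel" and \<omega>: "\<And>\<xi>. \<omega> \<xi> > 0"
    and conv: "AE y in lborel. y > 0 \<longrightarrow> H y \<in> borel_measurable borel \<and>
       (\<lambda>n. \<integral>\<^sup>+\<xi>. ennreal (\<omega> \<xi> * (norm (G n \<xi> y - H y \<xi>))\<^sup>2) \<partial>lborel) \<longlonglongrightarrow> 0"
  shows "\<exists>L. case_prod L \<in> borel_measurable borel \<and> (AE y in lborel. y > 0 \<longrightarrow> (AE \<xi> in lborel. H y \<xi> = L \<xi> y))"
proof -
  have Gm': "(\<lambda>(y, \<xi>). G n \<xi> y) \<in> borel_measurable (lborel \<Otimes>\<^sub>M lborel)" for n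
  proof -
    have "(\<lambda>z. (snd z, fst z)) \<in> borel_measurable (borel :: (real \<times> real \<times> real) measure)"
      by (intro borel_measurable_continuous_onI continuous_intros)
    from measurable_compose[OF this Gm[of n]] show ?thesis
      by (simp add: lborel_prod case_prod_beta')
  qed
  have Gs[measurable]: "(\<lambda>\<xi>. G n \<xi> y) \<in> borel_measurable borel" for n y
    using measurable_compose[OF measurable_Pair1' Gm'[of n], of y] by simp
  note \<omega>m[measurable]
  define q where "q n m y = (\<integral>\<^sup>+\<xi>. ennreal (\<omega> \<xi> * (norm (G n \<xi> y - G m \<xi> y))\<^sup>2) \<partial>lborel)" for n m y
  define d where "d n y = (SUP m\<in>{n..}. q n m y)" for n y
  define D where "D n y = (\<integral>\<^sup>+\<xi>. ennreal (\<omega> \<xi> * (norm (G n \<xi> y - H y \<xi>))\<^sup>2) \<partial>lborel)" for n y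
  have q_meas[measurable]: "q n m \<in> borel_measurable lborel" for n m
    unfolding q_def
  proof (rule lborel.borel_measurable_nn_integral)
    note [measurable] = Gm'[of n] Gm'[of m]
    have "(\<lambda>z. ennreal (\<omega> (snd z) * (norm ((\<lambda>(y, \<xi>). G n \<xi> y) z - (\<lambda>(y, \<xi>). G m \<xi> y) z))\<^sup>2)) \<in> borel_measurable (lborel \<Otimes>\<^sub>M lborel)"
      by measurable
    then show "(\<lambda>(y, \<xi>). ennreal (\<omega> \<xi> * (norm (G n \<xi> y - G m \<xi> y))\<^sup>2)) \<in> borel_measurable (lborel \<Otimes>\<^sub>M lborel)"
      by (simp add: case_prod_beta')
  qed
  have d_meas[measurable]: "d n \<in> borel_measurable lborel" for n
    unfolding d_def by (intro borel_measurable_SUP) auto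
  have tri: "(\<integral>\<^sup>+\<xi>. ennreal (\<omega> \<xi> * (norm (a \<xi> - b \<xi>))\<^sup>2) \<partial>lborel) \<le>
      2 * (\<integral>\<^sup>+\<xi>. ennreal (\<omega> \<xi> * (norm (a \<xi> - c \<xi>))\<^sup>2) \<partial>lborel) + 2 * (\<integral>\<^sup>+\<xi>. ennreal (\<omega> \<xi> * (norm (c \<xi> - b \<xi>))\<^sup>2) \<partial>lborel)"
    if [measurable]: "a \<in> borel_measurable borel" "b \<in> borel_measurable borel" "c \<in> borel_measurable borel" for a b c :: planefun
  proof -
    have "ennreal (\<omega> \<xi> * (norm (a \<xi> - b \<xi>))\<^sup>2) \<le> 2 * ennreal (\<omega> \<xi> * (norm (a \<xi> - c \<xi>))\<^sup>2) + 2 * ennreal (\<omega> \<xi> * (norm (c \<xi> - b \<xi>))\<^sup>2)" for \<xi>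
    proof -
      have "\<omega> \<xi> * (norm (a \<xi> - b \<xi>))\<^sup>2 \<le> \<omega> \<xi> * (2 * (norm (a \<xi> - c \<xi>))\<^sup>2 + 2 * (norm (c \<xi> - b \<xi>))\<^sup>2)"
        by (rule mult_left_mono[OF norm_diff_squared_le less_imp_le[OF \<omega>]])
      also have "\<dots> = 2 * (\<omega> \<xi> * (norm (a \<xi> - c \<xi>))\<^sup>2) + 2 * (\<omega> \<xi> * (norm (c \<xi> - b \<xi>))\<^sup>2)" by (simp add: algebra_simps)
      finally have "ennreal (\<omega> \<xi> * (norm (a \<xi> - b \<xi>))\<^sup>2) \<le> ennreal (2 * (\<omega> \<xi> * (norm (a \<xi> - c \<xi>))\<^sup>2) + 2 * (\<omega> \<xi> * (norm (c \<xi> - b \<xi>))\<^sup>2))"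
        by (rule ennreal_leI)
      then show ?thesis using less_imp_le[OF \<omega>[of \<xi>]] by (simp add: ennreal_plus ennreal_mult' flip: ennreal_numeral)
    qed
    then have "(\<integral>\<^sup>+\<xi>. ennreal (\<omega> \<xi> * (norm (a \<xi> - b \<xi>))\<^sup>2) \<partial>lborel) \<le>
      (\<integral>\<^sup>+\<xi>. 2 * ennreal (\<omega> \<xi> * (norm (a \<xi> - c \<xi>))\<^sup>2) + 2 * ennreal (\<omega> \<xi> * (norm (c \<xi> - b \<xi>))\<^sup>2) \<partial>lborel)"
      by (intro nn_integral_mono)
    also have "\<dots> = 2 * (\<integral>\<^sup>+\<xi>. ennreal (\<omega> \<xi> * (norm (a \<xi> - c \<xi>))\<^sup>2) \<partial>lborel) + 2 * (\<integral>\<^sup>+\<xi>. ennreal (\<omega> \<xi> * (norm (c \<xi> - b \<xi>))\<^sup>2) \<partial>lborel)"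
      by (simp add: nn_integral_add nn_integral_cmult)
    finally show ?thesis .
  qed
  have two_lim: "(\<lambda>m. c + 2 * f m) \<longlonglongrightarrow> c" if "f \<longlonglongrightarrow> 0" for f :: "nat \<Rightarrow> ennreal" and c
  proof -
    have "(\<lambda>m. 2 * f m) \<longlonglongrightarrow> 2 * 0" using that by (intro ennreal_tendsto_cmult) auto
    then have "(\<lambda>m. c + 2 * f m) \<longlonglongrightarrow> c + 2 * 0" by (intro tendsto_add tendsto_const)
    then show ?thesis by simp
  qed
  have good: "AE y in lborel. y > 0 \<longrightarrow> (H y \<in> borel_measurable borel \<and> (\<lambda>n. d n y) \<longlonglongrightarrow> 0 \<and> (\<forall>n. D n y \<le> 2 * d n y))"
    using conv
  proof eventually_elim
    case (elim y)
    show ?case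
    proof (intro impI conjI allI)
      assume y: "y > 0"
      show Hm[measurable]: "H y \<in> borel_measurable borel" using elim y by blast
      have D0: "(\<lambda>n. D n y) \<longlonglongrightarrow> 0" using elim y unfolding D_def by blast
      have sym: "(\<integral>\<^sup>+\<xi>. ennreal (\<omega> \<xi> * (norm (H y \<xi> - G m \<xi> y))\<^sup>2) \<partial>lborel) = D m y" for m
        unfolding D_def by (simp add: norm_minus_commute)
      \<comment> \<open>\<open>d n y\<close> is a supremum over all m \<ge> n. The tail suprema
        \<open>T\<close> of \<open>D\<close> still tend to 0 and bound it through the triangle
        inequality at \<open>H y\<close>.\<close>
      define T where "T n = (SUP m\<in>{n..}. D m y)" for n
      have T0: "T \<longlonglongrightarrow> 0"
      proof -
        have "decseq T" unfolding decseq_def T_def by (auto intro!: SUP_subset_mono)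
        then have "T \<longlonglongrightarrow> (INF n. T n)" by (rule LIMSEQ_INF)
        moreover have "(INF n. T n) = 0"
          using lim_imp_Limsup[OF _ D0] by (simp add: T_def limsup_INF_SUP)
        ultimately show ?thesis by simp
      qed
      have T: "D m y \<le> T n" if "n \<le> m" for m n unfolding T_def using that by (intro SUP_upper) auto
      have up: "d n y \<le> 2 * T n + 2 * T n" for n
        unfolding d_def
      proof (rule SUP_least)
        fix m assume m: "m \<in> {n..}"
        have "q n m y \<le> 2 * D n y + 2 * D m y"
          using tri[OF Gs[of n y] Gs[of m y] Hm] unfolding q_def sym D_def[symmetric] .
        also have "\<dots> \<le> 2 * T n + 2 * T n" using m by (intro add_mono mult_left_mono T) auto
        finally show "q n m y \<le> 2 * T n + 2 * T n" .
      qed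
      have "(\<lambda>n. 2 * T n) \<longlonglongrightarrow> 2 * 0" using T0 by (intro ennreal_tendsto_cmult) auto
      from tendsto_add[OF this this] have lim: "(\<lambda>n. 2 * T n + 2 * T n) \<longlonglongrightarrow> 0" by simp
      show "(\<lambda>n. d n y) \<longlonglongrightarrow> 0"
        by (rule tendsto_sandwich[OF _ _ tendsto_const lim]) (use up in auto)
      fix n
      \<comment> \<open>Going through \<open>G m\<close> with m \<ge> n costs
        \<open>2 * D m y\<close>, which vanishes as m grows.\<close>
      show "D n y \<le> 2 * d n y"
      proof (rule LIMSEQ_le_const[OF two_lim[OF D0]])
        have "D n y \<le> 2 * d n y + 2 * D m y" if "n \<le> m" for m
        proof -
          have "D n y \<le> 2 * q n m y + 2 * D m y"
            using tri[OF Gs[of n y] Hm Gs[of m y]] unfolding q_def D_def .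
          moreover have "q n m y \<le> d n y" unfolding d_def using that by (intro SUP_upper) auto
          then have "2 * q n m y + 2 * D m y \<le> 2 * d n y + 2 * D m y" by (intro add_right_mono mult_left_mono) auto
          ultimately show ?thesis by (rule order_trans)
        qed
        then show "\<exists>N. \<forall>m\<ge>N. D n y \<le> 2 * d n y + 2 * D m y" by blast
      qed
    qed
  qed
  \<comment> \<open>An integrable weight that is positive exactly on the half line. Together with
    the truncation of \<open>d\<close> at 1 in \<open>e\<close> it provides an integrable majorant,
    although \<open>d\<close> may take the value infinity.\<close>
  define v :: "real \<Rightarrow> real" where "v y = indicator {0<..} y * inverse (1 + y\<^sup>2)" for y
  have v0: "0 \<le> v y" for y by (simp add: v_def)
  have v_meas[measurable]: "v \<in> borel_measurable borel" unfolding v_def by measurable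
  have v_int: "(\<integral>\<^sup>+y. ennreal (v y) \<partial>lborel) < \<infinity>"
  proof -
    have "integrable lborel v"
      by (rule Bochner_Integration.integrable_bound[OF integrable_inverse_square]) (auto simp: v_def indicator_def)
    then show ?thesis using v0 by (simp add: nn_integral_eq_integral less_top[symmetric])
  qed
  define e where "e n y = enn2real (min 1 (d n y))" for n y
  have e_eq: "ennreal (e n y) = min 1 (d n y)" for n y
    unfolding e_def by (intro ennreal_enn2real) (auto simp: less_top[symmetric] min_def)
  have e0: "0 \<le> e n y" for n y by (simp add: e_def)
  have e_meas[measurable]: "e n \<in> borel_measurable lborel" for n unfolding e_def by measurable
  have J: "(\<lambda>n. \<integral>\<^sup>+y. ennreal (e n y * v y) \<partial>lborel) \<longlonglongrightarrow> (\<integral>\<^sup>+(y::real). 0 \<partial>lborel)"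
  proof (rule nn_integral_dominated_convergence[where w = "\<lambda>y. ennreal (v y)"])
    show "AE y in lborel. ennreal (e n y * v y) \<le> ennreal (v y)" for n
    proof (rule AE_I2)
      fix y
      have "ennreal (e n y) \<le> 1" unfolding e_eq by simp
      then have "e n y \<le> 1" by (simp add: ennreal_le_1)
      then show "ennreal (e n y * v y) \<le> ennreal (v y)" using v0[of y] e0 by (intro ennreal_leI mult_left_le_one_le)
    qed
    show "AE y in lborel. (\<lambda>n. ennreal (e n y * v y)) \<longlonglongrightarrow> 0"
      using good
    proof eventually_elim
      case (elim y)
      show ?case
      proof (cases "y > 0")
        case True
        have "(\<lambda>n. min 1 (d n y)) \<longlonglongrightarrow> min 1 0" using elim True by (intro tendsto_min tendsto_const) auto
        then have "(\<lambda>n. ennreal (v y) * min 1 (d n y)) \<longlonglongrightarrow> ennreal (v y) * 0" by (intro ennreal_tendsto_cmult) auto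
        then show ?thesis using e0 v0 by (simp add: ennreal_mult e_eq[symmetric] mult.commute)
      qed (simp add: v_def)
    qed
  qed (use v_int in auto)
  \<comment> \<open>Integrals tending to 0 admit a choice of indices \<open>r k\<close> with
    geometric bounds; summability then gives pointwise convergence along them.\<close>
  have "\<exists>n. (\<integral>\<^sup>+y. ennreal (e n y * v y) \<partial>lborel) < ennreal ((1 / 2) ^ k)" for k
  proof -
    have "\<forall>\<^sub>F n in sequentially. (\<integral>\<^sup>+y. ennreal (e n y * v y) \<partial>lborel) < ennreal ((1 / 2) ^ k)"
      using J by (intro order_tendstoD(2)[OF J]) (simp add: zero_less_power)
    then show ?thesis by (auto simp: eventually_sequentially)
  qed
  then obtain r where r: "\<And>k. (\<integral>\<^sup>+y. ennreal (e (r k) y * v y) \<partial>lborel) < ennreal ((1 / 2) ^ k)" by metis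
  have sm: "AE y in lborel. summable (\<lambda>k. e (r k) y * v y)"
    by (rule AE_summable_of_nn_integrals[where a = "\<lambda>k. (1 / 2) ^ k"])
       (use e0 v0 r in \<open>auto intro: less_imp_le summable_geometric\<close>)
  \<comment> \<open>\<open>lim\<close> has some value also where the sequence diverges, so
    \<open>L\<close> is Borel measurable on the whole space.\<close>
  define L where "L \<xi> y = lim (\<lambda>k. G (r k) \<xi> y)" for \<xi> y
  have "(\<lambda>z. lim (\<lambda>k. case_prod (G (r k)) z)) \<in> borel_measurable borel"
    by (rule borel_measurable_lim_metric) (rule Gm)
  then have "case_prod L \<in> borel_measurable borel" by (simp add: L_def case_prod_beta')
  moreover have "AE y in lborel. y > 0 \<longrightarrow> (AE \<xi> in lborel. H y \<xi> = L \<xi> y)"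
    using good sm
  proof eventually_elim
    case (elim y)
    show ?case
    proof
      assume y: "y > 0"
      then have vy: "v y > 0" by (simp add: v_def add_pos_nonneg)
      have Hm[measurable]: "H y \<in> borel_measurable borel" and Dd: "\<And>n. D n y \<le> 2 * d n y" using elim y by auto
      have se: "summable (\<lambda>k. e (r k) y)"
        using summable_mult2[OF elim(2), of "1 / v y"] vy by simp
      then have "(\<lambda>k. e (r k) y) \<longlonglongrightarrow> 0" by (rule summable_LIMSEQ_zero)
      then have "\<forall>\<^sub>F k in sequentially. e (r k) y < 1" by (rule order_tendstoD) simp
      \<comment> \<open>From \<open>K\<close> on the truncation is inactive, \<open>e\<close> equals
        \<open>d\<close>, and \<open>D\<close> inherits a summable bound.\<close>
      then obtain K where K: "\<And>k. k \<ge> K \<Longrightarrow> e (r k) y < 1" by (auto simp: eventually_sequentially)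
      have De: "D (r (k + K)) y \<le> ennreal (2 * e (r (k + K)) y)" for k
      proof -
        have "ennreal (e (r (k + K)) y) < 1" using K[of "k + K"] e0 by (simp add: ennreal_less_one_iff)
        then have "ennreal (e (r (k + K)) y) = d (r (k + K)) y" unfolding e_eq by (auto simp: min_def split: if_splits)
        then have "2 * d (r (k + K)) y = ennreal (2 * e (r (k + K)) y)" using e0 by (simp add: ennreal_mult)
        then show ?thesis using Dd[of "r (k + K)"] by simp
      qed
      have "AE \<xi> in lborel. summable (\<lambda>k. \<omega> \<xi> * (norm (G (r (k + K)) \<xi> y - H y \<xi>))\<^sup>2)"
      proof (rule AE_summable_of_nn_integrals[where a = "\<lambda>k. 2 * e (r (k + K)) y"])
        show "(\<lambda>\<xi>. \<omega> \<xi> * (norm (G (r (k + K)) \<xi> y - H y \<xi>))\<^sup>2) \<in> borel_measurable lborel" for k by measurable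
        show "(\<integral>\<^sup>+\<xi>. ennreal (\<omega> \<xi> * (norm (G (r (k + K)) \<xi> y - H y \<xi>))\<^sup>2) \<partial>lborel) \<le> ennreal (2 * e (r (k + K)) y)" for k
          using De unfolding D_def .
        show "summable (\<lambda>k. 2 * e (r (k + K)) y)" using summable_ignore_initial_segment[OF se, of K] by (rule summable_mult)
        show "0 \<le> \<omega> \<xi> * (norm (G (r (k + K)) \<xi> y - H y \<xi>))\<^sup>2" for k \<xi> using less_imp_le[OF \<omega>] by simp
        show "0 \<le> 2 * e (r (k + K)) y" for k using e0 by simp
      qed
      then show "AE \<xi> in lborel. H y \<xi> = L \<xi> y"
      proof eventually_elim
        case (elim \<xi>)
        have "(\<lambda>k. \<omega> \<xi> * (norm (G (r (k + K)) \<xi> y - H y \<xi>))\<^sup>2) \<longlonglongrightarrow> 0" using elim by (rule summable_LIMSEQ_zero)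
        from tendsto_mult_left[OF this, of "1 / \<omega> \<xi>"] have "(\<lambda>k. (norm (G (r (k + K)) \<xi> y - H y \<xi>))\<^sup>2) \<longlonglongrightarrow> 0"
          using \<omega>[of \<xi>] by simp
        from tendsto_real_sqrt[OF this] have "(\<lambda>k. norm (G (r (k + K)) \<xi> y - H y \<xi>)) \<longlonglongrightarrow> 0" by simp
        then have "(\<lambda>k. G (r (k + K)) \<xi> y) \<longlonglongrightarrow> H y \<xi>" using tendsto_norm_zero_iff LIM_zero_iff by blast
        then have "(\<lambda>k. G (r k) \<xi> y) \<longlonglongrightarrow> H y \<xi>" by (rule LIMSEQ_offset)
        then show ?case unfolding L_def by (rule limI[symmetric])
      qed
    qed
  qed
  ultimately show ?thesis by blast
qed

lemma AE_lebesgue_iff_lborel: "(AE y in lebesgue. P y) \<longleftrightarrow> (AE y in lborel. P y)"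
  by (rule AE_completion_iff)

text \<open>The transforms of the approximating simple functions are finite sums of an indicator in
  y times a function of \<xi>, hence jointly measurable, and their weighted distance to the
  transform of \<open>F\<close> tends to 0 for almost every y > 0.
  \<open>joint_measurable_limit\<close> then supplies the representative.\<close>

lemma tangential_fourier_exists:
  assumes F: "F \<in> L2_Hsg \<sigma> s \<gamma>" and \<gamma>: "\<gamma> \<ge> 1" and \<sigma>: "\<sigma> = 1 \<or> \<sigma> = -1"
  shows "\<exists>G. has_tangential_fourier \<sigma> \<gamma> F G"
proof -
  obtain S where fin: "\<And>n. finite (range (S n))" and rng: "\<And>n y. S n y \<in> Hsg s \<gamma>"
    and meas: "\<And>n u. S n -` {u} \<in> sets lebesgue"
    and lim: "AE y in lborel. y > 0 \<longrightarrow> (\<lambda>n. Hsg_norm s \<gamma> (dist_diff (S n y) (F (\<sigma> * y)))) \<longlonglongrightarrow> 0"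
    using F unfolding L2_Hsg_def bochner_measurable_def AE_lebesgue_iff_lborel by blast
  have mem: "AE y in lborel. y > 0 \<longrightarrow> F (\<sigma> * y) \<in> Hsg s \<gamma>"
    using F unfolding L2_Hsg_def AE_lebesgue_iff_lborel by blast
  define fh where "fh u = fourier_fun (exp_weight \<gamma> u)" for u
  have fh: "has_fourier_fun (exp_weight \<gamma> u) (fh u)" if "u \<in> Hsg s \<gamma>" for u
    unfolding fh_def by (rule Hsg_has_fourier_fun[OF that])
  obtain B where B: "\<And>n u. B n u \<in> sets borel" "\<And>n u. AE y in lborel. y \<in> B n u \<longleftrightarrow> S n y = u"
    using lebesgue_set_AE_borel[OF meas] by (simp only: vimage_singleton_eq) metis
  define G where "G n \<xi> y = (\<Sum>u\<in>range (S n). indicat_real (B n u) y *\<^sub>R fh u \<xi>)" for n \<xi> y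
  have Gm: "case_prod (G n) \<in> borel_measurable borel" for n
  proof -
    have "(\<lambda>z::(real \<times> real) \<times> real. indicat_real (B n u) (snd z) *\<^sub>R fh u (fst z)) \<in> borel_measurable borel" if "u \<in> range (S n)" for u
    proof -
      have "u \<in> Hsg s \<gamma>" using that rng by blast
      note [measurable] = has_fourier_funD(1)[OF fh[OF this]] B(1)
      have "(\<lambda>z::(real \<times> real) \<times> real. indicat_real (B n u) (snd z) *\<^sub>R fh u (fst z)) \<in> borel_measurable (borel \<Otimes>\<^sub>M borel)" by measurable
      then show ?thesis by (simp add: borel_prod)
    qed
    then have "(\<lambda>z::(real \<times> real) \<times> real. \<Sum>u\<in>range (S n). indicat_real (B n u) (snd z) *\<^sub>R fh u (fst z)) \<in> borel_measurable borel"
      by (rule borel_measurable_sum)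
    then show ?thesis by (simp add: G_def case_prod_beta')
  qed
  have GS: "AE y in lborel. \<forall>n \<xi>. G n \<xi> y = fh (S n y) \<xi>"
  proof -
    have "AE y in lborel. \<forall>u\<in>range (S n). y \<in> B n u \<longleftrightarrow> S n y = u" for n
      using B(2) by (intro AE_finite_allI fin)
    then have "AE y in lborel. \<forall>n. \<forall>u\<in>range (S n). y \<in> B n u \<longleftrightarrow> S n y = u" by (simp only: AE_all_countable) blast
    then show ?thesis
    proof eventually_elim
      case (elim y)
      show ?case
      proof (intro allI)
        fix n \<xi>
        have "G n \<xi> y = (\<Sum>u\<in>range (S n). if S n y = u then fh u \<xi> else 0)"
          unfolding G_def using elim by (intro sum.cong) (auto simp: indicator_def)
        also have "\<dots> = fh (S n y) \<xi>" using fin[of n] by simp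
        finally show "G n \<xi> y = fh (S n y) \<xi>" .
      qed
    qed
  qed
  have pos: "freq_weight \<gamma> \<xi> powr s > 0" for \<xi> using freq_weight_pos[OF \<gamma>, of \<xi>] by simp
  have "AE y in lborel. y > 0 \<longrightarrow> fh (F (\<sigma> * y)) \<in> borel_measurable borel \<and>
       (\<lambda>n. \<integral>\<^sup>+\<xi>. ennreal (freq_weight \<gamma> \<xi> powr s * (norm (G n \<xi> y - fh (F (\<sigma> * y)) \<xi>))\<^sup>2) \<partial>lborel) \<longlonglongrightarrow> 0"
    using lim mem GS
  proof eventually_elim
    case (elim y)
    show ?case
    proof (intro impI conjI)
      assume y: "y > 0"
      then have Fy: "F (\<sigma> * y) \<in> Hsg s \<gamma>" using elim by blast
      show "fh (F (\<sigma> * y)) \<in> borel_measurable borel" by (rule has_fourier_funD(1)[OF fh[OF Fy]])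
      have "(\<lambda>n. (2 * pi)\<^sup>2 * (Hsg_norm s \<gamma> (dist_diff (S n y) (F (\<sigma> * y))))\<^sup>2) \<longlonglongrightarrow> (2 * pi)\<^sup>2 * 0\<^sup>2"
        using elim(1) y by (intro tendsto_mult tendsto_power tendsto_const) blast
      then have "(\<lambda>n. ennreal ((2 * pi)\<^sup>2 * (Hsg_norm s \<gamma> (dist_diff (S n y) (F (\<sigma> * y))))\<^sup>2)) \<longlonglongrightarrow> ennreal 0"
        by (intro tendsto_ennrealI) simp
      then show "(\<lambda>n. \<integral>\<^sup>+\<xi>. ennreal (freq_weight \<gamma> \<xi> powr s * (norm (G n \<xi> y - fh (F (\<sigma> * y)) \<xi>))\<^sup>2) \<partial>lborel) \<longlonglongrightarrow> 0"
        using elim(3) Hsg_diff_nn_integral[OF rng Fy \<gamma> fh[OF rng] fh[OF Fy]] by simp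
    qed
  qed
  from joint_measurable_limit[OF Gm _ pos this] obtain L where Lm: "case_prod L \<in> borel_measurable borel"
    and L: "AE y in lborel. y > 0 \<longrightarrow> (AE \<xi> in lborel. fh (F (\<sigma> * y)) \<xi> = L \<xi> y)"
    by auto
  \<comment> \<open>The limit was formed in the parameter y > 0; as \<sigma>^2 = 1, this moves it to
    the points \<sigma> y of the half line in question.\<close>
  define K where "K z = L (fst z) (\<sigma> * snd z)" for z
  have "(\<lambda>z::(real \<times> real) \<times> real. (fst z, \<sigma> * snd z)) \<in> borel_measurable borel"
    by (intro borel_measurable_continuous_onI continuous_intros)
  from measurable_compose[OF this Lm] have Km: "K \<in> borel_measurable borel" by (simp add: K_def[abs_def])
  have "AE y in lborel. y > 0 \<longrightarrow> has_fourier_fun (exp_weight \<gamma> (F (\<sigma> * y))) (\<lambda>\<xi>. K (\<xi>, \<sigma> * y))"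
    using L mem
  proof eventually_elim
    case (elim y)
    show ?case
    proof
      assume y: "y > 0"
      have \<sigma>y: "\<sigma> * (\<sigma> * y) = y" using \<sigma> by auto
      have eq: "K (\<xi>, \<sigma> * y) = L \<xi> y" for \<xi> by (simp only: K_def fst_conv snd_conv \<sigma>y)
      have "(\<lambda>\<xi>. (\<xi>, \<sigma> * y)) \<in> borel_measurable (borel :: (real \<times> real) measure)"
        by (intro borel_measurable_continuous_onI continuous_intros)
      from measurable_compose[OF this Km] have m: "(\<lambda>\<xi>. K (\<xi>, \<sigma> * y)) \<in> borel_measurable borel" .
      show "has_fourier_fun (exp_weight \<gamma> (F (\<sigma> * y))) (\<lambda>\<xi>. K (\<xi>, \<sigma> * y))"
        by (rule has_fourier_fun_cong_AE[OF fh m]) (use elim y eq in auto)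
    qed
  qed
  then have "has_tangential_fourier \<sigma> \<gamma> F K"
    unfolding has_tangential_fourier_def AE_lebesgue_iff_lborel using Km by blast
  then show ?thesis by (intro exI[of _ K])
qed

section \<open>Solving the equation\<close>

lemma nn_integral_exp_decay:
  assumes a: "a > 0"
  shows "(\<integral>\<^sup>+y. ennreal (indicator {0<..} y * exp (- a * y)) \<partial>lborel) \<le> ennreal (1 / a)"
proof -
  have "((\<lambda>y. - exp (- a * y) / a) \<longlongrightarrow> 0) at_top" using a by real_asymp
  then have "(\<integral>\<^sup>+y. ennreal (exp (- a * y)) * indicator {0..} y \<partial>lborel) = ennreal (0 - (- exp (- a * 0) / a))"
    using a by (intro nn_integral_FTC_atLeast) (auto intro!: derivative_eq_intros)
  moreover have "(\<integral>\<^sup>+y. ennreal (indicator {0<..} y * exp (- a * y)) \<partial>lborel) \<le> (\<integral>\<^sup>+y. ennreal (exp (- a * y)) * indicator {0..} y \<partial>lborel)"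
    by (intro nn_integral_mono) (auto simp: indicator_def)
  ultimately show ?thesis by simp
qed

text \<open>Cauchy-Schwarz between exp (-a y) and g; the squared exponential integrates to 1 / (2
  a). Extended integrals keep the inequality meaningful at frequencies where the right-hand side is
  infinite.\<close>

lemma laplace_integral_bound:
  fixes g :: "real \<Rightarrow> complex"
  assumes [measurable]: "g \<in> borel_measurable borel" and a: "a > 0" "a \<le> Re \<mu>"
  shows "ennreal ((norm (LINT y:{0<..}|lborel. exp (- \<mu> * of_real y) * g y))\<^sup>2) \<le>
    ennreal (1 / (2 * a)) * (\<integral>\<^sup>+y. ennreal (indicator {0<..} y * (norm (g y))\<^sup>2) \<partial>lborel)"
proof -
  let ?f = "\<lambda>y. indicat_real {0<..} y *\<^sub>R (exp (- \<mu> * of_real y) * g y)"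
  let ?u = "\<lambda>y. ennreal (indicator {0<..} y * exp (- a * y))" and ?w = "\<lambda>y. ennreal (indicator {0<..} y * norm (g y))"
  have le: "ennreal (norm (integral\<^sup>L lborel ?f)) \<le> (\<integral>\<^sup>+y. ?u y * ?w y \<partial>lborel)"
  proof (cases "integrable lborel ?f")
    case True
    then have "ennreal (norm (integral\<^sup>L lborel ?f)) \<le> (\<integral>\<^sup>+y. ennreal (norm (?f y)) \<partial>lborel)"
      by (rule integral_norm_bound_ennreal)
    also have "\<dots> \<le> (\<integral>\<^sup>+y. ?u y * ?w y \<partial>lborel)"
    proof (rule nn_integral_mono)
      fix y
      have "norm (?f y) \<le> (indicator {0<..} y * exp (- a * y)) * (indicator {0<..} y * norm (g y))"
        using a by (auto simp: indicator_def norm_mult mult_right_mono intro!: mult_right_mono)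
      then show "ennreal (norm (?f y)) \<le> ?u y * ?w y"
        by (subst ennreal_mult[symmetric]) (auto intro: ennreal_leI)
    qed
    finally show ?thesis .
  next
    \<comment> \<open>The value of a Bochner integral that does not exist is 0, and the bound is
      then trivial.\<close>
    case False
    then show ?thesis by (simp add: not_integrable_integral_eq)
  qed
  have "ennreal ((norm (integral\<^sup>L lborel ?f))\<^sup>2) = (ennreal (norm (integral\<^sup>L lborel ?f)))\<^sup>2"
    by (simp add: ennreal_power)
  also have "\<dots> \<le> (\<integral>\<^sup>+y. ?u y * ?w y \<partial>lborel)\<^sup>2" by (intro power_mono le) simp
  also have "\<dots> \<le> (\<integral>\<^sup>+y. (?u y)\<^sup>2 \<partial>lborel) * (\<integral>\<^sup>+y. (?w y)\<^sup>2 \<partial>lborel)"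
    by (rule Cauchy_Schwarz_nn_integral) measurable
  also have "(\<lambda>y. (?u y)\<^sup>2) = (\<lambda>y. ennreal (indicator {0<..} y * exp (- (2 * a) * y)))"
    by (auto simp: indicator_def power2_eq_square ennreal_mult[symmetric] exp_add[symmetric] fun_eq_iff)
  also have "(\<lambda>y. (?w y)\<^sup>2) = (\<lambda>y. ennreal (indicator {0<..} y * (norm (g y))\<^sup>2))"
    by (auto simp: indicator_def ennreal_power fun_eq_iff)
  also have "(\<integral>\<^sup>+y. ennreal (indicator {0<..} y * exp (- (2 * a) * y)) \<partial>lborel) * (\<integral>\<^sup>+y. ennreal (indicator {0<..} y * (norm (g y))\<^sup>2) \<partial>lborel)
    \<le> ennreal (1 / (2 * a)) * (\<integral>\<^sup>+y. ennreal (indicator {0<..} y * (norm (g y))\<^sup>2) \<partial>lborel)"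
    using a by (intro mult_right_mono nn_integral_exp_decay) auto
  finally show ?thesis by (simp add: set_lebesgue_integral_def)
qed

lemma tangential_slice_measurable:
  assumes "G \<in> borel_measurable (borel :: ((real \<times> real) \<times> real) measure)"
  shows "(\<lambda>y. G (\<xi>, \<sigma> * y)) \<in> borel_measurable borel"
proof -
  have "(\<lambda>y. (\<xi>, \<sigma> * y)) \<in> borel_measurable borel"
    by (intro borel_measurable_continuous_onI continuous_intros)
  from measurable_compose[OF this assms] show ?thesis .
qed

lemma tangential_flip_measurable:
  assumes "G \<in> borel_measurable (borel :: ((real \<times> real) \<times> real) measure)"
  shows "(\<lambda>(\<xi>, y). G (\<xi>, \<sigma> * y)) \<in> borel_measurable (lborel \<Otimes>\<^sub>M lborel)"
proof -
  have "(\<lambda>z::(real \<times> real) \<times> real. (fst z, \<sigma> * snd z)) \<in> borel_measurable borel"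
    by (intro borel_measurable_continuous_onI continuous_intros)
  from measurable_compose[OF this assms] show ?thesis by (simp add: lborel_prod case_prod_beta')
qed

text \<open>Tonelli interchanges y and \<xi>; for fixed y the integral over \<xi> is the squared
  norm of the slice, by \<open>Hsg_nn_integral\<close>.\<close>

lemma tangential_nn_integral:
  assumes F: "F \<in> L2_Hsg \<sigma> s \<gamma>" and \<gamma>: "\<gamma> \<ge> 1" and G: "has_tangential_fourier \<sigma> \<gamma> F G"
  shows "(\<integral>\<^sup>+\<xi>. ennreal (freq_weight \<gamma> \<xi> powr s) * (\<integral>\<^sup>+y. ennreal (indicator {0<..} y * (norm (G (\<xi>, \<sigma> * y)))\<^sup>2) \<partial>lborel) \<partial>lborel)
    = ennreal ((2 * pi)\<^sup>2 * (L2_Hsg_norm \<sigma> s \<gamma> F)\<^sup>2)"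
proof -
  have Gm: "G \<in> borel_measurable borel" using G by (simp add: has_tangential_fourier_def)
  note flip[measurable] = tangential_flip_measurable[OF Gm, of \<sigma>]
  note slice[measurable] = tangential_slice_measurable[OF Gm]
  let ?k = "\<lambda>\<xi> y. ennreal (freq_weight \<gamma> \<xi> powr s * (indicator {0<..} y * (norm (G (\<xi>, \<sigma> * y)))\<^sup>2))"
  have k_meas: "case_prod ?k \<in> borel_measurable (lborel \<Otimes>\<^sub>M lborel)"
  proof -
    have "(\<lambda>z. ennreal (freq_weight \<gamma> (fst z) powr s * (indicator {0<..} (snd z) * (norm ((\<lambda>(\<xi>, y). G (\<xi>, \<sigma> * y)) z))\<^sup>2))) \<in> borel_measurable (lborel \<Otimes>\<^sub>M lborel)"
      by measurable
    then show ?thesis by (simp add: case_prod_beta')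
  qed
  have "(\<integral>\<^sup>+\<xi>. ennreal (freq_weight \<gamma> \<xi> powr s) * (\<integral>\<^sup>+y. ennreal (indicator {0<..} y * (norm (G (\<xi>, \<sigma> * y)))\<^sup>2) \<partial>lborel) \<partial>lborel)
     = (\<integral>\<^sup>+\<xi>. (\<integral>\<^sup>+y. ?k \<xi> y \<partial>lborel) \<partial>lborel)"
    by (intro nn_integral_cong, subst nn_integral_cmult[symmetric]) (auto simp: ennreal_mult)
  also have "\<dots> = (\<integral>\<^sup>+y. (\<integral>\<^sup>+\<xi>. ?k \<xi> y \<partial>lborel) \<partial>lborel)"
    using lborel_pair.Fubini'[OF k_meas] by simp
  \<comment> \<open>The inner integral is Borel measurable in y, whereas the squared norm of the
    slice is known to be measurable only for the completed measure; hence the change of measure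
    before identifying the two.\<close>
  also have "\<dots> = (\<integral>\<^sup>+y. (\<integral>\<^sup>+\<xi>. ?k \<xi> y \<partial>lborel) \<partial>lebesgue)"
    using lborel.borel_measurable_nn_integral[OF measurable_pair_swap[OF k_meas, unfolded split_conv]]
    by (intro nn_integral_completion[symmetric])
  also have "\<dots> = (\<integral>\<^sup>+y. ennreal ((2 * pi)\<^sup>2 * (indicator {0<..} y * (Hsg_norm s \<gamma> (F (\<sigma> * y)))\<^sup>2)) \<partial>lebesgue)"
  proof (rule nn_integral_cong_AE)
    have "AE y in lebesgue. y > 0 \<longrightarrow> F (\<sigma> * y) \<in> Hsg s \<gamma>" using F by (simp add: L2_Hsg_def)
    moreover have "AE y in lebesgue. y > 0 \<longrightarrow> has_fourier_fun (exp_weight \<gamma> (F (\<sigma> * y))) (\<lambda>\<xi>. G (\<xi>, \<sigma> * y))"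
      using G by (simp add: has_tangential_fourier_def)
    ultimately show "AE y in lebesgue. (\<integral>\<^sup>+\<xi>. ?k \<xi> y \<partial>lborel) = ennreal ((2 * pi)\<^sup>2 * (indicator {0<..} y * (Hsg_norm s \<gamma> (F (\<sigma> * y)))\<^sup>2))"
    proof eventually_elim
      case (elim y)
      show ?case
      proof (cases "y > 0")
        case True
        then show ?thesis using Hsg_nn_integral[OF _ \<gamma>, of "F (\<sigma> * y)" s "\<lambda>\<xi>. G (\<xi>, \<sigma> * y)"] elim by simp
      qed simp
    qed
  qed
  also have "\<dots> = ennreal (\<integral>y. (2 * pi)\<^sup>2 * (indicator {0<..} y * (Hsg_norm s \<gamma> (F (\<sigma> * y)))\<^sup>2) \<partial>lebesgue)"
  proof (rule nn_integral_eq_integral)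
    show "integrable lebesgue (\<lambda>y. (2 * pi)\<^sup>2 * (indicator {0<..} y * (Hsg_norm s \<gamma> (F (\<sigma> * y)))\<^sup>2))"
      using F by (intro integrable_mult_right) (simp add: L2_Hsg_def set_integrable_def)
  qed simp
  also have "(\<integral>y. (2 * pi)\<^sup>2 * (indicator {0<..} y * (Hsg_norm s \<gamma> (F (\<sigma> * y)))\<^sup>2) \<partial>lebesgue) = (2 * pi)\<^sup>2 * (L2_Hsg_norm \<sigma> s \<gamma> F)\<^sup>2"
  proof -
    have "0 \<le> (LINT y:{0<..}|lebesgue. (Hsg_norm s \<gamma> (F (\<sigma> * y)))\<^sup>2)"
      unfolding set_lebesgue_integral_def by (intro Bochner_Integration.integral_nonneg) simp
    then have "(L2_Hsg_norm \<sigma> s \<gamma> F)\<^sup>2 = (\<integral>y. indicator {0<..} y * (Hsg_norm s \<gamma> (F (\<sigma> * y)))\<^sup>2 \<partial>lebesgue)"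
      by (simp add: L2_Hsg_norm_def set_lebesgue_integral_def)
    then show ?thesis by simp
  qed
  finally show ?thesis .
qed

text \<open>For almost every y the slices agree at almost every \<xi>. Joint measurability makes the
  set of agreement measurable, so the two quantifiers may be exchanged; the integrals in
  \<open>M_term\<close> are thus independent of the representative at almost every
  frequency.\<close>

lemma tangential_unique:
  assumes G: "has_tangential_fourier \<sigma> \<gamma> F G" and G': "has_tangential_fourier \<sigma> \<gamma> F G'"
  shows "AE \<xi> in lborel. AE y in lborel. y > 0 \<longrightarrow> G (\<xi>, \<sigma> * y) = G' (\<xi>, \<sigma> * y)"
proof -
  have m: "G \<in> borel_measurable borel" "G' \<in> borel_measurable borel"
    using G G' by (simp_all add: has_tangential_fourier_def)
  have "AE y in lborel. AE \<xi> in lborel. y > 0 \<longrightarrow> G (\<xi>, \<sigma> * y) = G' (\<xi>, \<sigma> * y)"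
  proof -
    have "AE y in lborel. (y > 0 \<longrightarrow> has_fourier_fun (exp_weight \<gamma> (F (\<sigma> * y))) (\<lambda>\<xi>. G (\<xi>, \<sigma> * y))) \<and>
       (y > 0 \<longrightarrow> has_fourier_fun (exp_weight \<gamma> (F (\<sigma> * y))) (\<lambda>\<xi>. G' (\<xi>, \<sigma> * y)))"
      using G G' unfolding has_tangential_fourier_def AE_lebesgue_iff_lborel by (intro AE_conjI) auto
    then show ?thesis
    proof eventually_elim
      case (elim y)
      show ?case
      proof (cases "y > 0")
        case True
        then show ?thesis using has_fourier_fun_unique elim by auto
      qed simp
    qed
  qed
  moreover have "{z \<in> space (lborel \<Otimes>\<^sub>M lborel). snd z > 0 \<longrightarrow> G (fst z, \<sigma> * snd z) = G' (fst z, \<sigma> * snd z)} \<in> sets (lborel \<Otimes>\<^sub>M lborel)"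
  proof -
    note [measurable] = tangential_flip_measurable[OF m(1), of \<sigma>, unfolded case_prod_beta'] tangential_flip_measurable[OF m(2), of \<sigma>, unfolded case_prod_beta']
    show ?thesis by measurable
  qed
  ultimately show ?thesis
    using lborel_pair.AE_commute[of "\<lambda>\<xi> y. y > 0 \<longrightarrow> G (\<xi>, \<sigma> * y) = G' (\<xi>, \<sigma> * y)"] by blast
qed

lemma M_term_cong:
  assumes "AE y in lborel. y > 0 \<longrightarrow> Gp ((\<delta>, \<eta>), y) = Gp' ((\<delta>, \<eta>), y)" "AE y in lborel. y > 0 \<longrightarrow> Gm ((\<delta>, \<eta>), - y) = Gm' ((\<delta>, \<eta>), - y)"
    and m: "Gp \<in> borel_measurable borel" "Gp' \<in> borel_measurable borel" "Gm \<in> borel_measurable borel" "Gm' \<in> borel_measurable borel"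
  shows "M_term v c Gp Gm \<gamma> \<delta> \<eta> = M_term v c Gp' Gm' \<gamma> \<delta> \<eta>"
proof -
  have *: "(LINT y:{0<..}|lborel. exp (- \<mu> * of_real y) * f y) = (LINT y:{0<..}|lborel. exp (- \<mu> * of_real y) * g y)"
    if [measurable]: "f \<in> borel_measurable borel" "g \<in> borel_measurable borel" and "AE y in lborel. y > 0 \<longrightarrow> f y = g y" for f g :: "real \<Rightarrow> complex" and \<mu>
    unfolding set_lebesgue_integral_def
  proof (rule integral_cong_AE)
    show "AE y in lborel. indicat_real {0<..} y *\<^sub>R (exp (- \<mu> * of_real y) * f y) = indicat_real {0<..} y *\<^sub>R (exp (- \<mu> * of_real y) * g y)"
      using that(3) by eventually_elim (auto simp: indicator_def)
  qed measurable
  note s = tangential_slice_measurable[of _ "(\<delta>, \<eta>)" 1, simplified] tangential_slice_measurable[of _ "(\<delta>, \<eta>)" "-1", simplified]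
  show ?thesis
    unfolding M_term_def Let_def *[OF s(1)[OF m(1)] s(1)[OF m(2)] assms(1)] *[OF s(2)[OF m(3)] s(2)[OF m(4)] assms(2)] ..
qed

text \<open>\<open>csqrt\<close> is continuous off the nonpositive reals, and \<open>mu_arg\<close>
  never lies there, since its root would then have real part 0.\<close>

lemma mu_measurable:
  assumes "\<gamma> > 0" "c > 0"
  shows "(\<lambda>\<xi>. mu \<sigma> v c (Complex \<gamma> (fst \<xi>)) (snd \<xi>)) \<in> borel_measurable borel"
proof (rule borel_measurable_continuous_onI)
  have nn: "mu_arg \<sigma> v c (Complex \<gamma> \<delta>) \<eta> \<in> - \<real>\<^sub>\<le>\<^sub>0" for \<delta> \<eta>
  proof
    assume "mu_arg \<sigma> v c (Complex \<gamma> \<delta>) \<eta> \<in> \<real>\<^sub>\<le>\<^sub>0"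
    then obtain x where x: "mu_arg \<sigma> v c (Complex \<gamma> \<delta>) \<eta> = of_real x" "x \<le> 0" by (auto elim: nonpos_Reals_cases)
    then have "Re (mu \<sigma> v c (Complex \<gamma> \<delta>) \<eta>) = 0" by (simp add: mu_def)
    moreover have "Re (mu \<sigma> v c (Complex \<gamma> \<delta>) \<eta>) > 0" using assms by (intro mu_Re_pos) auto
    ultimately show False by simp
  qed
  have "continuous_on UNIV (\<lambda>\<xi>::real \<times> real. mu_arg \<sigma> v c (Complex \<gamma> (fst \<xi>)) (snd \<xi>))"
    unfolding mu_arg_def Complex_eq using assms by (intro continuous_intros) auto
  from continuous_on_compose2[OF continuous_on_csqrt this] show "continuous_on UNIV (\<lambda>\<xi>. mu \<sigma> v c (Complex \<gamma> (fst \<xi>)) (snd \<xi>))"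
    using nn by (auto simp: mu_def)
qed

lemma M_term_measurable:
  assumes \<gamma>: "\<gamma> > 0" and c: "c > 0" and m: "Gp \<in> borel_measurable borel" "Gm \<in> borel_measurable borel"
  shows "(\<lambda>\<xi>. M_term v c Gp Gm \<gamma> (fst \<xi>) (snd \<xi>)) \<in> borel_measurable borel"
proof -
  have "(\<lambda>\<xi>. LINT y:{0<..}|lborel. exp (- mu \<sigma> v c (Complex \<gamma> (fst \<xi>)) (snd \<xi>) * of_real y) * G (\<xi>, \<tau> * y)) \<in> borel_measurable lborel"
    if G: "G \<in> borel_measurable borel" for G :: "(real \<times> real) \<times> real \<Rightarrow> complex" and \<sigma> \<tau>
    unfolding set_lebesgue_integral_def
  proof (rule lborel.borel_measurable_lebesgue_integral)
    note [measurable] = mu_measurable[OF \<gamma> c, of \<sigma> v] tangential_flip_measurable[OF G, of \<tau>]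
    have "(\<lambda>z. indicat_real {0<..} (snd z) *\<^sub>R (exp (- mu \<sigma> v c (Complex \<gamma> (fst (fst z))) (snd (fst z)) * of_real (snd z)) * (\<lambda>(\<xi>, y). G (\<xi>, \<tau> * y)) z)) \<in> borel_measurable (lborel \<Otimes>\<^sub>M lborel)"
      by measurable
    then show "(\<lambda>(\<xi>, y). indicat_real {0<..} y *\<^sub>R (exp (- mu \<sigma> v c (Complex \<gamma> (fst \<xi>)) (snd \<xi>) * of_real y) * G (\<xi>, \<tau> * y))) \<in> borel_measurable (lborel \<Otimes>\<^sub>M lborel)"
      by (simp add: case_prod_beta')
  qed
  from this[OF m(1), of 1 1] this[OF m(2), of "-1" "-1"] show ?thesis
    unfolding M_term_def Let_def using mu_measurable[OF \<gamma> c, of 1 v] mu_measurable[OF \<gamma> c, of "-1" v] by simp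
qed

section \<open>The solution on the frequency side\<close>

definition solution_transform :: "real \<Rightarrow> real \<Rightarrow> ((real \<times> real) \<times> real \<Rightarrow> complex) \<Rightarrow>
    ((real \<times> real) \<times> real \<Rightarrow> complex) \<Rightarrow> real \<Rightarrow> planefun" where
  "solution_transform v c Gp Gm \<gamma> \<xi> =
     (let \<tau> = Complex \<gamma> (fst \<xi>); \<mu>p = mu 1 v c \<tau> (snd \<xi>); \<mu>m = mu (-1) v c \<tau> (snd \<xi>) in
        - (\<mu>p * \<mu>m / (\<mu>p + \<mu>m) * M_term v c Gp Gm \<gamma> (fst \<xi>) (snd \<xi>)) / lop_symbol v c \<tau> (snd \<xi>))"

lemma solution_transform_measurable:
  assumes \<gamma>: "\<gamma> > 0" and c: "c > 0" and m: "Gp \<in> borel_measurable borel" "Gm \<in> borel_measurable borel"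
  shows "solution_transform v c Gp Gm \<gamma> \<in> borel_measurable borel"
proof -
  note [measurable] = mu_measurable[OF \<gamma> c, of 1 v] mu_measurable[OF \<gamma> c, of "-1" v] M_term_measurable[OF \<gamma> c m, of v]
  have [measurable]: "(\<lambda>\<xi>. Complex \<gamma> (fst \<xi>)) \<in> borel_measurable (borel :: (real \<times> real) measure)"
    unfolding Complex_eq by (intro borel_measurable_continuous_onI continuous_intros)
  have [measurable]: "snd \<in> borel_measurable (borel :: (real \<times> real) measure)"
    by (intro borel_measurable_continuous_onI continuous_intros)
  show ?thesis unfolding solution_transform_def[abs_def] Let_def lop_symbol_def by measurable
qed

text \<open>After solving, the integral of \<open>Gp\<close> is multiplied by q / ((p + q) S) and
  that of \<open>Gm\<close> by p / ((p + q) S), each with the opposite root. The lower bound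
  \<open>low\<close>, for both signs, makes either factor at most 1 / (K \<gamma> sqrt w).\<close>

lemma solution_transform_bound:
  assumes c: "c > 0" and \<gamma>: "\<gamma> > 0" and K: "K > 0"
    and low: "\<And>\<sigma>. \<sigma> \<in> {1, -1} \<Longrightarrow> K * \<gamma> * sqrt (\<gamma>\<^sup>2 + \<delta>\<^sup>2 + \<eta>\<^sup>2) * norm (mu \<sigma> v c (Complex \<gamma> \<delta>) \<eta>)
      \<le> norm (lop_symbol v c (Complex \<gamma> \<delta>) \<eta>) * norm (mu 1 v c (Complex \<gamma> \<delta>) \<eta> + mu (-1) v c (Complex \<gamma> \<delta>) \<eta>)"
    and m: "Gp \<in> borel_measurable borel" "Gm \<in> borel_measurable borel"
  shows "ennreal ((norm (solution_transform v c Gp Gm \<gamma> (\<delta>, \<eta>)))\<^sup>2) \<le>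
     ennreal (c / (K\<^sup>2 * \<gamma>^3 * freq_weight \<gamma> (\<delta>, \<eta>))) *
       ((\<integral>\<^sup>+y. ennreal (indicator {0<..} y * (norm (Gp ((\<delta>, \<eta>), 1 * y)))\<^sup>2) \<partial>lborel)
        + (\<integral>\<^sup>+y. ennreal (indicator {0<..} y * (norm (Gm ((\<delta>, \<eta>), -1 * y)))\<^sup>2) \<partial>lborel))"
    and "lop_symbol v c (Complex \<gamma> \<delta>) \<eta> \<noteq> 0"
proof -
  define \<tau> where "\<tau> = Complex \<gamma> \<delta>"
  define p q where "p = mu 1 v c \<tau> \<eta>" and "q = mu (-1) v c \<tau> \<eta>"
  define S where "S = lop_symbol v c \<tau> \<eta>"
  define w where "w = freq_weight \<gamma> (\<delta>, \<eta>)"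
  have w: "w = \<gamma>\<^sup>2 + \<delta>\<^sup>2 + \<eta>\<^sup>2" by (simp add: w_def freq_weight_def)
  have w0: "w > 0" using \<gamma> by (simp add: w add_pos_nonneg)
  have R: "Re \<tau> > 0" using \<gamma> by (simp add: \<tau>_def)
  have pq0: "p \<noteq> 0" "q \<noteq> 0" "p + q \<noteq> 0"
    using mu_Re_pos[OF R c, of 1 v \<eta>] mu_Re_pos[OF R c, of "-1" v \<eta>] mu_sum_nonzero[OF R c] by (auto simp: p_def q_def)
  have lp: "K * \<gamma> * sqrt w * norm p \<le> norm S * norm (p + q)" and lq: "K * \<gamma> * sqrt w * norm q \<le> norm S * norm (p + q)"
    using low[of 1] low[of "-1"] by (simp_all add: w p_def q_def S_def \<tau>_def)
  have "0 < K * \<gamma> * sqrt w * norm p" using K \<gamma> w0 pq0 by simp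
  with lp have S0: "S \<noteq> 0" by auto
  then show "lop_symbol v c (Complex \<gamma> \<delta>) \<eta> \<noteq> 0" by (simp add: S_def \<tau>_def)
  define Ip where "Ip = (LINT y:{0<..}|lborel. exp (- p * of_real y) * Gp ((\<delta>, \<eta>), y))"
  define Im' where "Im' = (LINT y:{0<..}|lborel. exp (- q * of_real y) * Gm ((\<delta>, \<eta>), - y))"
  have eq: "solution_transform v c Gp Gm \<gamma> (\<delta>, \<eta>) = p / ((p + q) * S) * Im' - q / ((p + q) * S) * Ip"
  proof -
    have "solution_transform v c Gp Gm \<gamma> (\<delta>, \<eta>) = - (p * q / (p + q) * (1 / p * Ip - 1 / q * Im')) / S"
      by (simp add: solution_transform_def M_term_def Let_def p_def q_def S_def \<tau>_def Ip_def Im'_def)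
    also have "\<dots> = p / ((p + q) * S) * Im' - q / ((p + q) * S) * Ip"
    proof -
      have "- (p * q / D * (1 / p * Ip - 1 / q * Im')) / S = p / (D * S) * Im' - q / (D * S) * Ip" if "D \<noteq> 0" for D
        using pq0(1,2) S0 that by (simp add: field_simps)
      from this[OF pq0(3)] show ?thesis .
    qed
    finally show ?thesis .
  qed
  have co: "norm (r / ((p + q) * S)) \<le> 1 / (K * \<gamma> * sqrt w)" if "K * \<gamma> * sqrt w * norm r \<le> norm S * norm (p + q)" for r
  proof -
    have "norm (r / ((p + q) * S)) = norm r / (norm S * norm (p + q))" by (simp add: norm_divide norm_mult mult.commute)
    also have "\<dots> \<le> 1 / (K * \<gamma> * sqrt w)" using that K \<gamma> w0 S0 pq0 by (simp add: divide_simps mult_ac)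
    finally show ?thesis .
  qed
  have "(norm (solution_transform v c Gp Gm \<gamma> (\<delta>, \<eta>)))\<^sup>2 \<le> 2 * (norm (p / ((p + q) * S) * Im'))\<^sup>2 + 2 * (norm (q / ((p + q) * S) * Ip))\<^sup>2"
    unfolding eq using norm_diff_squared_le[of "p / ((p + q) * S) * Im'" "q / ((p + q) * S) * Ip" 0] by simp
  also have "\<dots> \<le> 2 * ((1 / (K * \<gamma> * sqrt w))\<^sup>2 * (norm Im')\<^sup>2) + 2 * ((1 / (K * \<gamma> * sqrt w))\<^sup>2 * (norm Ip)\<^sup>2)"
    unfolding norm_mult power_mult_distrib
    by (intro add_mono mult_left_mono mult_right_mono power_mono co lp lq) auto
  also have "\<dots> = 2 / (K\<^sup>2 * \<gamma>\<^sup>2 * w) * ((norm Ip)\<^sup>2 + (norm Im')\<^sup>2)"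
    using w0 by (simp add: power_divide power_mult_distrib algebra_simps add_divide_distrib)
  finally have "ennreal ((norm (solution_transform v c Gp Gm \<gamma> (\<delta>, \<eta>)))\<^sup>2) \<le> ennreal (2 / (K\<^sup>2 * \<gamma>\<^sup>2 * w) * ((norm Ip)\<^sup>2 + (norm Im')\<^sup>2))"
    by (rule ennreal_leI)
  also have "\<dots> = ennreal (2 / (K\<^sup>2 * \<gamma>\<^sup>2 * w)) * (ennreal ((norm Ip)\<^sup>2) + ennreal ((norm Im')\<^sup>2))"
    using w0 by (subst ennreal_mult) auto
  also have "\<dots> \<le> ennreal (2 / (K\<^sup>2 * \<gamma>\<^sup>2 * w)) * (ennreal (1 / (2 * (\<gamma> / c))) * (\<integral>\<^sup>+y. ennreal (indicator {0<..} y * (norm (Gp ((\<delta>, \<eta>), 1 * y)))\<^sup>2) \<partial>lborel)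
      + ennreal (1 / (2 * (\<gamma> / c))) * (\<integral>\<^sup>+y. ennreal (indicator {0<..} y * (norm (Gm ((\<delta>, \<eta>), -1 * y)))\<^sup>2) \<partial>lborel))"
  proof (intro mult_left_mono add_mono)
    show "ennreal ((norm Ip)\<^sup>2) \<le> ennreal (1 / (2 * (\<gamma> / c))) * (\<integral>\<^sup>+y. ennreal (indicator {0<..} y * (norm (Gp ((\<delta>, \<eta>), 1 * y)))\<^sup>2) \<partial>lborel)"
      unfolding Ip_def using laplace_integral_bound[OF tangential_slice_measurable[OF m(1), of "(\<delta>, \<eta>)" 1], of "\<gamma> / c" p] c \<gamma> mu_Re_ge[OF c \<gamma>, of 1 v \<delta> \<eta>]
      by (simp add: p_def \<tau>_def)
    show "ennreal ((norm Im')\<^sup>2) \<le> ennreal (1 / (2 * (\<gamma> / c))) * (\<integral>\<^sup>+y. ennreal (indicator {0<..} y * (norm (Gm ((\<delta>, \<eta>), -1 * y)))\<^sup>2) \<partial>lborel)"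
      unfolding Im'_def using laplace_integral_bound[OF tangential_slice_measurable[OF m(2), of "(\<delta>, \<eta>)" "-1"], of "\<gamma> / c" q] c \<gamma> mu_Re_ge[OF c \<gamma>, of "-1" v \<delta> \<eta>]
      by (simp add: q_def \<tau>_def)
  qed simp
  also have "\<dots> = (ennreal (2 / (K\<^sup>2 * \<gamma>\<^sup>2 * w)) * ennreal (1 / (2 * (\<gamma> / c)))) * ((\<integral>\<^sup>+y. ennreal (indicator {0<..} y * (norm (Gp ((\<delta>, \<eta>), 1 * y)))\<^sup>2) \<partial>lborel)
      + (\<integral>\<^sup>+y. ennreal (indicator {0<..} y * (norm (Gm ((\<delta>, \<eta>), -1 * y)))\<^sup>2) \<partial>lborel))"
    by (simp only: distrib_left[symmetric] mult.assoc)
  \<comment> \<open>The 2 from the squared difference cancels against the constant of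
    \<open>laplace_integral_bound\<close>, whose c / \<gamma> brings the third power of
    \<gamma>.\<close>
  also have "ennreal (2 / (K\<^sup>2 * \<gamma>\<^sup>2 * w)) * ennreal (1 / (2 * (\<gamma> / c))) = ennreal (c / (K\<^sup>2 * \<gamma>^3 * w))"
    using w0 c \<gamma> K by (subst ennreal_mult[symmetric]) (auto simp: power2_eq_square power3_eq_cube field_simps)
  finally show "ennreal ((norm (solution_transform v c Gp Gm \<gamma> (\<delta>, \<eta>)))\<^sup>2) \<le>
     ennreal (c / (K\<^sup>2 * \<gamma>^3 * freq_weight \<gamma> (\<delta>, \<eta>))) *
       ((\<integral>\<^sup>+y. ennreal (indicator {0<..} y * (norm (Gp ((\<delta>, \<eta>), 1 * y)))\<^sup>2) \<partial>lborel)
        + (\<integral>\<^sup>+y. ennreal (indicator {0<..} y * (norm (Gm ((\<delta>, \<eta>), -1 * y)))\<^sup>2) \<partial>lborel))"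
    by (simp only: w_def)
qed

theorem theorem3p2:
  fixes v c s :: real
  assumes "v > 0" and "c > 0" and "v / c > sqrt 2"
  shows "\<exists>C>0. \<forall>\<gamma>\<ge>1. \<forall>Fp \<in> L2_Hsg 1 s \<gamma>. \<forall>Fm \<in> L2_Hsg (-1) s \<gamma>.
     (\<exists>!f. f \<in> Hsg (s + 1) \<gamma> \<and> solves_equation v c \<gamma> Fp Fm f) \<and>
     (\<forall>f. f \<in> Hsg (s + 1) \<gamma> \<and> solves_equation v c \<gamma> Fp Fm f \<longrightarrow>
        \<gamma> ^ 3 * (Hsg_norm (s + 1) \<gamma> f)\<^sup>2
          \<le> C * ((L2_Hsg_norm 1 s \<gamma> Fp)\<^sup>2 + (L2_Hsg_norm (-1) s \<gamma> Fm)\<^sup>2))"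
proof -
  obtain K where K: "K > 0" and low: "\<And>\<gamma> \<delta> \<eta> \<sigma>. \<gamma> > 0 \<Longrightarrow> \<sigma> \<in> {1, -1} \<Longrightarrow>
    K * \<gamma> * sqrt (\<gamma>\<^sup>2 + \<delta>\<^sup>2 + \<eta>\<^sup>2) * norm (mu \<sigma> v c (Complex \<gamma> \<delta>) \<eta>)
      \<le> norm (lop_symbol v c (Complex \<gamma> \<delta>) \<eta>) * norm (mu 1 v c (Complex \<gamma> \<delta>) \<eta> + mu (-1) v c (Complex \<gamma> \<delta>) \<eta>)"
    using lop_symbol_lower_bound[OF assms] by blast
  note c = assms(2)
  show ?thesis
  \<comment> \<open>The constant is that of \<open>solution_transform_bound\<close> without its
    \<gamma>^3 and frequency weight; \<open>K\<close> depends only on \<open>v\<close> and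
    \<open>c\<close>.\<close>
  proof (rule exI[of _ "c / K\<^sup>2"], intro conjI allI impI ballI)
    show "0 < c / K\<^sup>2" using c K by simp
    fix \<gamma> :: real and Fp Fm :: "real \<Rightarrow> planefun \<Rightarrow> complex"
    assume \<gamma>1: "1 \<le> \<gamma>" and Fp: "Fp \<in> L2_Hsg 1 s \<gamma>" and Fm: "Fm \<in> L2_Hsg (-1) s \<gamma>"
    have \<gamma>: "\<gamma> > 0" using \<gamma>1 by simp
    obtain Gp where Gp: "has_tangential_fourier 1 \<gamma> Fp Gp" using tangential_fourier_exists[OF Fp \<gamma>1] by auto
    obtain Gm where Gm: "has_tangential_fourier (-1) \<gamma> Fm Gm" using tangential_fourier_exists[OF Fm \<gamma>1] by auto
    have meas: "G \<in> borel_measurable borel" if "has_tangential_fourier \<sigma> \<gamma> F G" for \<sigma> F G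
      using that by (simp add: has_tangential_fourier_def)
    note m = meas[OF Gp] meas[OF Gm]
    define h where "h = solution_transform v c Gp Gm \<gamma>"
    have hm[measurable]: "h \<in> borel_measurable borel" unfolding h_def by (rule solution_transform_measurable[OF \<gamma> c m])
    define Np Nm where "Np = L2_Hsg_norm 1 s \<gamma> Fp" and "Nm = L2_Hsg_norm (-1) s \<gamma> Fm"
    \<comment> \<open>The factors 1 and -1 stay unsimplified so that these terms match
      \<open>tangential_nn_integral\<close> for the two signs.\<close>
    let ?P = "\<lambda>\<xi>. \<integral>\<^sup>+y. ennreal (indicator {0<..} y * (norm (Gp (\<xi>, 1 * y)))\<^sup>2) \<partial>lborel"
    let ?Q = "\<lambda>\<xi>. \<integral>\<^sup>+y. ennreal (indicator {0<..} y * (norm (Gm (\<xi>, -1 * y)))\<^sup>2) \<partial>lborel"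
    have PQm: "(\<lambda>\<xi>. \<integral>\<^sup>+y. ennreal (indicator {0<..} y * (norm (G (\<xi>, \<sigma> * y)))\<^sup>2) \<partial>lborel) \<in> borel_measurable lborel"
      if "G \<in> borel_measurable borel" for G :: "(real \<times> real) \<times> real \<Rightarrow> complex" and \<sigma>
    proof (rule lborel.borel_measurable_nn_integral)
      note [measurable] = tangential_flip_measurable[OF that, of \<sigma>]
      have "(\<lambda>z. ennreal (indicator {0<..} (snd z) * (norm ((\<lambda>(\<xi>, y). G (\<xi>, \<sigma> * y)) z))\<^sup>2)) \<in> borel_measurable (lborel \<Otimes>\<^sub>M lborel)"
        by measurable
      then show "(\<lambda>(\<xi>, y). ennreal (indicator {0<..} y * (norm (G (\<xi>, \<sigma> * y)))\<^sup>2)) \<in> borel_measurable (lborel \<Otimes>\<^sub>M lborel)"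
        by (simp add: case_prod_beta')
    qed
    note [measurable] = PQm[OF m(1), of 1] PQm[OF m(2), of "-1"]
    have bound: "(\<integral>\<^sup>+\<xi>. ennreal (freq_weight \<gamma> \<xi> powr (s + 1) * (norm (h \<xi>))\<^sup>2) \<partial>lborel) \<le> ennreal (c / (K\<^sup>2 * \<gamma>^3) * ((2 * pi)\<^sup>2 * (Np\<^sup>2 + Nm\<^sup>2)))"
    proof -
      have pt: "ennreal (freq_weight \<gamma> \<xi> powr (s + 1) * (norm (h \<xi>))\<^sup>2) \<le>
         ennreal (c / (K\<^sup>2 * \<gamma>^3)) * (ennreal (freq_weight \<gamma> \<xi> powr s) * ?P \<xi> + ennreal (freq_weight \<gamma> \<xi> powr s) * ?Q \<xi>)" for \<xi>
      proof -
        obtain \<delta> \<eta> where \<xi>: "\<xi> = (\<delta>, \<eta>)" by force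
        have w: "freq_weight \<gamma> \<xi> > 0" using freq_weight_pos[OF \<gamma>1, of \<xi>] by simp
        have "ennreal (freq_weight \<gamma> \<xi> powr (s + 1) * (norm (h \<xi>))\<^sup>2) = ennreal (freq_weight \<gamma> \<xi> powr (s + 1)) * ennreal ((norm (h \<xi>))\<^sup>2)"
          by (rule ennreal_mult) auto
        also have "\<dots> \<le> ennreal (freq_weight \<gamma> \<xi> powr (s + 1)) * (ennreal (c / (K\<^sup>2 * \<gamma>^3 * freq_weight \<gamma> \<xi>)) * (?P \<xi> + ?Q \<xi>))"
          unfolding h_def \<xi> by (intro mult_left_mono solution_transform_bound(1)[OF c \<gamma> K low[OF \<gamma>] m]) auto
        also have "\<dots> = (ennreal (freq_weight \<gamma> \<xi> powr (s + 1)) * ennreal (c / (K\<^sup>2 * \<gamma>^3 * freq_weight \<gamma> \<xi>))) * (?P \<xi> + ?Q \<xi>)"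
          by (simp only: mult.assoc)
        also have "ennreal (freq_weight \<gamma> \<xi> powr (s + 1)) * ennreal (c / (K\<^sup>2 * \<gamma>^3 * freq_weight \<gamma> \<xi>)) = ennreal (freq_weight \<gamma> \<xi> powr (s + 1) * (c / (K\<^sup>2 * \<gamma>^3 * freq_weight \<gamma> \<xi>)))"
          using w c \<gamma> by (intro ennreal_mult[symmetric]) auto
        also have "freq_weight \<gamma> \<xi> powr (s + 1) * (c / (K\<^sup>2 * \<gamma>^3 * freq_weight \<gamma> \<xi>)) = c / (K\<^sup>2 * \<gamma>^3) * freq_weight \<gamma> \<xi> powr s"
          using w by (simp add: powr_add)
        also have "ennreal (c / (K\<^sup>2 * \<gamma>^3) * freq_weight \<gamma> \<xi> powr s) = ennreal (c / (K\<^sup>2 * \<gamma>^3)) * ennreal (freq_weight \<gamma> \<xi> powr s)"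
          using c \<gamma> by (intro ennreal_mult) auto
        finally show ?thesis by (simp only: mult.assoc distrib_left)
      qed
      have "(\<integral>\<^sup>+\<xi>. ennreal (freq_weight \<gamma> \<xi> powr (s + 1) * (norm (h \<xi>))\<^sup>2) \<partial>lborel) \<le>
        (\<integral>\<^sup>+\<xi>. ennreal (c / (K\<^sup>2 * \<gamma>^3)) * (ennreal (freq_weight \<gamma> \<xi> powr s) * ?P \<xi> + ennreal (freq_weight \<gamma> \<xi> powr s) * ?Q \<xi>) \<partial>lborel)"
        by (intro nn_integral_mono pt)
      also have "\<dots> = ennreal (c / (K\<^sup>2 * \<gamma>^3)) * ((\<integral>\<^sup>+\<xi>. ennreal (freq_weight \<gamma> \<xi> powr s) * ?P \<xi> \<partial>lborel) + (\<integral>\<^sup>+\<xi>. ennreal (freq_weight \<gamma> \<xi> powr s) * ?Q \<xi> \<partial>lborel))"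
        by (subst nn_integral_cmult, measurable, subst nn_integral_add, measurable)
      also have "\<dots> = ennreal (c / (K\<^sup>2 * \<gamma>^3)) * (ennreal ((2 * pi)\<^sup>2 * Np\<^sup>2) + ennreal ((2 * pi)\<^sup>2 * Nm\<^sup>2))"
        unfolding tangential_nn_integral[OF Fp \<gamma>1 Gp] tangential_nn_integral[OF Fm \<gamma>1 Gm] Np_def Nm_def ..
      also have "\<dots> = ennreal (c / (K\<^sup>2 * \<gamma>^3) * ((2 * pi)\<^sup>2 * (Np\<^sup>2 + Nm\<^sup>2)))"
        using c \<gamma> by (subst ennreal_mult) (auto simp: distrib_left)
      finally show ?thesis .
    qed
    have hi: "integrable lborel (\<lambda>\<xi>. freq_weight \<gamma> \<xi> powr (s + 1) * (norm (h \<xi>))\<^sup>2)"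
      unfolding integrable_iff_bounded using le_less_trans[OF bound ennreal_less_top] by simp
    have hi1: "integrable lborel (\<lambda>\<xi>. freq_weight 1 \<xi> powr (s + 1) * (norm (h \<xi>))\<^sup>2)"
      using hi integrable_freq_weight_iff[OF hm \<gamma>1] by simp
    obtain f where f: "f \<in> Hsg (s + 1) \<gamma>" "has_fourier_fun (exp_weight \<gamma> f) h" using Hsg_exists[OF hm hi1] by blast
    \<comment> \<open>The coefficient does not vanish, so at each frequency the equation is
      equivalent to a formula for the unknown. It is stated for arbitrary \<open>Gp'\<close> and
      \<open>Gm'\<close> because a competing solution may come with other representatives.\<close>
    have eqn: "(let \<tau> = Complex \<gamma> \<delta>; \<mu>p = mu 1 v c \<tau> \<eta>; \<mu>m = mu (-1) v c \<tau> \<eta> in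
          (\<tau>\<^sup>2 + (of_real v)\<^sup>2 * (of_real \<eta>)\<^sup>2 *
             (8 * \<tau>\<^sup>2 / ((of_real c)\<^sup>2 * (\<mu>p + \<mu>m)\<^sup>2) - 1)) * z
          + \<mu>p * \<mu>m / (\<mu>p + \<mu>m) * M_term v c Gp' Gm' \<gamma> \<delta> \<eta> = 0) \<longleftrightarrow> z = solution_transform v c Gp' Gm' \<gamma> (\<delta>, \<eta>)"
      for \<delta> \<eta> z Gp' Gm'
    proof -
      have S0: "lop_symbol v c (Complex \<gamma> \<delta>) \<eta> \<noteq> 0" by (rule solution_transform_bound(2)[OF c \<gamma> K low[OF \<gamma>] m])
      have lin: "S * z + X = 0 \<longleftrightarrow> z = - X / S" if "S \<noteq> 0" for S X :: complex
        unfolding nonzero_eq_divide_eq[OF that] by (simp add: eq_neg_iff_add_eq_0 mult.commute)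
      show ?thesis
        unfolding Let_def lop_symbol_def[symmetric] lin[OF S0] solution_transform_def fst_conv snd_conv ..
    qed
    have sol: "solves_equation v c \<gamma> Fp Fm f"
      unfolding solves_equation_def
      by (intro exI[of _ h] exI[of _ Gp] exI[of _ Gm] conjI f(2) Gp Gm) (simp only: eqn h_def split_beta prod.collapse, simp)
    \<comment> \<open>By \<open>tangential_unique\<close> other representatives change
      \<open>M_term\<close> only on a null set of frequencies, so the transforms of
      \<open>f'\<close> and \<open>f\<close> agree almost everywhere, and the transform determines
      the distribution.\<close>
    have uniq: "f' = f" if f': "f' \<in> Hsg (s + 1) \<gamma>" "solves_equation v c \<gamma> Fp Fm f'" for f'
    proof -
      obtain h' Gp' Gm' where h': "has_fourier_fun (exp_weight \<gamma> f') h'"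
        and G': "has_tangential_fourier 1 \<gamma> Fp Gp'" "has_tangential_fourier (-1) \<gamma> Fm Gm'"
        and E: "AE (\<delta>, \<eta>) in lborel. h' (\<delta>, \<eta>) = solution_transform v c Gp' Gm' \<gamma> (\<delta>, \<eta>)"
        using f'(2) unfolding solves_equation_def eqn by blast
      have "AE \<xi> in lborel. h' \<xi> = h \<xi>"
        using E tangential_unique[OF G'(1) Gp] tangential_unique[OF G'(2) Gm]
      proof eventually_elim
        case (elim \<xi>)
        obtain \<delta> \<eta> where \<xi>: "\<xi> = (\<delta>, \<eta>)" by force
        have "M_term v c Gp' Gm' \<gamma> \<delta> \<eta> = M_term v c Gp Gm \<gamma> \<delta> \<eta>"
          using elim(2,3) by (intro M_term_cong meas[OF G'(1)] meas[OF G'(2)] m) (simp_all add: \<xi>)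
        then show ?case using elim(1) by (simp add: \<xi> h_def solution_transform_def)
      qed
      then show ?thesis by (rule Hsg_unique[OF f'(1) f(1) h' f(2)])
    qed
    show "\<exists>!f. f \<in> Hsg (s + 1) \<gamma> \<and> solves_equation v c \<gamma> Fp Fm f"
      using f(1) sol uniq by blast
    \<comment> \<open>By uniqueness it is enough to estimate the constructed \<open>f\<close>, whose
      transform \<open>h\<close> satisfies \<open>bound\<close>.\<close>
    fix f' assume "f' \<in> Hsg (s + 1) \<gamma> \<and> solves_equation v c \<gamma> Fp Fm f'"
    then have "f' = f" using uniq by blast
    have "ennreal ((2 * pi)\<^sup>2 * (Hsg_norm (s + 1) \<gamma> f)\<^sup>2) \<le> ennreal (c / (K\<^sup>2 * \<gamma>^3) * ((2 * pi)\<^sup>2 * (Np\<^sup>2 + Nm\<^sup>2)))"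
      using bound unfolding Hsg_nn_integral[OF f(1) \<gamma>1 f(2)] .
    then have "(2 * pi)\<^sup>2 * (Hsg_norm (s + 1) \<gamma> f)\<^sup>2 \<le> c / (K\<^sup>2 * \<gamma>^3) * ((2 * pi)\<^sup>2 * (Np\<^sup>2 + Nm\<^sup>2))"
      using c \<gamma> by (subst (asm) ennreal_le_iff) auto
    then have "(2 * pi)\<^sup>2 * (Hsg_norm (s + 1) \<gamma> f)\<^sup>2 \<le> (2 * pi)\<^sup>2 * (c / (K\<^sup>2 * \<gamma>^3) * (Np\<^sup>2 + Nm\<^sup>2))"
      by (simp only: mult.left_commute)
    then have "(Hsg_norm (s + 1) \<gamma> f)\<^sup>2 \<le> c / (K\<^sup>2 * \<gamma>^3) * (Np\<^sup>2 + Nm\<^sup>2)"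
      by (rule mult_left_le_imp_le) simp
    then have "\<gamma> ^ 3 * (Hsg_norm (s + 1) \<gamma> f)\<^sup>2 \<le> \<gamma> ^ 3 * (c / (K\<^sup>2 * \<gamma>^3) * (Np\<^sup>2 + Nm\<^sup>2))"
      using \<gamma> by (intro mult_left_mono) auto
    also have "\<dots> = c / K\<^sup>2 * (Np\<^sup>2 + Nm\<^sup>2)" using \<gamma> by simp
    finally show "\<gamma> ^ 3 * (Hsg_norm (s + 1) \<gamma> f')\<^sup>2 \<le> c / K\<^sup>2 * ((L2_Hsg_norm 1 s \<gamma> Fp)\<^sup>2 + (L2_Hsg_norm (-1) s \<gamma> Fm)\<^sup>2)"
      by (simp only: \<open>f' = f\<close> Np_def Nm_def)
  qed
qed

end
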